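(* Let $(\bar\rho,\bar\phi)$ be a smooth Euler solution on $[0,T]$: $$\partial_t\bar\rho+\{\bar\phi,\bar\rho\}=0,\qquad\Delta\bar\phi=\bar\rho,\qquad\int_{\mathbb{T}^2}\bar\rho\,dx=\int_{\mathbb{T}^2}\bar\phi\,dx=0.$$ Let $\varepsilon>0$ and let $(\rho^\varepsilon,\psi^\varepsilon)$ be a smooth solution of $$\partial_t\rho^\varepsilon+\{\psi^\varepsilon,\rho^\varepsilon\}=0,\qquad\det(I+\varepsilon D^2\psi^\varepsilon)=1+\varepsilon\rho^\varepsilon,\qquad\int_{\mathbb{T}^2}\rho^\varepsilon dx=\int_{\mathbb{T}^2}\psi^\varepsilon dx=0,$$ with $\rho^\varepsilon(0)=\bar\rho(0)=\rho_0$. Assume $\varepsilon\|D^2\psi^\varepsilon(t)\|_{L^\infty}\le\eta_0$ for all $t\in[0,T]$. Then $$\sup_{0\le t\le T}\|\nabla\psi^\varepsilon(t)-\nabla\bar\phi(t)\|_{L^2}\le C_T\,\varepsilon,$$ where $C_T$ depends on $T$, $\|\rho_0\|_{L^\infty\cap L^2}$, and $\bar u=\nabla^\perp\bar\phi$ through $\|\nabla\bar u\|_{L^1(0,T;L^\infty)}$.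
   Context: $\mathbb{T}^2=\mathbb{R}^2/\mathbb{Z}^2$ with unit volume; $\nabla^\perp f=(-\partial_2f,\partial_1f)$ and $\{f,g\}=\nabla^\perp f\cdot\nabla g$. $\eta_0>0$ is a fixed, sufficiently small universal constant. In particular $C_T$ does not depend on $\varepsilon$. *)

theory Defs
  imports "HOL-Analysis.Analysis" "HOL-Probability.Essential_Supremum"
begin

text \<open>
  Functions on the torus \<open>R^2 / Z^2\<close> are represented by functions on the plane that are
  1-periodic in each coordinate.
\<close>

definition periodic :: "(real^2 \<Rightarrow> 'a) \<Rightarrow> bool"
  where "periodic f \<longleftrightarrow> (\<forall>x i. f (x + axis i 1) = f x)"

text \<open>The normalised measure of the torus, as Lebesgue measure on the closed unit square.\<close>

definition torus_measure :: "(real^2) measure"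
  where "torus_measure = restrict_space lborel (cbox 0 1)"

definition L2_norm :: "(real^2 \<Rightarrow> 'a::euclidean_space) \<Rightarrow> real"
  where "L2_norm f = sqrt (LINT x|torus_measure. (norm (f x))\<^sup>2)"

text \<open>
  The conversion from extended reals is harmless for the continuous periodic functions to which
  this is applied. For matrix-valued functions the pointwise norm is the Frobenius norm.
\<close>

definition Linf_norm :: "(real^2 \<Rightarrow> 'a::euclidean_space) \<Rightarrow> real"
  where "Linf_norm f = real_of_ereal (esssup torus_measure (\<lambda>x. ereal (norm (f x))))"

definition Linf_L2_norm :: "(real^2 \<Rightarrow> 'a::euclidean_space) \<Rightarrow> real"
  where "Linf_L2_norm f = max (Linf_norm f) (L2_norm f)"

definition L1_Linf_norm :: "real \<Rightarrow> (real \<Rightarrow> real^2 \<Rightarrow> 'a::euclidean_space) \<Rightarrow> real"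
  where "L1_Linf_norm T F = (LINT t:{0..T}|lborel. Linf_norm (F t))"

text \<open>
  \<open>Ck_on k S f\<close> uses derivatives within \<open>S\<close>. For \<open>T > 0\<close> these are
  uniquely determined on the closed slab \<open>[0,T] \<times> R^2\<close> used below (one-sided in time at
  \<open>0\<close> and \<open>T\<close>), and the predicate says that all partial derivatives up to order
  \<open>k\<close> exist and are continuous up to the boundary.
\<close>

primrec Ck_on :: "nat \<Rightarrow> 'a::real_normed_vector set \<Rightarrow> ('a \<Rightarrow> 'b::real_normed_vector) \<Rightarrow> bool"
  where
    "Ck_on 0 S f \<longleftrightarrow> continuous_on S f"
  | "Ck_on (Suc k) S f \<longleftrightarrow>
      (\<exists>f'. (\<forall>x\<in>S. (f has_derivative f' x) (at x within S)) \<and> (\<forall>v. Ck_on k S (\<lambda>x. f' x v)))"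

definition smooth_on :: "'a::real_normed_vector set \<Rightarrow> ('a \<Rightarrow> 'b::real_normed_vector) \<Rightarrow> bool"
  where "smooth_on S f \<longleftrightarrow> (\<forall>k. Ck_on k S f)"

definition smooth_torus_evolution :: "real \<Rightarrow> (real \<Rightarrow> real^2 \<Rightarrow> real) \<Rightarrow> bool"
  where "smooth_torus_evolution T f \<longleftrightarrow>
    smooth_on ({0..T} \<times> UNIV) (\<lambda>(t, x). f t x) \<and> (\<forall>t\<in>{0..T}. periodic (f t))"

definition pderiv_at :: "2 \<Rightarrow> (real^2 \<Rightarrow> real) \<Rightarrow> real^2 \<Rightarrow> real"
  where "pderiv_at i f x = frechet_derivative f (at x) (axis i 1)"

definition grad :: "(real^2 \<Rightarrow> real) \<Rightarrow> real^2 \<Rightarrow> real^2"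
  where "grad f x = (\<chi> i. pderiv_at i f x)"

definition perp_grad :: "(real^2 \<Rightarrow> real) \<Rightarrow> real^2 \<Rightarrow> real^2"
  where "perp_grad f x = vector [- pderiv_at 2 f x, pderiv_at 1 f x]"

definition bracket :: "(real^2 \<Rightarrow> real) \<Rightarrow> (real^2 \<Rightarrow> real) \<Rightarrow> real^2 \<Rightarrow> real"
  where "bracket f g x = perp_grad f x \<bullet> grad g x"

definition hessian :: "(real^2 \<Rightarrow> real) \<Rightarrow> real^2 \<Rightarrow> real^2^2"
  where "hessian f x = (\<chi> i j. pderiv_at i (pderiv_at j f) x)"

definition laplacian :: "(real^2 \<Rightarrow> real) \<Rightarrow> real^2 \<Rightarrow> real"
  where "laplacian f x = (\<Sum>i\<in>UNIV. pderiv_at i (pderiv_at i f) x)"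

definition time_deriv :: "real \<Rightarrow> (real \<Rightarrow> real^2 \<Rightarrow> real) \<Rightarrow> real \<Rightarrow> real^2 \<Rightarrow> real"
  where "time_deriv T f t x = vector_derivative (\<lambda>s. f s x) (at t within {0..T})"

definition smooth_euler_solution ::
  "real \<Rightarrow> (real \<Rightarrow> real^2 \<Rightarrow> real) \<Rightarrow> (real \<Rightarrow> real^2 \<Rightarrow> real) \<Rightarrow> bool"
  where "smooth_euler_solution T \<rho> \<phi> \<longleftrightarrow>
    smooth_torus_evolution T \<rho> \<and> smooth_torus_evolution T \<phi> \<and>
    (\<forall>t\<in>{0..T}.
      (\<forall>x. time_deriv T \<rho> t x + bracket (\<phi> t) (\<rho> t) x = 0) \<and>
      (\<forall>x. laplacian (\<phi> t) x = \<rho> t x) \<and>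
      (LINT x|torus_measure. \<rho> t x) = 0 \<and>
      (LINT x|torus_measure. \<phi> t x) = 0)"

definition smooth_monge_ampere_solution ::
  "real \<Rightarrow> real \<Rightarrow> (real \<Rightarrow> real^2 \<Rightarrow> real) \<Rightarrow> (real \<Rightarrow> real^2 \<Rightarrow> real) \<Rightarrow> bool"
  where "smooth_monge_ampere_solution \<epsilon> T \<rho> \<psi> \<longleftrightarrow>
    smooth_torus_evolution T \<rho> \<and> smooth_torus_evolution T \<psi> \<and>
    (\<forall>t\<in>{0..T}.
      (\<forall>x. time_deriv T \<rho> t x + bracket (\<psi> t) (\<rho> t) x = 0) \<and>
      (\<forall>x. det (mat 1 + \<epsilon> *\<^sub>R hessian (\<psi> t) x) = 1 + \<epsilon> * \<rho> t x) \<and>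
      (LINT x|torus_measure. \<rho> t x) = 0 \<and>
      (LINT x|torus_measure. \<psi> t x) = 0)"

end

theory Submission
  imports Defs "HOL-Probability.Probability_Measure"
begin

text \<open>
  Write the Monge--Ampere equation as \<open>\<Delta>\<psi> + \<epsilon> det D\<^sup>2\<psi> = \<rho>\<close>. If \<open>\<epsilon> \<bar>D\<^sup>2\<psi>\<bar> \<le> 1\<close>, then \<open>D\<^sup>2\<psi>\<close> is bounded
  in \<open>L\<^sup>2\<close> by \<open>2 \<parallel>\<rho>\<parallel>\<close>, and by the Wente inequality \<open>det D\<^sup>2\<psi> = {\<partial>\<^sub>1\<psi>, \<partial>\<^sub>2\<psi>}\<close> is bounded in \<open>H\<^sup>-\<^sup>1\<close> by
  \<open>\<parallel>D\<^sup>2\<psi>\<parallel>\<^sup>2\<close>. Hence \<open>\<nabla>\<psi>\<close> is \<open>O(\<epsilon>)\<close>-close in \<open>L\<^sup>2\<close> to \<open>\<nabla>\<Delta>\<^sup>-\<^sup>1\<rho>\<close>, without Calderon--Zygmund theory.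
  The distance of \<open>\<rho>\<close> to the Euler vorticity in \<open>H\<^sup>-\<^sup>1\<close> satisfies a Gronwall inequality: the error
  in the velocity is multiplied by \<open>\<rho>\<close>, whose maximum is conserved, and the transport by the Euler
  flow contributes only the velocity gradient. Truncating the \<open>H\<^sup>-\<^sup>1\<close> norm to finitely many Fourier
  modes makes all these steps elementary; the truncation errors are uniform in time and vanish in
  the limit.
\<close>

section \<open>Integration on the torus\<close>

text \<open>The determinant term has to be O(\<epsilon>) in H^-1. Smallness of \<epsilon> D^2 \<psi>
  alone bounds \<epsilon> det D^2 \<psi> by a multiple of D^2 \<psi>, which is only O(1). Bounding
  both second-derivative factors in L^2 puts det D^2 \<psi> in L^1, and in two dimensions L^1 just
  fails to embed in H^-1; the cancellation in the Poisson bracket makes up for this, hence the Wente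
  inequality. Smallness enters to close the L^2 bound of D^2 \<psi>; the threshold 1 is admissible
  because a 2x2 matrix A in the Frobenius norm satisfies 2 * \<bar>det A\<bar> \<le>
  \<bar>A\<bar>^2.

  Norms are kept squared until the end. The initial vorticities agree, so the energy starts at zero
  and a source of size \<epsilon>^2 gives a squared error of size \<epsilon>^2.

  The potential of a truncated vorticity is a trigonometric polynomial, so the Wente inequality has
  to be tested against such functions alone. Bounds on further derivatives of the two solutions may
  depend on \<epsilon>, but they occur only divided by N^2; N tends to infinity with \<epsilon>
  fixed, so they never reach the constant.\<close>

abbreviation avg :: "(real^2 \<Rightarrow> real) \<Rightarrow> real"
  where "avg f \<equiv> integral\<^sup>L torus_measure f"

lemma space_torus [simp]: "space torus_measure = cbox 0 1"
  by (simp add: torus_measure_def space_restrict_space)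

lemma prob_space_torus: "prob_space torus_measure"
proof (rule prob_spaceI)
  have "(1 - 0::real^2) \<bullet> b = 1" if "b \<in> Basis" for b
    using that by (auto simp: Basis_vec_def inner_axis)
  hence "(\<Prod>b\<in>Basis. (1 - 0::real^2) \<bullet> b) = 1"
    by (intro prod.neutral) simp
  moreover have "\<And>b. b \<in> Basis \<Longrightarrow> (0::real^2) \<bullet> b \<le> 1 \<bullet> b"
    by (auto simp: Basis_vec_def inner_axis)
  ultimately show "emeasure torus_measure (space torus_measure) = 1"
    by (simp add: torus_measure_def emeasure_restrict_space emeasure_lborel_cbox)
qed

interpretation torus: prob_space torus_measure
  by (rule prob_space_torus)

lemma integrable_torus:
  fixes f :: "real^2 \<Rightarrow> 'a::{banach, second_countable_topology}"
  assumes "continuous_on (cbox 0 1) f"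
  shows "integrable torus_measure f"
  unfolding torus_measure_def
  using borel_integrable_compact[OF compact_cbox assms]
  by (subst integrable_restrict_space) auto

lemma integrable_torus': "continuous_on UNIV f \<Longrightarrow> integrable torus_measure f"
  for f :: "real^2 \<Rightarrow> 'a::{banach, second_countable_topology}"
  by (rule integrable_torus) (blast intro: continuous_on_subset)

lemma avg_lborel: "avg f = (LINT x|lborel. indicator (cbox 0 1) x *\<^sub>R f x)"
  unfolding torus_measure_def by (subst integral_restrict_space) auto

lemma avg_eq_integral:
  assumes "continuous_on (cbox 0 1) f"
  shows "avg f = integral (cbox 0 1) f"
  using set_borel_integral_eq_integral(2)[of "cbox 0 1" f] borel_integrable_compact[OF compact_cbox assms]
  by (simp add: avg_lborel set_lebesgue_integral_def set_integrable_def)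

lemma avg_mono:
  assumes "continuous_on UNIV f" "continuous_on UNIV g" "\<And>x. x \<in> cbox 0 1 \<Longrightarrow> f x \<le> g x"
  shows "avg f \<le> avg g"
  using assms by (intro integral_mono integrable_torus') auto

lemma avg_nonneg: "(\<And>x. 0 \<le> f x) \<Longrightarrow> 0 \<le> avg f"
  by (rule Bochner_Integration.integral_nonneg)

text \<open>Discriminant argument: the average of the square of \<open>s * f + r * g\<close> is a
  nonnegative quadratic form in \<open>s\<close> and \<open>r\<close>.\<close>

lemma avg_Cauchy_Schwarz:
  assumes f: "continuous_on UNIV f" and g: "continuous_on UNIV g"
  shows "(avg (\<lambda>x. f x * g x))\<^sup>2 \<le> avg (\<lambda>x. (f x)\<^sup>2) * avg (\<lambda>x. (g x)\<^sup>2)"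
proof -
  let ?A = "avg (\<lambda>x. (f x)\<^sup>2)" and ?B = "avg (\<lambda>x. f x * g x)" and ?C = "avg (\<lambda>x. (g x)\<^sup>2)"
  have int: "integrable torus_measure (\<lambda>x. (f x)\<^sup>2)" "integrable torus_measure (\<lambda>x. f x * g x)"
    "integrable torus_measure (\<lambda>x. (g x)\<^sup>2)"
    by (intro integrable_torus' continuous_intros f g)+
  have *: "0 \<le> s\<^sup>2 * ?A + 2 * s * r * ?B + r\<^sup>2 * ?C" for s r
  proof -
    have "0 \<le> avg (\<lambda>x. (s * f x + r * g x)\<^sup>2)"
      by (rule avg_nonneg) simp
    also have "(\<lambda>x. (s * f x + r * g x)\<^sup>2)
        = (\<lambda>x. s\<^sup>2 * (f x)\<^sup>2 + (2 * s * r) * (f x * g x) + r\<^sup>2 * (g x)\<^sup>2)"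
      by (simp add: fun_eq_iff power2_eq_square algebra_simps)
    also have "avg \<dots> = s\<^sup>2 * ?A + 2 * s * r * ?B + r\<^sup>2 * ?C"
      using int by (simp add: Bochner_Integration.integral_add)
    finally show ?thesis .
  qed
  have C: "0 \<le> ?C" by (rule avg_nonneg) simp
  show ?thesis
  proof (cases "?C = 0")
    case False
    have "0 \<le> ?C * (?A * ?C - ?B\<^sup>2)"
      using *[of ?C "- ?B"] by (simp add: power2_eq_square algebra_simps)
    thus ?thesis using C False by (simp add: zero_le_mult_iff)
  next
    case True
    have "?B = 0"
    proof (rule ccontr)
      assume "?B \<noteq> 0"
      \<comment> \<open>With \<open>?C = 0\<close> and \<open>s = 1\<close> the form is affine in
        \<open>r\<close>; this \<open>r\<close> would give it the value -1.\<close>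
      hence "2 * (- (?A + 1) / (2 * ?B)) * ?B = - (?A + 1)" by (simp add: field_simps)
      with *[of 1 "- (?A + 1) / (2 * ?B)"] True show False by simp
    qed
    with True show ?thesis by simp
  qed
qed

section \<open>Fubini's theorem on \<open>real^2\<close>\<close>

lemma continuous_on_vector_2:
  fixes f g :: "'a::topological_space \<Rightarrow> real"
  assumes "continuous_on S f" "continuous_on S g"
  shows "continuous_on S (\<lambda>x. vector [f x, g x] :: real^2)"
proof -
  from assms have "continuous_on S (\<lambda>x. if i = 1 then f x else g x)" for i :: 2
    by (cases "i = 1") auto
  hence "continuous_on S (\<lambda>x. \<chi> i::2. if i = 1 then f x else g x)"
    by (intro continuous_on_vec_lambda)
  moreover have "(\<lambda>x. \<chi> i::2. if i = 1 then f x else g x) = (\<lambda>x. vector [f x, g x] :: real^2)"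
    by (simp add: fun_eq_iff vec_eq_iff forall_2)
  ultimately show ?thesis by (rule back_subst)
qed

lemma borel_measurable_vector_2:
  "(\<lambda>(x, y). vector [x, y] :: real^2) \<in> borel_measurable (lborel \<Otimes>\<^sub>M lborel)"
  unfolding lborel_prod
  by (auto intro!: borel_measurable_continuous_onI continuous_on_vector_2 continuous_intros
      simp: split_beta)

text \<open>Open boxes determine Lebesgue measure, and the preimage of a box is a product box. This
  transfers the Fubini theorem from pairs to vectors.\<close>

lemma lborel_vec_2: "lborel = distr (lborel \<Otimes>\<^sub>M lborel) borel (\<lambda>(x, y). vector [x, y] :: real^2)"
proof (rule lborel_eqI)
  let ?v = "\<lambda>(x, y). vector [x, y] :: real^2"
  note v = borel_measurable_vector_2
  fix l u :: "real^2"
  assume le: "\<And>b. b \<in> Basis \<Longrightarrow> l \<bullet> b \<le> u \<bullet> b"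
  have le': "l $ i \<le> u $ i" for i
    using le[of "axis i 1"] by (simp add: inner_axis)
  have vim: "?v -` box l u \<inter> space (lborel \<Otimes>\<^sub>M lborel) = box (l$1, l$2) (u$1, u$2)"
    by (auto simp: mem_box_cart forall_2 space_pair_measure mem_box Basis_prod_def)
  have B: "(Basis :: (real^2) set) = {axis 1 1, axis 2 1}"
    by (auto simp: Basis_vec_def UNIV_2)
  have ne: "(axis 1 1 :: real^2) \<noteq> axis 2 1"
    by (simp add: axis_eq_axis)
  have "emeasure (distr (lborel \<Otimes>\<^sub>M lborel) borel ?v) (box l u)
      = emeasure lborel (box (l$1, l$2) (u$1, u$2))"
    using v by (simp only: emeasure_distr vim borel_open open_box) (simp add: lborel_prod)
  also have "\<dots> = (\<Prod>b\<in>Basis. (u - l) \<bullet> b)"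
    using le' by (subst emeasure_lborel_box) (auto simp: B ne inner_axis Basis_prod_def)
  finally show "emeasure (distr (lborel \<Otimes>\<^sub>M lborel) borel ?v) (box l u) = (\<Prod>b\<in>Basis. (u - l) \<bullet> b)" .
qed simp

lemma avg_Fubini:
  assumes f: "continuous_on UNIV f"
  defines "F \<equiv> \<lambda>x y. indicator {0..1} x *\<^sub>R indicator {0..1} y *\<^sub>R f (vector [x, y])"
  shows "avg f = (LINT y|lborel. LINT x|lborel. F x y)"
    and "avg f = (LINT x|lborel. LINT y|lborel. F x y)"
proof -
  let ?v = "\<lambda>(x, y). vector [x, y] :: real^2"
  note v = borel_measurable_vector_2
  have int: "integrable lborel (\<lambda>x. indicator (cbox 0 1) x *\<^sub>R f x)"
    using borel_integrable_compact[OF compact_cbox continuous_on_subset[OF f]] by auto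
  have meas: "(\<lambda>x. indicator (cbox 0 1) x *\<^sub>R f x) \<in> borel_measurable borel"
    using borel_measurable_integrable[OF int] by simp
  have F: "(\<lambda>p. indicator (cbox 0 1) (?v p) *\<^sub>R f (?v p)) = case_prod F"
    by (auto simp: fun_eq_iff F_def indicator_def mem_box_cart forall_2)
  have intF: "integrable (lborel \<Otimes>\<^sub>M lborel) (case_prod F)"
    using int unfolding F[symmetric]
    by (subst (asm) lborel_vec_2) (simp only: integrable_distr_eq[OF v meas])
  have "avg f = integral\<^sup>L (distr (lborel \<Otimes>\<^sub>M lborel) borel ?v) (\<lambda>x. indicator (cbox 0 1) x *\<^sub>R f x)"
    by (simp only: avg_lborel lborel_vec_2[symmetric])
  also have "\<dots> = integral\<^sup>L (lborel \<Otimes>\<^sub>M lborel) (case_prod F)"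
    unfolding F[symmetric] by (rule integral_distr[OF v meas])
  finally have *: "avg f = integral\<^sup>L (lborel \<Otimes>\<^sub>M lborel) (case_prod F)" .
  show "avg f = (LINT y|lborel. LINT x|lborel. F x y)"
    using lborel_pair.integral_snd[OF intF] * by simp
  show "avg f = (LINT x|lborel. LINT y|lborel. F x y)"
    using lborel_pair.integral_fst[OF intF] * by simp
qed

section \<open>Partial derivatives of periodic functions\<close>

lemma pderiv_at_eqI: "(f has_derivative f') (at x) \<Longrightarrow> pderiv_at i f x = f' (axis i 1)"
  unfolding pderiv_at_def by (simp add: frechet_derivative_at[symmetric])

lemma pderiv_at_has_derivative:
  "f differentiable (at x) \<Longrightarrow> (f has_derivative (\<lambda>v. \<Sum>i\<in>UNIV. v $ i * pderiv_at i f x)) (at x)"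
proof -
  assume "f differentiable (at x)"
  hence d: "(f has_derivative frechet_derivative f (at x)) (at x)"
    by (simp add: frechet_derivative_works)
  then interpret bounded_linear "frechet_derivative f (at x)"
    by (rule has_derivative_bounded_linear)
  have "frechet_derivative f (at x) v = (\<Sum>i\<in>UNIV. v $ i * pderiv_at i f x)" for v
  proof -
    have "v = (\<Sum>i\<in>UNIV. v $ i *\<^sub>R axis i 1)"
      by (simp add: vec_eq_iff axis_def if_distrib sum.delta cong: if_cong)
    hence "frechet_derivative f (at x) v = frechet_derivative f (at x) (\<Sum>i\<in>UNIV. v $ i *\<^sub>R axis i 1)"
      by simp
    thus ?thesis by (simp add: sum scaleR pderiv_at_def)
  qed
  hence "frechet_derivative f (at x) = (\<lambda>v. \<Sum>i\<in>UNIV. v $ i * pderiv_at i f x)" ..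
  with d show ?thesis by simp
qed

lemma
  assumes "f differentiable (at x)" "g differentiable (at x)"
  shows pderiv_at_add: "pderiv_at i (\<lambda>x. f x + g x) x = pderiv_at i f x + pderiv_at i g x"
    and pderiv_at_diff: "pderiv_at i (\<lambda>x. f x - g x) x = pderiv_at i f x - pderiv_at i g x"
    and pderiv_at_mult: "pderiv_at i (\<lambda>x. f x * g x) x = pderiv_at i f x * g x + f x * pderiv_at i g x"
proof -
  note d = assms[unfolded frechet_derivative_works]
  show "pderiv_at i (\<lambda>x. f x + g x) x = pderiv_at i f x + pderiv_at i g x"
    by (subst pderiv_at_eqI[OF has_derivative_add[OF d]]) (simp add: pderiv_at_def)
  show "pderiv_at i (\<lambda>x. f x - g x) x = pderiv_at i f x - pderiv_at i g x"
    by (subst pderiv_at_eqI[OF has_derivative_diff[OF d]]) (simp add: pderiv_at_def)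
  show "pderiv_at i (\<lambda>x. f x * g x) x = pderiv_at i f x * g x + f x * pderiv_at i g x"
    by (subst pderiv_at_eqI[OF has_derivative_mult[OF d]]) (simp add: pderiv_at_def)
qed

lemma pderiv_at_const [simp]: "pderiv_at i (\<lambda>x. c) x = 0"
  by (rule pderiv_at_eqI) (rule has_derivative_const)

text \<open>A finite order of differentiability, spent one unit per derivative. It lets merely C^1
  functions, such as truncated powers of the vorticity, enter the same integration by parts as the
  smooth ones.\<close>

primrec torus_C :: "nat \<Rightarrow> (real^2 \<Rightarrow> real) \<Rightarrow> bool"
  where
    "torus_C 0 f \<longleftrightarrow> periodic f \<and> continuous_on UNIV f"
  | "torus_C (Suc n) f \<longleftrightarrow>
      periodic f \<and> (\<forall>x. f differentiable (at x)) \<and> (\<forall>i. torus_C n (pderiv_at i f))"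

lemma torus_C_periodic: "torus_C n f \<Longrightarrow> periodic f"
  by (cases n) auto

lemma torus_C_cont: "torus_C n f \<Longrightarrow> continuous_on UNIV f"
  by (cases n) (auto intro: differentiable_imp_continuous_on simp: differentiable_on_def)

lemma torus_C_diff: "torus_C (Suc n) f \<Longrightarrow> f differentiable (at x)"
  by simp

lemma torus_C_pderiv: "torus_C (Suc n) f \<Longrightarrow> torus_C n (pderiv_at i f)"
  by simp

lemma torus_C_lower: "torus_C n f \<Longrightarrow> m \<le> n \<Longrightarrow> torus_C m f"
proof (induction n arbitrary: f m)
  case (Suc n)
  show ?case
  proof (cases m)
    case 0
    thus ?thesis using Suc.prems torus_C_cont torus_C_periodic by (metis torus_C.simps(1))
  next
    case (Suc m')
    thus ?thesis using Suc.prems Suc.IH by auto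
  qed
qed auto

lemma torus_C_const: "torus_C n (\<lambda>x. c)"
proof (induction n arbitrary: c)
  case (Suc n)
  have "pderiv_at i (\<lambda>x. c) = (\<lambda>x. 0)" for i
    by (rule ext) simp
  thus ?case by (simp add: periodic_def Suc)
qed (simp add: periodic_def)

lemma torus_C_add: "torus_C n f \<Longrightarrow> torus_C n g \<Longrightarrow> torus_C n (\<lambda>x. f x + g x)"
proof (induction n arbitrary: f g)
  case (Suc n)
  hence "pderiv_at i (\<lambda>x. f x + g x) = (\<lambda>x. pderiv_at i f x + pderiv_at i g x)" for i
    by (auto simp: fun_eq_iff pderiv_at_add)
  with Suc show ?case by (auto simp: periodic_def)
qed (auto simp: periodic_def intro: continuous_intros)

lemma torus_C_mult: "torus_C n f \<Longrightarrow> torus_C n g \<Longrightarrow> torus_C n (\<lambda>x. f x * g x)"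
proof (induction n arbitrary: f g)
  case (Suc n)
  hence "pderiv_at i (\<lambda>x. f x * g x) = (\<lambda>x. pderiv_at i f x * g x + f x * pderiv_at i g x)" for i
    by (auto simp: fun_eq_iff pderiv_at_mult)
  moreover have "torus_C n f" "torus_C n g"
    using Suc.prems by (auto intro: torus_C_lower[OF _ le_SucI[OF order_refl]] simp del: torus_C.simps)
  ultimately show ?case using Suc by (auto simp: periodic_def intro!: torus_C_add)
qed (auto simp: periodic_def intro: continuous_intros)

lemma torus_C_cmult: "torus_C n f \<Longrightarrow> torus_C n (\<lambda>x. c * f x)"
  by (rule torus_C_mult[OF torus_C_const])

lemma torus_C_minus: "torus_C n f \<Longrightarrow> torus_C n (\<lambda>x. - f x)"
  using torus_C_cmult[of n f "-1"] by simp

lemma torus_C_diff_fun: "torus_C n f \<Longrightarrow> torus_C n g \<Longrightarrow> torus_C n (\<lambda>x. f x - g x)"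
  using torus_C_add[OF _ torus_C_minus, of n f g] by simp

lemma torus_C_sum: "(\<And>k. k \<in> K \<Longrightarrow> torus_C n (f k)) \<Longrightarrow> torus_C n (\<lambda>x. \<Sum>k\<in>K. f k x)"
  by (induction K rule: infinite_finite_induct) (auto intro: torus_C_add torus_C_const)

lemma pderiv_at_cmult: "f differentiable (at x) \<Longrightarrow> pderiv_at i (\<lambda>x. c * f x) x = c * pderiv_at i f x"
  by (subst pderiv_at_mult) auto

lemma pderiv_at_sum:
  "(\<And>k. k \<in> K \<Longrightarrow> f k differentiable (at x)) \<Longrightarrow>
    pderiv_at i (\<lambda>x. \<Sum>k\<in>K. f k x) x = (\<Sum>k\<in>K. pderiv_at i (f k) x)"
  by (induction K rule: infinite_finite_induct) (auto simp: pderiv_at_add)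

lemma vector_2_shift: "(vector [x, y] :: real^2) = vector [0, y] + x *\<^sub>R axis 1 1"
    "(vector [x, y] :: real^2) = vector [x, 0] + y *\<^sub>R axis 2 1"
  by (simp_all add: vec_eq_iff forall_2 axis_def)

lemma pderiv_at_line:
  assumes "f differentiable (at (a + s *\<^sub>R axis i 1))"
  shows "((\<lambda>s. f (a + s *\<^sub>R axis i 1)) has_vector_derivative pderiv_at i f (a + s *\<^sub>R axis i 1)) (at s within S)"
proof -
  have "((\<lambda>s. a + s *\<^sub>R axis i 1) has_derivative (\<lambda>s. s *\<^sub>R axis i (1::real))) (at s within S)"
    by (auto intro!: derivative_eq_intros)
  from has_derivative_compose[OF this assms[unfolded frechet_derivative_works]]
  show ?thesis
    unfolding has_vector_derivative_def pderiv_at_def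
    by (simp add: linear_cmul[OF linear_frechet_derivative[OF assms], simplified])
qed

text \<open>The order in Fubini is chosen so that the inner integral runs along direction
  \<open>i\<close>; there the fundamental theorem of calculus leaves two boundary values that cancel
  by periodicity.\<close>

lemma avg_pderiv_at:
  assumes f: "torus_C (Suc n) f"
  shows "avg (pderiv_at i f) = 0"
proof -
  have c: "continuous_on UNIV (pderiv_at j f)" and d: "f differentiable (at x)" and p: "periodic f" for j x
    using f torus_C_cont[of n "pderiv_at j f"] by auto
  have *: "(LINT s|lborel. indicator {0..1} s *\<^sub>R pderiv_at i f (a + s *\<^sub>R axis i 1)) = 0" for i a
  proof (subst integral_FTC_atLeastAtMost[where F = "\<lambda>s. f (a + s *\<^sub>R axis i 1)"])
    show "continuous_on {0..1} (\<lambda>x. pderiv_at i f (a + x *\<^sub>R axis i 1))"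
      by (rule continuous_on_compose2[OF c]) (auto intro!: continuous_intros)
    show "f (a + 1 *\<^sub>R axis i 1) - f (a + 0 *\<^sub>R axis i 1) = 0"
      using p by (simp add: periodic_def)
  qed (auto intro: pderiv_at_line d)
  consider "i = 1" | "i = 2" using exhaust_2 by blast
  thus ?thesis
  proof cases
    case 1
    have "(LINT x|lborel. indicator {0..1} x *\<^sub>R indicator {0..1} y *\<^sub>R pderiv_at i f (vector [x, y])) = 0" for y :: real
      using *[of 1 "vector [0, y]"] unfolding vector_2_shift(1)[symmetric] 1
      by (simp add: mult.left_commute[of _ "indicator {0..1} y"])
    thus ?thesis by (subst avg_Fubini(1)[OF c]) simp
  next
    case 2
    have "(LINT y|lborel. indicator {0..1} x *\<^sub>R indicator {0..1} y *\<^sub>R pderiv_at i f (vector [x, y])) = 0" for x :: real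
      using *[of 2 "vector [x, 0]"] unfolding vector_2_shift(2)[symmetric] 2 by simp
    thus ?thesis by (subst avg_Fubini(2)[OF c]) (simp only: Bochner_Integration.integral_zero)
  qed
qed

lemma integrable_torus_C: "torus_C n f \<Longrightarrow> integrable torus_measure f"
  by (intro integrable_torus' torus_C_cont)

lemma avg_by_parts:
  assumes f: "torus_C (Suc n) f" and g: "torus_C (Suc m) g"
  shows "avg (\<lambda>x. pderiv_at i f x * g x) = - avg (\<lambda>x. f x * pderiv_at i g x)"
proof -
  have f1: "torus_C 1 f" and g1: "torus_C 1 g"
    using assms torus_C_lower by (auto simp del: torus_C.simps)
  have f0: "torus_C 0 f" "torus_C 0 (pderiv_at i f)" and g0: "torus_C 0 g" "torus_C 0 (pderiv_at i g)"
    using f1 g1 torus_C_lower[of 1 _ 0] by (auto simp del: torus_C.simps(1))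
  have "0 = avg (pderiv_at i (\<lambda>x. f x * g x))"
    using avg_pderiv_at[of 0 "\<lambda>x. f x * g x"] torus_C_mult[OF f1 g1] by simp
  also have "pderiv_at i (\<lambda>x. f x * g x) = (\<lambda>x. pderiv_at i f x * g x + f x * pderiv_at i g x)"
    using f1 g1 by (simp add: pderiv_at_mult fun_eq_iff)
  also have "avg \<dots> = avg (\<lambda>x. pderiv_at i f x * g x) + avg (\<lambda>x. f x * pderiv_at i g x)"
    by (intro Bochner_Integration.integral_add integrable_torus_C[of 0] torus_C_mult f0 g0)
  finally show ?thesis by simp
qed

section \<open>A trilinear estimate on the integer lattice\<close>

definition nsq :: "int \<times> int \<Rightarrow> real"
  where "nsq k = (of_int (fst k))\<^sup>2 + (of_int (snd k))\<^sup>2"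

text \<open>The symbol of the Poisson bracket: the weight with which mode \<open>k\<close> of one
  factor meets mode \<open>l\<close> of the other.\<close>

definition cross :: "int \<times> int \<Rightarrow> int \<times> int \<Rightarrow> real"
  where "cross k l = of_int (fst k * snd l - snd k * fst l)"

lemma nsq_nonneg [simp]: "0 \<le> nsq k"
  by (simp add: nsq_def)

lemma nsq_eq_0 [simp]: "nsq k = 0 \<longleftrightarrow> k = 0"
  by (simp add: nsq_def sum_power2_eq_zero_iff prod_eq_iff)

lemma nsq_minus [simp]: "nsq (- k) = nsq k"
  by (simp add: nsq_def)

lemma nsq_ge_1: "k \<noteq> 0 \<Longrightarrow> 1 \<le> nsq k"
proof -
  have *: "nsq k = of_int ((fst k)\<^sup>2 + (snd k)\<^sup>2)"
    by (simp add: nsq_def)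
  assume "k \<noteq> 0"
  hence "0 < nsq k" using nsq_nonneg[of k] nsq_eq_0[of k] by linarith
  hence "1 \<le> (fst k)\<^sup>2 + (snd k)\<^sup>2" unfolding * of_int_0_less_iff by linarith
  thus ?thesis unfolding * of_int_1_le_iff .
qed

text \<open>Lagrange's identity: the squares of the cross and the dot product add up to
  \<open>nsq k * nsq l\<close>.\<close>

lemma abs_cross_le: "\<bar>cross k l\<bar> \<le> sqrt (nsq k) * sqrt (nsq l)"
proof -
  have "(cross k l)\<^sup>2 + (of_int (fst k * fst l + snd k * snd l))\<^sup>2 = nsq k * nsq l"
    by (simp add: cross_def nsq_def power2_eq_square algebra_simps)
  hence "(cross k l)\<^sup>2 \<le> nsq k * nsq l"
    using zero_le_power2[of "of_int (fst k * fst l + snd k * snd l) :: real"] by linarith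
  thus ?thesis
    by (metis real_sqrt_le_mono real_sqrt_mult real_sqrt_abs)
qed

lemma cross_add: "cross k (k + l) = cross k l" "cross (k + l) l = cross k l"
  by (simp_all add: cross_def algebra_simps)

lemma cross_minus: "cross (- k) l = - cross k l" "cross k (- l) = - cross k l"
  by (simp_all add: cross_def algebra_simps)

text \<open>The disc lies in a square of side \<open>2 * r + 1\<close> with \<open>r\<close> the
  rounded-down radius. Since \<open>k \<noteq> 0\<close> forces \<open>r \<ge> 1\<close>, the side
  is at most \<open>3 * r\<close>, whence the 9.\<close>

lemma nsq_count:
  assumes "k \<noteq> 0"
  shows "finite {m. nsq m \<le> nsq k}" and "real (card {m. nsq m \<le> nsq k}) \<le> 9 * nsq k"
proof -
  define r where "r = \<lfloor>sqrt (nsq k)\<rfloor>"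
  have r1: "1 \<le> r" using nsq_ge_1[OF assms] by (simp add: r_def le_floor_iff)
  have b: "\<bar>j\<bar> \<le> r" if "(of_int j)\<^sup>2 \<le> nsq k" for j :: int
  proof -
    have "of_int \<bar>j\<bar> \<le> sqrt (nsq k)"
      using real_sqrt_le_mono[OF that] by simp
    thus ?thesis by (simp add: r_def le_floor_iff)
  qed
  have sub: "{m. nsq m \<le> nsq k} \<subseteq> {-r..r} \<times> {-r..r}"
  proof
    fix m assume "m \<in> {m. nsq m \<le> nsq k}"
    hence m: "(of_int (fst m))\<^sup>2 + (of_int (snd m))\<^sup>2 \<le> nsq k" by (simp add: nsq_def)
    have "\<bar>fst m\<bar> \<le> r" "\<bar>snd m\<bar> \<le> r"
      using m zero_le_power2[of "of_int (fst m) :: real"] zero_le_power2[of "of_int (snd m) :: real"]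
      by (intro b; linarith)+
    thus "m \<in> {-r..r} \<times> {-r..r}" by (auto simp: mem_Times_iff)
  qed
  show "finite {m. nsq m \<le> nsq k}" by (rule finite_subset[OF sub]) auto
  have "card {m. nsq m \<le> nsq k} \<le> card ({-r..r} \<times> {-r..r})"
    by (rule card_mono[OF _ sub]) auto
  also have "\<dots> = (nat (2 * r + 1))\<^sup>2"
    by (simp add: card_cartesian_product power2_eq_square)
  finally have "real (card {m. nsq m \<le> nsq k}) \<le> real ((nat (2 * r + 1))\<^sup>2)"
    by (rule of_nat_mono)
  also have "\<dots> = (of_int (2 * r + 1))\<^sup>2" using r1 by simp
  also have "\<dots> \<le> (of_int (3 * r))\<^sup>2"
    using r1 by (intro power_mono) auto
  also have "\<dots> = 9 * (of_int r)\<^sup>2" by (simp add: power2_eq_square)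
  also have "(of_int r)\<^sup>2 \<le> (sqrt (nsq k))\<^sup>2"
    using r1 by (intro power_mono) (auto simp: r_def)
  finally show "real (card {m. nsq m \<le> nsq k}) \<le> 9 * nsq k" by simp
qed

text \<open>\<open>K\<close> is not invariant under translation: a shifted window can only lose
  terms of \<open>f\<close>, and what it gains outside \<open>K\<close> is zero.\<close>

lemma sum_shift_le:
  fixes f :: "int \<times> int \<Rightarrow> real"
  assumes K: "finite K" and f: "\<And>k. 0 \<le> f k" and f0: "\<And>k. k \<notin> K \<Longrightarrow> f k = 0"
  shows "(\<Sum>k\<in>K. f (k + l)) \<le> (\<Sum>m\<in>K. f m)" and "(\<Sum>k\<in>K. f (l + k)) \<le> (\<Sum>m\<in>K. f m)"
proof -
  have "(\<Sum>k\<in>K. f (k + l)) = (\<Sum>m\<in>(\<lambda>k. k + l) ` K. f m)"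
    by (simp add: sum.reindex inj_on_def)
  also have "\<dots> = (\<Sum>m\<in>(\<lambda>k. k + l) ` K \<inter> K. f m)"
    using K f0 by (intro sum.mono_neutral_right) auto
  also have "\<dots> \<le> (\<Sum>m\<in>K. f m)"
    using K f by (intro sum_mono2) auto
  finally show *: "(\<Sum>k\<in>K. f (k + l)) \<le> (\<Sum>m\<in>K. f m)" .
  thus "(\<Sum>k\<in>K. f (l + k)) \<le> (\<Sum>m\<in>K. f m)" by (simp add: add.commute)
qed

text \<open>The inner sum counts lattice points in a disc, or in a translate of one. The guard
  \<open>k \<noteq> 0\<close> is there because at the origin the disc has one point while the bound
  \<open>9 * nsq k\<close> is 0.\<close>

lemma sum_count_le:
  fixes a :: "int \<times> int \<Rightarrow> real"
  assumes K: "finite K"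
  shows "(\<Sum>k\<in>K. \<Sum>l\<in>K. if nsq l \<le> nsq k \<and> k \<noteq> 0 then (a k)\<^sup>2 else 0) \<le> 9 * (\<Sum>k\<in>K. nsq k * (a k)\<^sup>2)"
    and "(\<Sum>k\<in>K. \<Sum>l\<in>K. if nsq (k + l) \<le> nsq k \<and> k \<noteq> 0 then (a k)\<^sup>2 else 0) \<le> 9 * (\<Sum>k\<in>K. nsq k * (a k)\<^sup>2)"
proof -
  have 1: "(\<Sum>l\<in>K. if nsq l \<le> nsq k \<and> k \<noteq> 0 then (a k)\<^sup>2 else 0) \<le> 9 * (nsq k * (a k)\<^sup>2)" for k
  proof (cases "k = 0")
    case False
    have "(\<Sum>l\<in>K. if nsq l \<le> nsq k \<and> k \<noteq> 0 then (a k)\<^sup>2 else 0) = card (K \<inter> {m. nsq m \<le> nsq k}) * (a k)\<^sup>2"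
      using K False by (simp add: sum.inter_restrict[symmetric] sum.If_cases)
    also have "\<dots> \<le> card {m. nsq m \<le> nsq k} * (a k)\<^sup>2"
      by (intro mult_right_mono of_nat_mono card_mono nsq_count(1)[OF False]) auto
    also have "\<dots> \<le> (9 * nsq k) * (a k)\<^sup>2"
      by (intro mult_right_mono nsq_count(2)[OF False]) auto
    finally show ?thesis by simp
  qed simp
  have 2: "(\<Sum>l\<in>K. if nsq (k + l) \<le> nsq k \<and> k \<noteq> 0 then (a k)\<^sup>2 else 0) \<le> 9 * (nsq k * (a k)\<^sup>2)" for k
  proof (cases "k = 0")
    case False
    have "card (K \<inter> {l. nsq (k + l) \<le> nsq k}) \<le> card {m. nsq m \<le> nsq k}"
      by (rule card_inj_on_le[of "\<lambda>l. k + l"]) (auto simp: inj_on_def nsq_count(1)[OF False])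
    moreover have "(\<Sum>l\<in>K. if nsq (k + l) \<le> nsq k \<and> k \<noteq> 0 then (a k)\<^sup>2 else 0)
        = card (K \<inter> {l. nsq (k + l) \<le> nsq k}) * (a k)\<^sup>2"
      using K False by (simp add: sum.If_cases)
    ultimately have "(\<Sum>l\<in>K. if nsq (k + l) \<le> nsq k \<and> k \<noteq> 0 then (a k)\<^sup>2 else 0)
        \<le> card {m. nsq m \<le> nsq k} * (a k)\<^sup>2"
      by (simp add: mult_right_mono)
    also have "\<dots> \<le> (9 * nsq k) * (a k)\<^sup>2"
      by (intro mult_right_mono nsq_count(2)[OF False]) auto
    finally show ?thesis by simp
  qed simp
  show "(\<Sum>k\<in>K. \<Sum>l\<in>K. if nsq l \<le> nsq k \<and> k \<noteq> 0 then (a k)\<^sup>2 else 0) \<le> 9 * (\<Sum>k\<in>K. nsq k * (a k)\<^sup>2)"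
    unfolding sum_distrib_left by (intro sum_mono 1)
  show "(\<Sum>k\<in>K. \<Sum>l\<in>K. if nsq (k + l) \<le> nsq k \<and> k \<noteq> 0 then (a k)\<^sup>2 else 0) \<le> 9 * (\<Sum>k\<in>K. nsq k * (a k)\<^sup>2)"
    unfolding sum_distrib_left by (intro sum_mono 2)
qed

text \<open>Shaped for the trilinear estimate: the sum of \<open>x\<close> is bounded by counting,
  with constant 9, and the sum of \<open>y\<close> by a product of two weighted sums.\<close>

lemma double_sum_Cauchy_Schwarz:
  fixes x y :: "'a \<Rightarrow> 'a \<Rightarrow> real"
  assumes "(\<Sum>k\<in>K. \<Sum>l\<in>K. (x k l)\<^sup>2) \<le> 9 * U" "(\<Sum>k\<in>K. \<Sum>l\<in>K. (y k l)\<^sup>2) \<le> V" "0 \<le> U"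
  shows "(\<Sum>k\<in>K. \<Sum>l\<in>K. x k l * y k l) \<le> 3 * sqrt (U * V)"
proof -
  have "(\<Sum>p\<in>K\<times>K. case_prod x p * case_prod y p)\<^sup>2
      \<le> (\<Sum>p\<in>K\<times>K. (case_prod x p)\<^sup>2) * (\<Sum>p\<in>K\<times>K. (case_prod y p)\<^sup>2)"
    by (rule Cauchy_Schwarz_ineq_sum)
  hence "(\<Sum>k\<in>K. \<Sum>l\<in>K. x k l * y k l)\<^sup>2 \<le> (\<Sum>k\<in>K. \<Sum>l\<in>K. (x k l)\<^sup>2) * (\<Sum>k\<in>K. \<Sum>l\<in>K. (y k l)\<^sup>2)"
    by (simp add: sum.cartesian_product split_def)
  also have "\<dots> \<le> (9 * U) * V"
    using assms by (intro mult_mono sum_nonneg) auto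
  also have "\<dots> = (3 * sqrt (U * V))\<^sup>2"
  proof -
    have "0 \<le> V" using assms(2) order_trans[OF sum_nonneg] by (metis (no_types, lifting) sum_nonneg zero_le_power2)
    thus ?thesis using assms(3) by (simp add: power_mult_distrib)
  qed
  finally show ?thesis
    by (rule power2_le_imp_le) (use assms in \<open>auto intro!: mult_nonneg_nonneg order_trans[OF _ assms(2)] sum_nonneg\<close>)
qed

text \<open>
  Since \<open>k \<times> l = k \<times> m = m \<times> l\<close> for \<open>m = k + l\<close>, the factor \<open>\<bar>k \<times> l\<bar>\<close> is at most the product of the
  two smallest of \<open>\<bar>k\<bar>, \<bar>l\<bar>, \<bar>m\<bar>\<close>. One of \<open>\<bar>m\<bar> \<le> \<bar>k\<bar>\<close>, \<open>\<bar>l\<bar> \<le> \<bar>m\<bar>\<close>, \<open>\<bar>k\<bar> \<le> \<bar>l\<bar>\<close> always holds; in each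
  region the Cauchy--Schwarz inequality over pairs applies, because a ball of radius \<open>\<bar>k\<bar> \<ge> 1\<close>
  contains at most \<open>9 \<bar>k\<bar>\<^sup>2\<close> lattice points.
\<close>

lemma trilinear_sum_le:
  fixes a b g :: "int \<times> int \<Rightarrow> real"
  assumes K: "finite K"
    and nn: "\<And>k. 0 \<le> a k" "\<And>k. 0 \<le> b k" "\<And>k. 0 \<le> g k"
    and g0: "\<And>k. k \<notin> K \<Longrightarrow> g k = 0"
  defines "S \<equiv> \<lambda>f::int \<times> int \<Rightarrow> real. \<Sum>k\<in>K. nsq k * (f k)\<^sup>2"
  shows "(\<Sum>k\<in>K. \<Sum>l\<in>K. \<bar>cross k l\<bar> * a k * b l * g (k + l)) \<le> 9 * sqrt (S a * S b * S g)"
proof -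
  define n where "n k = sqrt (nsq k)" for k
  have n0 [simp]: "0 \<le> n k" "n k = 0 \<longleftrightarrow> k = 0" for k by (auto simp: n_def)
  have [simp]: "n 0 = 0" by simp
  have n2: "(n k * f k)\<^sup>2 = nsq k * (f k)\<^sup>2" for f :: "int \<times> int \<Rightarrow> real" and k
    by (simp add: n_def power_mult_distrib)
  have S: "S f = (\<Sum>k\<in>K. (n k * f k)\<^sup>2)" for f by (simp add: S_def n2)
  have S0: "0 \<le> S f" for f by (simp add: S_def sum_nonneg)
  \<comment> \<open>Each \<open>x\<close> holds, without weight, the factor at the larger of the two
    frequencies compared in its region, so that lattice points can be counted; the matching
    \<open>y\<close> holds the other two factors with their weights \<open>n\<close>.\<close>
  define x1 where "x1 k l = (if nsq (k + l) \<le> nsq k \<and> k \<noteq> 0 then a k else 0)" for k l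
  define x2 where "x2 k l = (if nsq l \<le> nsq (k + l) \<and> k + l \<noteq> 0 then g (k + l) else 0)" for k l
  define x3 where "x3 k l = (if nsq k \<le> nsq l \<and> l \<noteq> 0 then b l else 0)" for k l
  define y1 where "y1 k l = (n l * b l) * (n (k + l) * g (k + l))" for k l
  define y2 where "y2 k l = (n k * a k) * (n l * b l)" for k l
  define y3 where "y3 k l = (n k * a k) * (n (k + l) * g (k + l))" for k l
  have gsq: "(\<Sum>k\<in>K. (n (k + l) * g (k + l))\<^sup>2) \<le> S g" "(\<Sum>k\<in>K. (n (l + k) * g (l + k))\<^sup>2) \<le> S g" for l
    unfolding S using sum_shift_le[OF K, of "\<lambda>k. (n k * g k)\<^sup>2" l] g0 by auto

  have X1: "(\<Sum>k\<in>K. \<Sum>l\<in>K. (x1 k l)\<^sup>2) \<le> 9 * S a"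
    using sum_count_le(2)[OF K, of a] by (simp add: x1_def S_def if_distrib[of "\<lambda>x. x\<^sup>2"] cong: if_cong)
  have X3: "(\<Sum>k\<in>K. \<Sum>l\<in>K. (x3 k l)\<^sup>2) \<le> 9 * S b"
    using sum_count_le(1)[OF K, of b]
    by (subst sum.swap) (simp add: x3_def S_def if_distrib[of "\<lambda>x. x\<^sup>2"] cong: if_cong)
  have X2: "(\<Sum>k\<in>K. \<Sum>l\<in>K. (x2 k l)\<^sup>2) \<le> 9 * S g"
  proof -
    have "(\<Sum>k\<in>K. \<Sum>l\<in>K. (x2 k l)\<^sup>2)
        = (\<Sum>l\<in>K. \<Sum>k\<in>K. (\<lambda>m. if nsq l \<le> nsq m \<and> m \<noteq> 0 then (g m)\<^sup>2 else 0) (k + l))"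
      by (subst sum.swap) (simp add: x2_def if_distrib[of "\<lambda>x. x\<^sup>2"] cong: if_cong)
    also have "\<dots> \<le> (\<Sum>l\<in>K. \<Sum>m\<in>K. if nsq l \<le> nsq m \<and> m \<noteq> 0 then (g m)\<^sup>2 else 0)"
      using g0 by (intro sum_mono sum_shift_le[OF K]) auto
    also have "\<dots> = (\<Sum>m\<in>K. \<Sum>l\<in>K. if nsq l \<le> nsq m \<and> m \<noteq> 0 then (g m)\<^sup>2 else 0)"
      by (rule sum.swap)
    also have "\<dots> \<le> 9 * S g"
      unfolding S_def by (rule sum_count_le(1)[OF K])
    finally show ?thesis .
  qed
  have Y1: "(\<Sum>k\<in>K. \<Sum>l\<in>K. (y1 k l)\<^sup>2) \<le> S b * S g"
  proof -
    have "(\<Sum>k\<in>K. \<Sum>l\<in>K. (y1 k l)\<^sup>2) = (\<Sum>l\<in>K. (n l * b l)\<^sup>2 * (\<Sum>k\<in>K. (n (k + l) * g (k + l))\<^sup>2))"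
      by (subst sum.swap) (simp add: y1_def power_mult_distrib sum_distrib_left)
    also have "\<dots> \<le> (\<Sum>l\<in>K. (n l * b l)\<^sup>2 * S g)"
      by (intro sum_mono mult_left_mono gsq) auto
    finally show ?thesis by (simp add: S[of b] sum_distrib_right)
  qed
  have Y2: "(\<Sum>k\<in>K. \<Sum>l\<in>K. (y2 k l)\<^sup>2) \<le> S a * S b"
    by (simp add: y2_def S sum_product power_mult_distrib)
  have Y3: "(\<Sum>k\<in>K. \<Sum>l\<in>K. (y3 k l)\<^sup>2) \<le> S a * S g"
  proof -
    have "(\<Sum>k\<in>K. \<Sum>l\<in>K. (y3 k l)\<^sup>2) = (\<Sum>k\<in>K. (n k * a k)\<^sup>2 * (\<Sum>l\<in>K. (n (k + l) * g (k + l))\<^sup>2))"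
      by (simp add: y3_def power_mult_distrib sum_distrib_left)
    also have "\<dots> \<le> (\<Sum>k\<in>K. (n k * a k)\<^sup>2 * S g)"
      by (intro sum_mono mult_left_mono gsq) auto
    finally show ?thesis by (simp add: S[of a] sum_distrib_right)
  qed
  have nonneg: "0 \<le> x1 k l * y1 k l" "0 \<le> x2 k l * y2 k l" "0 \<le> x3 k l * y3 k l" for k l
    using nn by (auto simp: x1_def x2_def x3_def y1_def y2_def y3_def)
  have le: "\<bar>cross k l\<bar> * a k * b l * g (k + l) \<le> x1 k l * y1 k l + x2 k l * y2 k l + x3 k l * y3 k l" for k l
  proof (cases "cross k l = 0")
    case True
    thus ?thesis using nonneg[of k l] by simp
  next
    case False
    have c: "\<bar>cross k l\<bar> \<le> n k * n l" "\<bar>cross k l\<bar> \<le> n (k + l) * n l" "\<bar>cross k l\<bar> \<le> n k * n (k + l)"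
      using abs_cross_le[of k l] abs_cross_le[of "k + l" l] abs_cross_le[of k "k + l"]
      by (simp_all add: cross_add n_def)
    \<comment> \<open>A nonzero cross product makes all three frequencies nonzero, as the guards in
      the \<open>x\<close> demand.\<close>
    have kl: "k \<noteq> 0" "l \<noteq> 0" "k + l \<noteq> 0"
      using False c by auto
    have p: "0 \<le> a k * b l * g (k + l)" using nn by simp
    consider "nsq (k + l) \<le> nsq k" | "nsq l \<le> nsq (k + l)" | "nsq k \<le> nsq l" by linarith
    thus ?thesis
    proof cases
      case 1
      have "\<bar>cross k l\<bar> * (a k * b l * g (k + l)) \<le> (n (k + l) * n l) * (a k * b l * g (k + l))"
        by (rule mult_right_mono[OF c(2) p])
      also have "\<dots> = x1 k l * y1 k l"
        using 1 kl by (simp add: x1_def y1_def)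
      finally show ?thesis using nonneg[of k l] by (simp add: mult.assoc)
    next
      case 2
      have "\<bar>cross k l\<bar> * (a k * b l * g (k + l)) \<le> (n k * n l) * (a k * b l * g (k + l))"
        by (rule mult_right_mono[OF c(1) p])
      also have "\<dots> = x2 k l * y2 k l"
        using 2 kl by (simp add: x2_def y2_def)
      finally show ?thesis using nonneg[of k l] by (simp add: mult.assoc)
    next
      case 3
      have "\<bar>cross k l\<bar> * (a k * b l * g (k + l)) \<le> (n k * n (k + l)) * (a k * b l * g (k + l))"
        by (rule mult_right_mono[OF c(3) p])
      also have "\<dots> = x3 k l * y3 k l"
        using 3 kl by (simp add: x3_def y3_def)
      finally show ?thesis using nonneg[of k l] by (simp add: mult.assoc)
    qed
  qed
  have "(\<Sum>k\<in>K. \<Sum>l\<in>K. \<bar>cross k l\<bar> * a k * b l * g (k + l))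
      \<le> (\<Sum>k\<in>K. \<Sum>l\<in>K. x1 k l * y1 k l + x2 k l * y2 k l + x3 k l * y3 k l)"
    by (intro sum_mono le)
  also have "\<dots> = (\<Sum>k\<in>K. \<Sum>l\<in>K. x1 k l * y1 k l) + (\<Sum>k\<in>K. \<Sum>l\<in>K. x2 k l * y2 k l)
      + (\<Sum>k\<in>K. \<Sum>l\<in>K. x3 k l * y3 k l)"
    by (simp add: sum.distrib)
  also have "\<dots> \<le> 3 * sqrt (S a * (S b * S g)) + 3 * sqrt (S g * (S a * S b)) + 3 * sqrt (S b * (S a * S g))"
    by (intro add_mono double_sum_Cauchy_Schwarz X1 X2 X3 Y1 Y2 Y3 S0)
  also have "\<dots> = 9 * sqrt (S a * S b * S g)"
    by (simp add: mult_ac)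
  finally show ?thesis .
qed

section \<open>Hartley series on the torus\<close>

text \<open>
  The functions \<open>cos + sin\<close> form a real orthonormal basis in which \<open>\<partial>\<^sub>i\<close> maps the mode \<open>k\<close> to a
  multiple of the mode \<open>- k\<close>; this avoids complex-valued functions.
\<close>

definition cas :: "int \<times> int \<Rightarrow> real^2 \<Rightarrow> real"
  where "cas k x = cos (2 * pi * (of_int (fst k) * x$1 + of_int (snd k) * x$2))
    + sin (2 * pi * (of_int (fst k) * x$1 + of_int (snd k) * x$2))"

definition freq :: "2 \<Rightarrow> int \<times> int \<Rightarrow> real"
  where "freq i k = (if i = 1 then of_int (fst k) else of_int (snd k))"

lemma cas_0 [simp]: "cas 0 x = 1"
  by (simp add: cas_def)

lemma freq_minus [simp]: "freq i (- k) = - freq i k"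
  by (simp add: freq_def)

lemma freq_0 [simp]: "freq i 0 = 0"
  by (simp add: freq_def)

lemma sum_freq_sq: "(\<Sum>i\<in>UNIV. (freq i k)\<^sup>2) = nsq k"
  by (simp add: sum_2 freq_def nsq_def)

lemma periodic_cas: "periodic (cas k)"
proof -
  have "cas k (x + axis i 1) = cas k x" for x i
  proof -
    define m where "m = (if i = 1 then fst k else snd k)"
    have "2 * pi * (of_int (fst k) * (x + axis i 1)$1 + of_int (snd k) * (x + axis i 1)$2)
      = 2 * pi * (of_int (fst k) * x$1 + of_int (snd k) * x$2) + 2 * pi * of_int m"
      using exhaust_2[of i] by (auto simp: m_def axis_def algebra_simps)
    thus ?thesis unfolding cas_def by (simp only: cos_add sin_add) simp
  qed
  thus ?thesis by (simp add: periodic_def)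
qed

lemma cas_minus:
  "cas (- k) x = cos (2 * pi * (of_int (fst k) * x$1 + of_int (snd k) * x$2))
    - sin (2 * pi * (of_int (fst k) * x$1 + of_int (snd k) * x$2))"
proof -
  have "2 * pi * (of_int (fst (- k)) * x$1 + of_int (snd (- k)) * x$2)
      = - (2 * pi * (of_int (fst k) * x$1 + of_int (snd k) * x$2))"
    by (simp add: algebra_simps)
  thus ?thesis unfolding cas_def by (simp only: cos_minus sin_minus)
qed

lemma cas_has_derivative:
  "(cas k has_derivative (\<lambda>v. 2 * pi * (of_int (fst k) * v$1 + of_int (snd k) * v$2) * cas (- k) x)) (at x)"
proof -
  have vn: "((\<lambda>x. x $ i) has_derivative (\<lambda>v. v $ i)) F" for i :: 2 and F :: "(real^2) filter"
    by (rule bounded_linear_imp_has_derivative) (rule bounded_linear_vec_nth)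
  define \<theta> where "\<theta> x = 2 * pi * (of_int (fst k) * x$1 + of_int (snd k) * x$2)" for x :: "real^2"
  define \<theta>' where "\<theta>' v = 2 * pi * (of_int (fst k) * v$1 + of_int (snd k) * v$2)" for v :: "real^2"
  have "(\<theta> has_derivative \<theta>') (at x)"
    unfolding \<theta>_def \<theta>'_def
    by (intro has_derivative_mult_right has_derivative_add vn)
  hence "((\<lambda>x. cos (\<theta> x) + sin (\<theta> x)) has_derivative (\<lambda>v. \<theta>' v * (cos (\<theta> x) - sin (\<theta> x)))) (at x)"
    by (auto intro!: derivative_eq_intros simp: fun_eq_iff algebra_simps)
  thus ?thesis
    unfolding cas_minus by (simp add: cas_def[abs_def] \<theta>_def \<theta>'_def)
qed

lemma pderiv_at_cas: "pderiv_at i (cas k) = (\<lambda>x. 2 * pi * freq i k * cas (- k) x)"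
  using exhaust_2[of i]
  by (auto simp: fun_eq_iff pderiv_at_eqI[OF cas_has_derivative] freq_def axis_def)

lemma cas_differentiable: "cas k differentiable (at x)"
  using cas_has_derivative by (rule differentiableI)

lemma torus_C_cas: "torus_C n (cas k)"
proof (induction n arbitrary: k)
  case 0
  show ?case
    by (simp add: periodic_cas continuous_at_imp_continuous_on differentiable_imp_continuous_within cas_differentiable)
next
  case (Suc n)
  show ?case
    by (auto simp: periodic_cas cas_differentiable pderiv_at_cas intro!: torus_C_cmult Suc)
qed

text \<open>If some component of \<open>k\<close> is nonzero, \<open>cas k\<close> is up to a
  nonzero factor a partial derivative of \<open>cas (- k)\<close>, so its average vanishes.\<close>

lemma avg_cas: "avg (cas k) = (if k = 0 then 1 else 0)"
proof (cases "k = 0")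
  case True
  hence "cas k = (\<lambda>x. 1)" by (simp add: fun_eq_iff)
  thus ?thesis using True torus.prob_space by simp
next
  case False
  have "\<exists>i. freq i k \<noteq> 0"
  proof (rule ccontr)
    assume "\<nexists>i. freq i k \<noteq> 0"
    hence "nsq k = 0" by (simp flip: sum_freq_sq)
    with False show False by simp
  qed
  then obtain i where i: "freq i k \<noteq> 0" ..
  have "0 = avg (pderiv_at i (cas (- k)))"
    using avg_pderiv_at[OF torus_C_cas] by simp
  also have "\<dots> = 2 * pi * freq i (- k) * avg (cas k)"
    unfolding pderiv_at_cas by simp
  finally show ?thesis using i False by simp
qed

text \<open>With phases s and t the product is cos (s - t) + sin (s + t), the even part of one
  \<open>cas\<close> plus the odd part of another. This one formula gives orthogonality, closure
  under products and the triple averages in the Wente inequality.\<close>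

lemma cas_mult: "cas k x * cas l x = (cas (k - l) x + cas (l - k) x + cas (k + l) x - cas (- k - l) x) / 2"
proof -
  define s t where "s = 2 * pi * (of_int (fst k) * x$1 + of_int (snd k) * x$2)"
    and "t = 2 * pi * (of_int (fst l) * x$1 + of_int (snd l) * x$2)"
  have "cas k x = cos s + sin s" "cas l x = cos t + sin t"
    "cas (k - l) x = cos (s - t) + sin (s - t)" "cas (l - k) x = cos (t - s) + sin (t - s)"
    "cas (k + l) x = cos (s + t) + sin (s + t)" "cas (- k - l) x = cos (- s - t) + sin (- s - t)"
    by (simp_all add: cas_def s_def t_def algebra_simps)
  moreover have "cos (- s - t) = cos (s + t)" "sin (- s - t) = - sin (s + t)"
    using cos_minus[of "s + t"] sin_minus[of "s + t"] by simp_all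
  ultimately show ?thesis
    by (simp add: cos_add cos_diff sin_add sin_diff algebra_simps)
qed

lemma integrable_cas [simp]: "integrable torus_measure (cas k)"
  by (rule integrable_torus_C[OF torus_C_cas])

lemma avg_cas_mult: "avg (\<lambda>x. cas k x * cas l x) = (if k = l then 1 else 0)"
proof -
  have "- k - l = 0 \<longleftrightarrow> k + l = 0"
    by (auto simp: prod_eq_iff)
  moreover have "k - l = 0 \<longleftrightarrow> k = l" "l - k = 0 \<longleftrightarrow> k = l"
    by auto
  ultimately show ?thesis
    unfolding cas_mult by (simp add: avg_cas)
qed

lemma continuous_on_cas [continuous_intros]: "continuous_on S (cas k)"
  by (rule continuous_on_subset[OF torus_C_cont[OF torus_C_cas]]) auto

section \<open>Trigonometric polynomials and Bessel's inequality\<close>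

definition trig :: "(int \<times> int \<Rightarrow> real) \<Rightarrow> (int \<times> int) set \<Rightarrow> real^2 \<Rightarrow> real"
  where "trig c K x = (\<Sum>k\<in>K. c k * cas k x)"

definition coef :: "(real^2 \<Rightarrow> real) \<Rightarrow> int \<times> int \<Rightarrow> real"
  where "coef f k = avg (\<lambda>x. f x * cas k x)"

text \<open>Symmetric under negation, so that truncation commutes with \<open>pderiv_at\<close>,
  which exchanges the modes \<open>k\<close> and \<open>- k\<close>.\<close>

definition boxZ :: "nat \<Rightarrow> (int \<times> int) set"
  where "boxZ N = {- int N..int N} \<times> {- int N..int N}"

lemma finite_boxZ [simp]: "finite (boxZ N)"
  by (simp add: boxZ_def)

lemma boxZ_mono: "M \<le> N \<Longrightarrow> boxZ M \<subseteq> boxZ N"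
  by (auto simp: boxZ_def)

lemma uminus_boxZ [simp]: "- k \<in> boxZ N \<longleftrightarrow> k \<in> boxZ N"
  by (cases k) (auto simp: boxZ_def)

lemma sum_boxZ_uminus: "(\<Sum>k\<in>boxZ N. F (- k)) = (\<Sum>k\<in>boxZ N. F k)"
  by (rule sum.reindex_bij_witness[of _ uminus uminus]) auto

lemma finite_subset_boxZ: "finite K \<Longrightarrow> \<exists>N. K \<subseteq> boxZ N"
proof (induction K rule: finite_induct)
  case (insert k K)
  then obtain N where N: "K \<subseteq> boxZ N" by blast
  have "k \<in> boxZ (nat (\<bar>fst k\<bar> + \<bar>snd k\<bar>))"
    by (cases k) (auto simp: boxZ_def)
  hence "insert k K \<subseteq> boxZ (max N (nat (\<bar>fst k\<bar> + \<bar>snd k\<bar>)))"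
    using N boxZ_mono[of N "max N (nat (\<bar>fst k\<bar> + \<bar>snd k\<bar>))"]
      boxZ_mono[of "nat (\<bar>fst k\<bar> + \<bar>snd k\<bar>)" "max N (nat (\<bar>fst k\<bar> + \<bar>snd k\<bar>))"] by auto
  thus ?case by blast
qed simp

lemma nsq_not_in_boxZ: "k \<notin> boxZ N \<Longrightarrow> (real N)\<^sup>2 \<le> nsq k"
proof -
  assume "k \<notin> boxZ N"
  hence "int N \<le> \<bar>fst k\<bar> \<or> int N \<le> \<bar>snd k\<bar>"
    by (cases k) (auto simp: boxZ_def)
  hence "(real N)\<^sup>2 \<le> (of_int (fst k))\<^sup>2 \<or> (real N)\<^sup>2 \<le> (of_int (snd k))\<^sup>2"
    by (auto simp: abs_le_square_iff[symmetric])
  thus ?thesis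
    unfolding nsq_def using zero_le_power2[of "of_int (fst k) :: real"] zero_le_power2[of "of_int (snd k) :: real"]
    by linarith
qed

lemma torus_C_trig: "torus_C n (trig c K)"
  unfolding trig_def[abs_def] by (intro torus_C_sum torus_C_cmult torus_C_cas)

lemma continuous_on_trig [continuous_intros]: "continuous_on S (trig c K)"
  by (rule continuous_on_subset[OF torus_C_cont[OF torus_C_trig]]) auto

lemma trig_superset:
  assumes "finite L" "K \<subseteq> L"
  shows "trig c K = trig (\<lambda>k. if k \<in> K then c k else 0) L"
proof
  fix x
  have "trig (\<lambda>k. if k \<in> K then c k else 0) L x = (\<Sum>k\<in>L. if k \<in> K then c k * cas k x else 0)"
    by (simp add: trig_def if_distrib[of "\<lambda>z. z * _"] cong: if_cong)
  also have "\<dots> = (\<Sum>k\<in>L \<inter> K. c k * cas k x)"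
    using assms by (simp add: sum.inter_restrict)
  finally show "trig c K x = trig (\<lambda>k. if k \<in> K then c k else 0) L x"
    using assms(2) by (simp add: trig_def Int_absorb1)
qed

lemma avg_mult_trig:
  assumes f: "continuous_on UNIV f"
  shows "avg (\<lambda>x. f x * trig c K x) = (\<Sum>k\<in>K. c k * coef f k)"
proof -
  have "avg (\<lambda>x. f x * trig c K x) = avg (\<lambda>x. \<Sum>k\<in>K. c k * (f x * cas k x))"
    by (simp add: trig_def sum_distrib_left mult_ac)
  also have "\<dots> = (\<Sum>k\<in>K. avg (\<lambda>x. c k * (f x * cas k x)))"
    by (intro Bochner_Integration.integral_sum integrable_torus' continuous_intros f)
  finally show ?thesis by (simp add: coef_def)
qed

lemma coef_trig:
  assumes "finite K"
  shows "coef (trig c K) k = (if k \<in> K then c k else 0)"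
proof -
  have "coef (trig c K) k = (\<Sum>l\<in>K. c l * coef (cas k) l)"
    unfolding coef_def[of "trig c K"] by (subst mult.commute) (rule avg_mult_trig, intro continuous_intros)
  also have "\<dots> = (\<Sum>l\<in>K. if k = l then c l else 0)"
    by (intro sum.cong) (auto simp: coef_def avg_cas_mult)
  finally show ?thesis using assms by (simp add: sum.delta')
qed

lemma avg_trig_mult: "finite K \<Longrightarrow> avg (\<lambda>x. trig c K x * trig d K x) = (\<Sum>k\<in>K. c k * d k)"
  by (subst avg_mult_trig) (auto simp: coef_trig mult.commute intro!: continuous_intros sum.cong)

text \<open>Completing the square mode by mode. Taking \<open>c = coef f\<close> gives Bessel's
  inequality, and nonnegativity of the last sum gives optimality of the projection.\<close>

lemma avg_sq_diff_trig:
  assumes f: "continuous_on UNIV f" and K: "finite K"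
  shows "avg (\<lambda>x. (f x - trig c K x)\<^sup>2)
    = avg (\<lambda>x. (f x)\<^sup>2) - (\<Sum>k\<in>K. (coef f k)\<^sup>2) + (\<Sum>k\<in>K. (coef f k - c k)\<^sup>2)"
proof -
  have int: "integrable torus_measure (\<lambda>x. (f x)\<^sup>2)" "integrable torus_measure (\<lambda>x. f x * trig c K x)"
    "integrable torus_measure (\<lambda>x. trig c K x * trig c K x)"
    by (intro integrable_torus' continuous_intros f)+
  have "avg (\<lambda>x. (f x - trig c K x)\<^sup>2)
      = avg (\<lambda>x. (f x)\<^sup>2 - 2 * (f x * trig c K x) + trig c K x * trig c K x)"
    by (simp add: power2_eq_square algebra_simps)
  also have "\<dots> = avg (\<lambda>x. (f x)\<^sup>2) - 2 * avg (\<lambda>x. f x * trig c K x) + avg (\<lambda>x. trig c K x * trig c K x)"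
    using int by simp
  also have "\<dots> = avg (\<lambda>x. (f x)\<^sup>2) - 2 * (\<Sum>k\<in>K. c k * coef f k) + (\<Sum>k\<in>K. c k * c k)"
    by (simp add: avg_mult_trig[OF f] avg_trig_mult[OF K])
  also have "\<dots> = avg (\<lambda>x. (f x)\<^sup>2) - (\<Sum>k\<in>K. (coef f k)\<^sup>2) + (\<Sum>k\<in>K. (coef f k - c k)\<^sup>2)"
    by (simp add: power2_eq_square algebra_simps sum.distrib sum_subtractf sum_distrib_left)
  finally show ?thesis .
qed

lemma Bessel:
  assumes f: "continuous_on UNIV f" and K: "finite K"
  shows "(\<Sum>k\<in>K. (coef f k)\<^sup>2) \<le> avg (\<lambda>x. (f x)\<^sup>2)"
  using avg_sq_diff_trig[OF f K, of "coef f"] avg_nonneg[of "\<lambda>x. (f x - trig (coef f) K x)\<^sup>2"] by simp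

lemma best_approx:
  assumes f: "continuous_on UNIV f" and L: "finite L" and K: "K \<subseteq> L"
  shows "avg (\<lambda>x. (f x - trig (coef f) L x)\<^sup>2) \<le> avg (\<lambda>x. (f x - trig c K x)\<^sup>2)"
  unfolding trig_superset[OF L K, of c] avg_sq_diff_trig[OF f L]
  by (simp add: sum_nonneg)

text \<open>Trigonometric polynomials without their index sets, so that closure under products is a
  plain induction; \<open>trig_fun_imp_trig\<close> returns to coefficients on a box.\<close>

inductive trig_fun :: "(real^2 \<Rightarrow> real) \<Rightarrow> bool"
  where
    trig_fun_cas: "trig_fun (cas k)"
  | trig_fun_add: "trig_fun f \<Longrightarrow> trig_fun g \<Longrightarrow> trig_fun (\<lambda>x. f x + g x)"
  | trig_fun_cmult: "trig_fun f \<Longrightarrow> trig_fun (\<lambda>x. c * f x)"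

lemma trig_fun_const: "trig_fun (\<lambda>x. c)"
  using trig_fun_cmult[OF trig_fun_cas[of 0], of c] by simp

lemma trig_fun_sum: "(\<And>k. k \<in> K \<Longrightarrow> trig_fun (f k)) \<Longrightarrow> trig_fun (\<lambda>x. \<Sum>k\<in>K. f k x)"
  by (induction K rule: infinite_finite_induct) (auto intro: trig_fun_add trig_fun_const)

lemma trig_fun_mult: "trig_fun f \<Longrightarrow> trig_fun g \<Longrightarrow> trig_fun (\<lambda>x. f x * g x)"
proof (induction f rule: trig_fun.induct)
  case (trig_fun_cas k)
  thus ?case
  proof (induction g rule: trig_fun.induct)
    case (trig_fun_cas l)
    have "(\<lambda>x. cas k x * cas l x)
        = (\<lambda>x. (1/2) * (cas (k - l) x + (cas (l - k) x + (cas (k + l) x + (- 1) * cas (- k - l) x))))"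
      by (auto simp: fun_eq_iff cas_mult)
    thus ?case by (simp only:) (intro trig_fun.intros)
  next
    case (trig_fun_add f g)
    thus ?case by (auto simp: distrib_left intro: trig_fun.intros)
  next
    case (trig_fun_cmult f c)
    have "(\<lambda>x. cas k x * (c * f x)) = (\<lambda>x. c * (cas k x * f x))"
      by (simp add: mult_ac)
    with trig_fun_cmult show ?case by (auto intro: trig_fun.intros)
  qed
next
  case (trig_fun_add f h)
  thus ?case by (auto simp: distrib_right intro: trig_fun.intros)
next
  case (trig_fun_cmult f c)
  thus ?case by (auto simp: mult.assoc intro: trig_fun.intros)
qed

lemma trig_fun_imp_trig: "trig_fun f \<Longrightarrow> \<exists>N c. f = trig c (boxZ N)"
proof (induction f rule: trig_fun.induct)
  case (trig_fun_cas k)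
  obtain N where "{k} \<subseteq> boxZ N" using finite_subset_boxZ[of "{k}"] by auto
  moreover have "cas k = trig (\<lambda>_. 1) {k}" by (simp add: trig_def fun_eq_iff)
  ultimately show ?case using trig_superset[of "boxZ N" "{k}"] by auto
next
  case (trig_fun_add f g)
  then obtain M N c d where *: "f = trig c (boxZ M)" "g = trig d (boxZ N)" by blast
  let ?L = "boxZ (max M N)"
  obtain c' d' where "f = trig c' ?L" "g = trig d' ?L"
    using * trig_superset[OF finite_boxZ boxZ_mono[of M "max M N"]]
      trig_superset[OF finite_boxZ boxZ_mono[of N "max M N"]] by fastforce
  hence "(\<lambda>x. f x + g x) = trig (\<lambda>k. c' k + d' k) ?L"
    by (simp add: trig_def fun_eq_iff sum.distrib distrib_right)
  thus ?case by blast
next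
  case (trig_fun_cmult f c)
  then obtain N d where "f = trig d (boxZ N)" by blast
  hence "(\<lambda>x. c * f x) = trig (\<lambda>k. c * d k) (boxZ N)"
    by (simp add: trig_def fun_eq_iff sum_distrib_left mult.assoc)
  thus ?case by blast
qed

text \<open>The embedding of the torus in R^4 as a product of two circles. Polynomials in the four
  coordinates pull back to trigonometric polynomials.\<close>

definition circ :: "real^2 \<Rightarrow> (real^2) \<times> (real^2)"
  where "circ x = ((\<chi> i. cos (2 * pi * x $ i)), (\<chi> i. sin (2 * pi * x $ i)))"

lemma trig_fun_circ: "trig_fun (\<lambda>x. fst (circ x) $ i)" "trig_fun (\<lambda>x. snd (circ x) $ i)"
proof -
  define k :: "int \<times> int" where "k = (if i = 1 then (1, 0) else (0, 1))"
  have k: "2 * pi * (of_int (fst k) * x$1 + of_int (snd k) * x$2) = 2 * pi * x $ i" for x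
    using exhaust_2[of i] by (auto simp: k_def)
  have c: "cas k x = cos (2 * pi * x $ i) + sin (2 * pi * x $ i)"
    "cas (- k) x = cos (2 * pi * x $ i) - sin (2 * pi * x $ i)" for x
    using cas_def[of k x] cas_minus[of k x] by (simp_all only: k)
  have "fst (circ x) $ i = (1/2) * (cas k x + cas (- k) x)" for x
    unfolding c by (simp add: circ_def)
  thus "trig_fun (\<lambda>x. fst (circ x) $ i)"
    using trig_fun_cmult[OF trig_fun_add[OF trig_fun_cas[of k] trig_fun_cas[of "- k"]], of "1/2"] by (simp only:)
  have "snd (circ x) $ i = (1/2) * (cas k x + (- 1) * cas (- k) x)" for x
    unfolding c by (simp add: circ_def)
  thus "trig_fun (\<lambda>x. snd (circ x) $ i)"
    using trig_fun_cmult[OF trig_fun_add[OF trig_fun_cas[of k] trig_fun_cmult[OF trig_fun_cas[of "- k"], of "- 1"]], of "1/2"]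
    by (simp only:)
qed

lemma trig_fun_polynomial: "real_polynomial_function p \<Longrightarrow> trig_fun (\<lambda>x. p (circ x))"
proof (induction p rule: real_polynomial_function.induct)
  case (linear L)
  then interpret bounded_linear L .
  have "L (circ x) = (\<Sum>i\<in>UNIV. L (axis i 1, 0) * fst (circ x) $ i) + (\<Sum>i\<in>UNIV. L (0, axis i 1) * snd (circ x) $ i)" for x
  proof -
    have "circ x = (\<Sum>i\<in>UNIV. fst (circ x) $ i *\<^sub>R (axis i 1, 0)) + (\<Sum>i\<in>UNIV. snd (circ x) $ i *\<^sub>R (0, axis i 1))"
      by (simp add: prod_eq_iff vec_eq_iff forall_2 sum_2 fst_sum snd_sum axis_def)
    hence "L (circ x) = L ((\<Sum>i\<in>UNIV. fst (circ x) $ i *\<^sub>R (axis i 1, 0)) + (\<Sum>i\<in>UNIV. snd (circ x) $ i *\<^sub>R (0, axis i 1)))"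
      by (rule arg_cong)
    thus ?thesis unfolding add sum scaleR by (simp add: mult.commute)
  qed
  thus ?case
    by (simp only:) (intro trig_fun_add trig_fun_sum trig_fun_cmult trig_fun_circ)
qed (auto intro: trig_fun_const trig_fun_add trig_fun_mult)

section \<open>Reduction to the unit square, density and completeness\<close>

lemma periodic_of_int:
  fixes f :: "real^2 \<Rightarrow> real"
  assumes "periodic f"
  shows "f (x + of_int n *\<^sub>R axis i 1) = f x"
proof -
  have nat: "f (x + of_nat n *\<^sub>R axis i 1) = f x" for n :: nat and x
  proof (induction n)
    case (Suc n)
    have "f (x + of_nat (Suc n) *\<^sub>R axis i 1) = f ((x + of_nat n *\<^sub>R axis i 1) + axis i 1)"
      by (simp add: algebra_simps)
    also have "\<dots> = f (x + of_nat n *\<^sub>R axis i 1)"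
      using assms by (simp only: periodic_def)
    finally show ?case using Suc by simp
  qed simp
  show ?thesis
  proof (cases n)
    case (nonneg m)
    thus ?thesis using nat[of x m] by simp
  next
    case (neg m)
    have "f (x + of_int n *\<^sub>R axis i 1) = f ((x + of_int n *\<^sub>R axis i 1) + of_nat (Suc m) *\<^sub>R axis i 1)"
      by (rule nat[symmetric])
    also have "(x + of_int n *\<^sub>R axis i 1) + of_nat (Suc m) *\<^sub>R axis i 1 = x"
      by (simp only: neg add.assoc scaleR_add_left[symmetric]) simp
    finally show ?thesis .
  qed
qed

lemma periodic_eq:
  fixes f :: "real^2 \<Rightarrow> real"
  assumes f: "periodic f" and d: "\<And>i. y $ i - x $ i \<in> \<int>"
  shows "f y = f x"
proof -
  obtain m n where mn: "y $ 1 - x $ 1 = of_int m" "y $ 2 - x $ 2 = of_int n"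
    using d Ints_cases by metis
  have "y = (x + of_int m *\<^sub>R axis 1 1) + of_int n *\<^sub>R axis 2 1"
    using mn by (simp add: vec_eq_iff forall_2 axis_def algebra_simps)
  thus ?thesis by (simp only: periodic_of_int[OF f])
qed

lemma periodic_in_cbox:
  fixes x :: "real^2"
  obtains y where "y \<in> cbox 0 1" "\<And>i. y $ i - x $ i \<in> \<int>"
proof (rule that)
  show "(\<chi> i. frac (x $ i)) \<in> cbox (0::real^2) 1"
    by (auto simp: mem_box_cart frac_ge_0 less_imp_le[OF frac_lt_1])
  show "(\<chi> i. frac (x $ i)) $ i - x $ i \<in> \<int>" for i
    by (simp add: frac_def)
qed

lemma periodic_all_cbox:
  fixes f :: "real^2 \<Rightarrow> real"
  assumes "periodic f" "\<And>x. x \<in> cbox 0 1 \<Longrightarrow> P (f x)"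
  shows "P (f x)"
proof -
  obtain y where "y \<in> cbox 0 1" "\<And>i. y $ i - x $ i \<in> \<int>" using periodic_in_cbox[of x] by blast
  thus ?thesis using assms periodic_eq[OF assms(1), of y x] by metis
qed

text \<open>A continuous periodic function descends to the compact image of \<open>circ\<close>,
  where the Stone-Weierstrass theorem applies.\<close>

lemma trig_dense:
  assumes f: "torus_C 0 f" and e: "0 < e"
  shows "\<exists>N c. \<forall>x. \<bar>f x - trig c (boxZ N) x\<bar> < e"
proof -
  have per: "periodic f" and cont: "continuous_on UNIV f" using f by auto
  let ?Q = "cbox 0 1 :: (real^2) set"
  define S where "S = circ ` ?Q"
  have circ: "continuous_on A circ" for A
    unfolding circ_def by (intro continuous_intros)
  have S: "compact S" unfolding S_def by (intro compact_continuous_image circ compact_cbox)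
  have circ_eq: "f x = f y" if "circ x = circ y" for x y
  proof (rule periodic_eq[OF per])
    fix i
    have "sin (2 * pi * x $ i) = sin (2 * pi * y $ i) \<and> cos (2 * pi * x $ i) = cos (2 * pi * y $ i)"
      using that by (simp add: circ_def vec_eq_iff)
    then obtain n :: int where "2 * pi * x $ i = 2 * pi * y $ i + 2 * pi * of_int n"
      unfolding sin_cos_eq_iff by auto
    hence "2 * pi * x $ i = 2 * pi * (y $ i + of_int n)" by (simp add: algebra_simps)
    hence "x $ i - y $ i = of_int n" by simp
    thus "x $ i - y $ i \<in> \<int>" by simp
  qed
  \<comment> \<open>The choice of preimage is immaterial: points with the same image differ by
    integers, so opposite edges of the square are identified consistently with
    \<open>f\<close>.\<close>
  define g where "g z = f (SOME x. x \<in> ?Q \<and> circ x = z)" for z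
  have g: "g (circ x) = f x" if "x \<in> ?Q" for x
    unfolding g_def using someI[of "\<lambda>y. y \<in> ?Q \<and> circ y = circ x" x] that by (intro circ_eq) auto
  have "continuous_on S g"
    unfolding continuous_on_closed_vimage[OF compact_imp_closed[OF S]]
  proof (intro allI impI)
    fix B :: "real set" assume B: "closed B"
    \<comment> \<open>Preimages of closed sets under \<open>g\<close> are images of compact sets
      under \<open>circ\<close>, hence closed; this is continuity of \<open>g\<close>.\<close>
    have "g -` B \<inter> S = circ ` (f -` B \<inter> ?Q)"
      using g by (auto simp: S_def)
    moreover have "closed (f -` B)"
      using cont B by (simp add: continuous_on_closed_vimage[of UNIV, simplified])
    hence "compact (f -` B \<inter> ?Q)" by (rule closed_Int_compact) simp
    ultimately show "closed (g -` B \<inter> S)"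
      by (simp add: compact_imp_closed compact_continuous_image circ)
  qed
  from Stone_Weierstrass_real_polynomial_function[OF S this e]
  obtain p where p: "real_polynomial_function p" "\<And>z. z \<in> S \<Longrightarrow> \<bar>g z - p z\<bar> < e" by blast
  obtain N c where N: "(\<lambda>x. p (circ x)) = trig c (boxZ N)"
    using trig_fun_imp_trig[OF trig_fun_polynomial[OF p(1)]] by blast
  have "\<bar>f x - trig c (boxZ N) x\<bar> < e" for x
  proof (rule periodic_all_cbox[of "\<lambda>x. f x - trig c (boxZ N) x" "\<lambda>z. \<bar>z\<bar> < e"])
    show "periodic (\<lambda>x. f x - trig c (boxZ N) x)"
      using per torus_C_periodic[OF torus_C_trig] by (simp add: periodic_def)
    fix x assume x: "x \<in> ?Q"
    thus "\<bar>f x - trig c (boxZ N) x\<bar> < e"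
      using p(2)[of "circ x"] g[OF x] N[THEN fun_cong, of x] by (simp add: S_def)
  qed
  thus ?thesis by blast
qed

abbreviation proj :: "nat \<Rightarrow> (real^2 \<Rightarrow> real) \<Rightarrow> real^2 \<Rightarrow> real"
  where "proj N f \<equiv> trig (coef f) (boxZ N)"

text \<open>A uniform approximant is a competitor in L^2, and the projection to any larger box is at
  least as good.\<close>

lemma proj_tendsto:
  assumes f: "torus_C 0 f"
  shows "(\<lambda>N. avg (\<lambda>x. (f x - proj N f x)\<^sup>2)) \<longlonglongrightarrow> 0"
proof (rule LIMSEQ_I)
  fix r :: real assume r: "0 < r"
  define e where "e = sqrt (r / 2)"
  have e: "0 < e" "e\<^sup>2 = r / 2" using r by (auto simp: e_def)
  have cont: "continuous_on UNIV f" using f by simp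
  obtain M c where M: "\<And>x. \<bar>f x - trig c (boxZ M) x\<bar> < e"
    using trig_dense[OF f e(1)] by blast
  have "avg (\<lambda>x. (f x - proj N f x)\<^sup>2) < r" if "M \<le> N" for N
  proof -
    have "avg (\<lambda>x. (f x - proj N f x)\<^sup>2) \<le> avg (\<lambda>x. (f x - trig c (boxZ M) x)\<^sup>2)"
      by (rule best_approx[OF cont finite_boxZ boxZ_mono[OF that]])
    also have "\<dots> \<le> avg (\<lambda>x. e\<^sup>2)"
      using M e(1) by (intro avg_mono continuous_intros cont) (simp add: abs_le_square_iff[symmetric] less_imp_le)
    also have "\<dots> < r" using e r torus.prob_space by simp
    finally show ?thesis .
  qed
  thus "\<exists>no. \<forall>n\<ge>no. norm (avg (\<lambda>x. (f x - proj n f x)\<^sup>2) - 0) < r"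
    by (auto simp: avg_nonneg intro!: exI[of _ M])
qed

section \<open>Dirichlet energy in Fourier coefficients\<close>

lemma coef_pderiv_at:
  assumes f: "torus_C (Suc n) f"
  shows "coef (pderiv_at i f) k = - (2 * pi * freq i k) * coef f (- k)"
proof -
  have "(\<lambda>x. f x * (2 * pi * freq i k * cas (- k) x)) = (\<lambda>x. (2 * pi * freq i k) * (f x * cas (- k) x))"
    by (simp add: fun_eq_iff)
  thus ?thesis
    unfolding coef_def avg_by_parts[OF f torus_C_cas] pderiv_at_cas by simp
qed

definition dirichlet :: "(real^2 \<Rightarrow> real) \<Rightarrow> real"
  where "dirichlet f = (\<Sum>i\<in>UNIV. avg (\<lambda>x. (pderiv_at i f x)\<^sup>2))"

lemma dirichlet_nonneg [simp]: "0 \<le> dirichlet f"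
  by (simp add: dirichlet_def sum_nonneg avg_nonneg)

lemma pderiv_at_trig:
  "pderiv_at i (trig c (boxZ N)) = trig (\<lambda>k. - (2 * pi * freq i k) * c (- k)) (boxZ N)"
proof
  fix x
  have "pderiv_at i (trig c (boxZ N)) x = (\<Sum>k\<in>boxZ N. pderiv_at i (\<lambda>x. c k * cas k x) x)"
    unfolding trig_def[abs_def]
    by (rule pderiv_at_sum) (auto intro!: torus_C_diff torus_C_cmult torus_C_cas simp del: torus_C.simps)
  also have "\<dots> = (\<Sum>k\<in>boxZ N. 2 * pi * freq i k * c k * cas (- k) x)"
    by (intro sum.cong refl, subst pderiv_at_cmult) (auto simp: cas_differentiable pderiv_at_cas)
  also have "\<dots> = (\<Sum>k\<in>boxZ N. 2 * pi * freq i (- k) * c (- k) * cas k x)"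
    using sum_boxZ_uminus[of "\<lambda>k. 2 * pi * freq i k * c k * cas (- k) x" N] by simp
  finally show "pderiv_at i (trig c (boxZ N)) x = trig (\<lambda>k. - (2 * pi * freq i k) * c (- k)) (boxZ N) x"
    by (simp add: trig_def)
qed

lemma pderiv_at_proj:
  "torus_C (Suc n) f \<Longrightarrow> pderiv_at i (proj N f) = proj N (pderiv_at i f)"
  using coef_pderiv_at[of n f i] by (simp add: pderiv_at_trig trig_def fun_eq_iff del: torus_C.simps)

lemma sum_freq_coef_sq:
  "(\<Sum>i\<in>UNIV. \<Sum>k\<in>boxZ N. (- (2 * pi * freq i k) * c (- k))\<^sup>2) = 4 * pi\<^sup>2 * (\<Sum>k\<in>boxZ N. nsq k * (c k)\<^sup>2)"
proof -
  have "(\<Sum>i\<in>UNIV. \<Sum>k\<in>boxZ N. (- (2 * pi * freq i k) * c (- k))\<^sup>2)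
      = (\<Sum>k\<in>boxZ N. 4 * pi\<^sup>2 * ((\<Sum>i\<in>UNIV. (freq i (- k))\<^sup>2) * (c (- k))\<^sup>2))"
    by (subst sum.swap) (simp add: power_mult_distrib sum_distrib_left sum_distrib_right mult.assoc)
  also have "\<dots> = (\<Sum>k\<in>boxZ N. 4 * pi\<^sup>2 * (nsq k * (c k)\<^sup>2))"
    unfolding sum_freq_sq by (rule sum_boxZ_uminus)
  finally show ?thesis by (simp add: sum_distrib_left)
qed

lemma dirichlet_trig: "dirichlet (trig c (boxZ N)) = 4 * pi\<^sup>2 * (\<Sum>k\<in>boxZ N. nsq k * (c k)\<^sup>2)"
  unfolding dirichlet_def pderiv_at_trig sum_freq_coef_sq[symmetric]
  by (simp add: power2_eq_square avg_trig_mult)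

lemma Bessel_dirichlet:
  assumes f: "torus_C (Suc n) f"
  shows "4 * pi\<^sup>2 * (\<Sum>k\<in>boxZ N. nsq k * (coef f k)\<^sup>2) \<le> dirichlet f"
  unfolding dirichlet_def sum_freq_coef_sq[symmetric] coef_pderiv_at[OF f, symmetric]
  by (intro sum_mono Bessel finite_boxZ torus_C_cont[OF torus_C_pderiv[OF f]])

text \<open>Modes outside the box have \<open>nsq k\<close> at least \<open>N\<close> squared, so
  the tail is paid for by the gradient. The tail is taken between two boxes and the outer one is
  sent to infinity, which avoids infinite series.\<close>

lemma avg_sq_diff_proj_le:
  assumes f: "torus_C (Suc n) f"
  shows "(real N)\<^sup>2 * avg (\<lambda>x. (f x - proj N f x)\<^sup>2) \<le> dirichlet f"
proof -
  have cont: "continuous_on UNIV f" and f0: "torus_C 0 f"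
    using torus_C_cont[OF f] torus_C_lower[OF f, of 0] by auto
  let ?d = "\<lambda>N. avg (\<lambda>x. (f x - proj N f x)\<^sup>2)"
  have d: "?d N = avg (\<lambda>x. (f x)\<^sup>2) - (\<Sum>k\<in>boxZ N. (coef f k)\<^sup>2)" for N
    using avg_sq_diff_trig[OF cont finite_boxZ, of "coef f"] by simp
  have "(real N)\<^sup>2 * ?d N \<le> (real N)\<^sup>2 * ?d M + dirichlet f" if MN: "N \<le> M" for M
  proof -
    have "?d N - ?d M = (\<Sum>k\<in>boxZ M - boxZ N. (coef f k)\<^sup>2)"
      using sum_diff[OF finite_boxZ boxZ_mono[OF MN], of "\<lambda>k. (coef f k)\<^sup>2"] by (simp add: d)
    hence "(real N)\<^sup>2 * (?d N - ?d M) = (\<Sum>k\<in>boxZ M - boxZ N. (real N)\<^sup>2 * (coef f k)\<^sup>2)"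
      by (simp add: sum_distrib_left)
    also have "\<dots> \<le> (\<Sum>k\<in>boxZ M - boxZ N. nsq k * (coef f k)\<^sup>2)"
      by (intro sum_mono mult_right_mono nsq_not_in_boxZ) auto
    also have "\<dots> \<le> 1 * (\<Sum>k\<in>boxZ M. nsq k * (coef f k)\<^sup>2)"
      by (simp, intro sum_mono2) auto
    also have "\<dots> \<le> (4 * pi\<^sup>2) * (\<Sum>k\<in>boxZ M. nsq k * (coef f k)\<^sup>2)"
    proof (rule mult_right_mono)
      have "1 \<le> pi\<^sup>2" using pi_ge_two by (simp add: one_le_power)
      thus "1 \<le> 4 * pi\<^sup>2" by simp
    qed (simp add: sum_nonneg)
    also have "\<dots> \<le> dirichlet f" by (rule Bessel_dirichlet[OF f])
    finally show ?thesis by (simp add: algebra_simps)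
  qed
  moreover have "(\<lambda>M. (real N)\<^sup>2 * ?d M + dirichlet f) \<longlonglongrightarrow> (real N)\<^sup>2 * 0 + dirichlet f"
    by (intro tendsto_intros proj_tendsto f0)
  ultimately have "(real N)\<^sup>2 * ?d N \<le> (real N)\<^sup>2 * 0 + dirichlet f"
    by (intro LIMSEQ_le_const) (auto intro!: exI[of _ N])
  thus ?thesis by simp
qed

lemma avg_sq_eq_0:
  assumes f: "torus_C 0 f" and z: "avg (\<lambda>x. (f x)\<^sup>2) = 0"
  shows "f x = 0"
proof -
  have c: "continuous_on S f" for S using f by (auto intro: continuous_on_subset)
  have "integral (cbox 0 1) (\<lambda>x. (f x)\<^sup>2) = 0"
    using z by (subst (asm) avg_eq_integral) (auto intro: continuous_intros c)
  hence "\<forall>x\<in>cbox 0 1. (f x)\<^sup>2 = 0"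
    by (subst (asm) integral_cbox_eq_0_iff)
      (auto intro!: continuous_intros c simp: box_ne_empty Basis_vec_def inner_axis)
  thus ?thesis using periodic_all_cbox[of f "\<lambda>z. z = 0"] f by auto
qed

text \<open>
  Equality of mixed partials: the coefficients agree, and the basis is complete.
\<close>

lemma pderiv_at_commute:
  assumes f: "torus_C (Suc (Suc n)) f"
  shows "pderiv_at i (pderiv_at j f) = pderiv_at j (pderiv_at i f)"
proof
  fix x
  let ?g = "\<lambda>x. pderiv_at i (pderiv_at j f) x - pderiv_at j (pderiv_at i f) x"
  have 2: "torus_C (Suc 0) (pderiv_at i f)" "torus_C 0 (pderiv_at i (pderiv_at j f))" for i j
    using f torus_C_lower[of n "pderiv_at i (pderiv_at j f)" 0]
      torus_C_lower[of "Suc n" "pderiv_at i f" 1] by auto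
  have g0: "torus_C 0 ?g" by (intro torus_C_diff_fun 2)
  have cc: "coef (pderiv_at i (pderiv_at j f)) k = coef (pderiv_at j (pderiv_at i f)) k" for k
    by (simp add: coef_pderiv_at[OF 2(1)] coef_pderiv_at[OF f])
  have "coef ?g k = coef (pderiv_at i (pderiv_at j f)) k - coef (pderiv_at j (pderiv_at i f)) k" for k
    unfolding coef_def left_diff_distrib
    by (intro Bochner_Integration.integral_diff integrable_torus_C[of 0] torus_C_mult 2 torus_C_cas)
  hence "coef ?g k = 0" for k by (simp add: cc)
  hence "proj N ?g x = 0" for N x by (simp add: trig_def)
  hence "(\<lambda>N::nat. avg (\<lambda>x. (?g x)\<^sup>2)) \<longlonglongrightarrow> 0"
    using proj_tendsto[OF g0] by simp
  hence "avg (\<lambda>x. (?g x)\<^sup>2) = 0" by (simp add: LIMSEQ_const_iff)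
  from avg_sq_eq_0[OF g0 this, of x] show "pderiv_at i (pderiv_at j f) x = pderiv_at j (pderiv_at i f) x"
    by simp
qed

section \<open>The Poisson bracket and the Wente inequality\<close>

lemma bracket_eq:
  "bracket f g x = pderiv_at 1 f x * pderiv_at 2 g x - pderiv_at 2 f x * pderiv_at 1 g x"
  by (simp add: bracket_def perp_grad_def grad_def inner_vec_def sum_2)

lemma torus_C_bracket: "torus_C (Suc n) f \<Longrightarrow> torus_C (Suc n) g \<Longrightarrow> torus_C n (bracket f g)"
  unfolding bracket_eq[abs_def]
  by (intro torus_C_diff_fun torus_C_mult torus_C_pderiv)

lemma bracket_mult:
  assumes "torus_C (Suc n) g" "torus_C (Suc m) h"
  shows "bracket f (\<lambda>x. g x * h x) x = g x * bracket f h x + h x * bracket f g x"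
  using torus_C_diff[OF assms(1)] torus_C_diff[OF assms(2)]
  by (simp add: bracket_eq pderiv_at_mult algebra_simps)

text \<open>The bracket is a divergence. Both integrations by parts move derivatives from
  \<open>g\<close> to \<open>f\<close>, so \<open>g\<close> may be merely C^1, as happens for the
  composed vorticity below.\<close>

lemma avg_bracket:
  assumes f: "torus_C (Suc (Suc n)) f" and g: "torus_C (Suc m) g"
  shows "avg (bracket f g) = 0"
proof -
  have f1: "torus_C (Suc n) (pderiv_at i f)" for i using f by (rule torus_C_pderiv)
  have "avg (bracket f g) = avg (\<lambda>x. pderiv_at 1 f x * pderiv_at 2 g x) - avg (\<lambda>x. pderiv_at 2 f x * pderiv_at 1 g x)"
    unfolding bracket_eq[abs_def]
    by (intro Bochner_Integration.integral_diff integrable_torus' continuous_intros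
        torus_C_cont[OF f1] torus_C_cont[OF torus_C_pderiv[OF g]])
  also have "\<dots> = avg (\<lambda>x. pderiv_at 1 (pderiv_at 2 f) x * g x) - avg (\<lambda>x. pderiv_at 2 (pderiv_at 1 f) x * g x)"
    by (simp add: avg_by_parts[OF f1 g])
  also have "\<dots> = 0" by (simp add: pderiv_at_commute[OF f, of 1 2])
  finally show ?thesis .
qed

text \<open>Bracketing with \<open>f\<close> is a derivation whose values have average zero, hence
  skew-adjoint. With \<open>g = h\<close> the pairing vanishes.\<close>

lemma avg_mult_bracket:
  assumes f: "torus_C (Suc (Suc n)) f" and g: "torus_C (Suc m) g" and h: "torus_C (Suc l) h"
  shows "avg (\<lambda>x. g x * bracket f h x) = - avg (\<lambda>x. h x * bracket f g x)"
proof -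
  have 1: "torus_C 1 g" "torus_C 1 h" "torus_C 1 f"
    using torus_C_lower[OF f, of 1] torus_C_lower[OF g, of 1] torus_C_lower[OF h, of 1]
    by (auto simp del: torus_C.simps)
  have 0: "torus_C 0 g" "torus_C 0 h"
    using torus_C_lower[OF g, of 0] torus_C_lower[OF h, of 0] by (auto simp del: torus_C.simps)
  have "0 = avg (bracket f (\<lambda>x. g x * h x))"
    using avg_bracket[OF f, of 0 "\<lambda>x. g x * h x"] torus_C_mult[OF 1(1,2)] by simp
  also have "\<dots> = avg (\<lambda>x. g x * bracket f h x + h x * bracket f g x)"
    by (subst bracket_mult[OF g h, abs_def]) simp
  also have "\<dots> = avg (\<lambda>x. g x * bracket f h x) + avg (\<lambda>x. h x * bracket f g x)"
    using 0 1 by (intro Bochner_Integration.integral_add integrable_torus_C[of 0] torus_C_mult torus_C_bracket)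
      (auto simp del: torus_C.simps)
  finally show ?thesis by simp
qed

text \<open>The product formula for \<open>cas\<close> produces four sign combinations. Reflecting a
  frequency changes only the sign of \<open>cross\<close> and leaves the weighted sums alone, so
  each costs one trilinear estimate: 36 is 4 times 9.\<close>

lemma trilinear_sum_boxZ_le:
  fixes a b g :: "int \<times> int \<Rightarrow> real"
  assumes nn: "\<And>k. 0 \<le> a k" "\<And>k. 0 \<le> b k" "\<And>k. 0 \<le> g k"
    and g0: "\<And>k. k \<notin> boxZ N \<Longrightarrow> g k = 0"
  defines "S \<equiv> \<lambda>f::int \<times> int \<Rightarrow> real. \<Sum>k\<in>boxZ N. nsq k * (f k)\<^sup>2"
  shows "(\<Sum>k\<in>boxZ N. \<Sum>l\<in>boxZ N. \<bar>cross k l\<bar> * a k * b l * (g (k + l) + g (- k - l) + g (k - l) + g (l - k)))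
    \<le> 36 * sqrt (S a * S b * S g)"
proof -
  have Sm: "S (\<lambda>k. f (- k)) = S f" for f
    unfolding S_def using sum_boxZ_uminus[of "\<lambda>k. nsq k * (f k)\<^sup>2"] by simp
  have plus: "(\<Sum>k\<in>boxZ N. \<Sum>l\<in>boxZ N. \<bar>cross k l\<bar> * a k * b l * h (k + l)) \<le> 9 * sqrt (S a * S b * S g)"
    and minus: "(\<Sum>k\<in>boxZ N. \<Sum>l\<in>boxZ N. \<bar>cross k l\<bar> * a k * b l * h (l - k)) \<le> 9 * sqrt (S a * S b * S g)"
    if h: "h = g \<or> h = (\<lambda>k. g (- k))" for h
  proof -
    have h': "\<And>k. 0 \<le> h k" "S h = S g"
      using h nn(3) Sm[of g] by auto
    have h0: "h k = 0" if "k \<notin> boxZ N" for k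
      using h g0[of k] g0[of "- k"] that unfolding uminus_boxZ by auto
    show "(\<Sum>k\<in>boxZ N. \<Sum>l\<in>boxZ N. \<bar>cross k l\<bar> * a k * b l * h (k + l)) \<le> 9 * sqrt (S a * S b * S g)"
      using trilinear_sum_le[of "boxZ N" a b h] h' h0 nn by (simp add: S_def)
    have "(\<Sum>k\<in>boxZ N. \<Sum>l\<in>boxZ N. \<bar>cross k l\<bar> * a k * b l * h (l - k))
        = (\<Sum>k\<in>boxZ N. \<Sum>l\<in>boxZ N. \<bar>cross k l\<bar> * a (- k) * b l * h (k + l))"
      by (subst sum_boxZ_uminus[symmetric]) (simp add: cross_minus add.commute)
    also have "\<dots> \<le> 9 * sqrt (S (\<lambda>k. a (- k)) * S b * S h)"
      unfolding S_def using h' h0 nn by (intro trilinear_sum_le) auto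
    finally show "(\<Sum>k\<in>boxZ N. \<Sum>l\<in>boxZ N. \<bar>cross k l\<bar> * a k * b l * h (l - k)) \<le> 9 * sqrt (S a * S b * S g)"
      by (simp add: Sm h')
  qed
  have "(\<Sum>k\<in>boxZ N. \<Sum>l\<in>boxZ N. \<bar>cross k l\<bar> * a k * b l * (g (k + l) + g (- k - l) + g (k - l) + g (l - k)))
      = (\<Sum>k\<in>boxZ N. \<Sum>l\<in>boxZ N. \<bar>cross k l\<bar> * a k * b l * g (k + l))
      + (\<Sum>k\<in>boxZ N. \<Sum>l\<in>boxZ N. \<bar>cross k l\<bar> * a k * b l * g (- (k + l)))
      + (\<Sum>k\<in>boxZ N. \<Sum>l\<in>boxZ N. \<bar>cross k l\<bar> * a k * b l * g (- (l - k)))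
      + (\<Sum>k\<in>boxZ N. \<Sum>l\<in>boxZ N. \<bar>cross k l\<bar> * a k * b l * g (l - k))"
    by (simp add: distrib_left sum.distrib)
  also have "\<dots> \<le> 36 * sqrt (S a * S b * S g)"
    using plus[of g] plus[of "\<lambda>k. g (- k)"] minus[of g] minus[of "\<lambda>k. g (- k)"] by simp
  finally show ?thesis .
qed

lemma bracket_trig:
  "bracket (trig a (boxZ N)) (trig b (boxZ N)) x
    = (\<Sum>k\<in>boxZ N. \<Sum>l\<in>boxZ N. 4 * pi\<^sup>2 * (a k * b l * cross k l) * (cas (- k) x * cas (- l) x))"
proof -
  have p: "pderiv_at i (trig c (boxZ N)) x = (\<Sum>k\<in>boxZ N. 2 * pi * freq i k * c k * cas (- k) x)" for i c
    using sum_boxZ_uminus[of "\<lambda>k. 2 * pi * freq i k * c k * cas (- k) x" N]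
    by (simp add: pderiv_at_trig trig_def)
  show ?thesis
    unfolding bracket_eq p sum_product sum_subtractf[symmetric]
    by (intro sum.cong refl) (simp add: freq_def cross_def power2_eq_square algebra_simps)
qed

text \<open>Expanding the bracket in modes and averaging against \<open>g\<close> turns the integral
  into a sum over pairs weighted by \<open>cross\<close>, which is the trilinear sum on the
  lattice.\<close>

lemma Wente_trig:
  "(avg (\<lambda>x. trig g (boxZ N) x * bracket (trig a (boxZ N)) (trig b (boxZ N)) x))\<^sup>2
    \<le> 21 * (dirichlet (trig g (boxZ N)) * (dirichlet (trig a (boxZ N)) * dirichlet (trig b (boxZ N))))"
proof -
  let ?K = "boxZ N"
  define S where "S f = (\<Sum>k\<in>?K. nsq k * (f k)\<^sup>2)" for f :: "int \<times> int \<Rightarrow> real"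
  \<comment> \<open>Padding by zero, since sums and differences of two frequencies can leave the
    box.\<close>
  define G where "G k = (if k \<in> ?K then g k else 0)" for k
  have cont: "continuous_on UNIV (trig g ?K)" by (intro continuous_intros)
  have triple: "avg (\<lambda>x. trig g ?K x * (cas (- k) x * cas (- l) x)) = (G (l - k) + G (k - l) + G (- k - l) - G (k + l)) / 2" for k l
  proof -
    have int: "integrable torus_measure (\<lambda>x. trig g ?K x * cas m x)" for m
      by (intro integrable_torus' continuous_intros)
    have m: "avg (\<lambda>x. trig g ?K x * cas m x) = G m" for m
      using coef_trig[OF finite_boxZ, of g N m] by (simp add: coef_def G_def)
    have "(\<lambda>x. trig g ?K x * (cas (- k) x * cas (- l) x))
        = (\<lambda>x. (trig g ?K x * cas (l - k) x + trig g ?K x * cas (k - l) x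
            + trig g ?K x * cas (- k - l) x - trig g ?K x * cas (k + l) x) / 2)"
      by (simp add: cas_mult fun_eq_iff algebra_simps)
    thus ?thesis using int by (simp add: m)
  qed
  let ?T = "\<lambda>k l. G (l - k) + G (k - l) + G (- k - l) - G (k + l)"
  have "avg (\<lambda>x. trig g ?K x * bracket (trig a ?K) (trig b ?K) x)
      = avg (\<lambda>x. \<Sum>k\<in>?K. \<Sum>l\<in>?K. 4 * pi\<^sup>2 * (a k * b l * cross k l) * (trig g ?K x * (cas (- k) x * cas (- l) x)))"
    unfolding bracket_trig sum_distrib_left by (simp add: mult_ac)
  also have "\<dots> = (\<Sum>k\<in>?K. \<Sum>l\<in>?K. avg (\<lambda>x. 4 * pi\<^sup>2 * (a k * b l * cross k l) * (trig g ?K x * (cas (- k) x * cas (- l) x))))"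
    by (subst Bochner_Integration.integral_sum, intro integrable_torus' continuous_intros continuous_on_sum)
      (intro sum.cong refl Bochner_Integration.integral_sum integrable_torus' continuous_intros)
  also have "\<dots> = (\<Sum>k\<in>?K. \<Sum>l\<in>?K. 2 * pi\<^sup>2 * (a k * b l * cross k l) * ?T k l)"
    by (intro sum.cong refl) (simp add: triple)
  finally have eq: "avg (\<lambda>x. trig g ?K x * bracket (trig a ?K) (trig b ?K) x)
      = (\<Sum>k\<in>?K. \<Sum>l\<in>?K. 2 * pi\<^sup>2 * (a k * b l * cross k l) * ?T k l)" .
  let ?B = "36 * sqrt (S (\<lambda>k. \<bar>a k\<bar>) * S (\<lambda>k. \<bar>b k\<bar>) * S (\<lambda>k. \<bar>G k\<bar>))"
  have "\<bar>\<Sum>k\<in>?K. \<Sum>l\<in>?K. 2 * pi\<^sup>2 * (a k * b l * cross k l) * ?T k l\<bar>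
      \<le> (\<Sum>k\<in>?K. \<Sum>l\<in>?K. \<bar>2 * pi\<^sup>2 * (a k * b l * cross k l) * ?T k l\<bar>)"
    by (rule order_trans[OF sum_abs]) (intro sum_mono sum_abs)
  also have "\<dots> \<le> (\<Sum>k\<in>?K. \<Sum>l\<in>?K. 2 * pi\<^sup>2 * (\<bar>cross k l\<bar> * \<bar>a k\<bar> * \<bar>b l\<bar>
      * (\<bar>G (k + l)\<bar> + \<bar>G (- k - l)\<bar> + \<bar>G (k - l)\<bar> + \<bar>G (l - k)\<bar>)))"
  proof (intro sum_mono)
    fix k l
    have "\<bar>?T k l\<bar> \<le> \<bar>G (k + l)\<bar> + \<bar>G (- k - l)\<bar> + \<bar>G (k - l)\<bar> + \<bar>G (l - k)\<bar>" by linarith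
    hence "(2 * pi\<^sup>2 * (\<bar>cross k l\<bar> * \<bar>a k\<bar> * \<bar>b l\<bar>)) * \<bar>?T k l\<bar>
        \<le> (2 * pi\<^sup>2 * (\<bar>cross k l\<bar> * \<bar>a k\<bar> * \<bar>b l\<bar>)) * (\<bar>G (k + l)\<bar> + \<bar>G (- k - l)\<bar> + \<bar>G (k - l)\<bar> + \<bar>G (l - k)\<bar>)"
      by (rule mult_left_mono) simp
    thus "\<bar>2 * pi\<^sup>2 * (a k * b l * cross k l) * ?T k l\<bar> \<le> 2 * pi\<^sup>2 * (\<bar>cross k l\<bar> * \<bar>a k\<bar> * \<bar>b l\<bar>
      * (\<bar>G (k + l)\<bar> + \<bar>G (- k - l)\<bar> + \<bar>G (k - l)\<bar> + \<bar>G (l - k)\<bar>))"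
      by (simp add: abs_mult mult_ac)
  qed
  also have "\<dots> \<le> 2 * pi\<^sup>2 * ?B"
    unfolding sum_distrib_left[symmetric] S_def
    by (intro mult_left_mono trilinear_sum_boxZ_le) (auto simp: G_def)
  also have "\<dots> = 72 * pi\<^sup>2 * sqrt (S a * S b * S g)"
    by (simp add: S_def G_def)
  finally have "\<bar>avg (\<lambda>x. trig g ?K x * bracket (trig a ?K) (trig b ?K) x)\<bar> \<le> 72 * pi\<^sup>2 * sqrt (S a * S b * S g)"
    unfolding eq .
  hence "(avg (\<lambda>x. trig g ?K x * bracket (trig a ?K) (trig b ?K) x))\<^sup>2 \<le> (72 * pi\<^sup>2 * sqrt (S a * S b * S g))\<^sup>2"
    by (rule abs_le_square_iff[THEN iffD1, OF order_trans]) simp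
  also have "\<dots> = 5184 * pi ^ 4 * (S a * S b * S g)"
    by (simp add: power_mult_distrib S_def sum_nonneg)
  \<comment> \<open>5184 is the square of 72. Turning three weighted sums into Dirichlet energies
    takes the factor 64 * pi ^ 6, and 1344 is 21 * 64; the crude bound
    \<open>4 \<le> pi\<^sup>2\<close> suffices for the comparison.\<close>
  also have "\<dots> \<le> 1344 * pi ^ 6 * (S a * S b * S g)"
  proof (rule mult_right_mono)
    have "4 \<le> pi\<^sup>2" using power_mono[OF pi_ge_two, of 2] by simp
    hence "pi ^ 4 * 4 \<le> pi ^ 4 * pi\<^sup>2" by (rule mult_left_mono) simp
    hence "pi ^ 4 * 4 \<le> pi ^ 6" by (simp flip: power_add)
    thus "5184 * pi ^ 4 \<le> 1344 * pi ^ 6" using zero_le_power[OF pi_ge_zero, of 4] by linarith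
  qed (simp add: S_def sum_nonneg)
  also have "\<dots> = 21 * ((4 * pi\<^sup>2 * S g) * ((4 * pi\<^sup>2 * S a) * (4 * pi\<^sup>2 * S b)))"
    by (simp add: power2_eq_square power_numeral_reduce)
  finally show ?thesis unfolding dirichlet_trig S_def .
qed

text \<open>With f and h the L^2 limits of u and v, u v = f h + (f - u) (h - v) - f (h - v) - h (f -
  u). The last two terms are linear in the errors; in the quadratic one the weight \<open>g\<close>
  is bounded on the unit square before Cauchy-Schwarz is applied.\<close>

lemma avg_mult_tendsto:
  fixes f h :: "real^2 \<Rightarrow> real" and u v :: "nat \<Rightarrow> real^2 \<Rightarrow> real"
  assumes g: "continuous_on UNIV g" "periodic g"
    and f: "continuous_on UNIV f" and h: "continuous_on UNIV h"
    and u: "\<And>N. continuous_on UNIV (u N)" and v: "\<And>N. continuous_on UNIV (v N)"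
    and uf: "(\<lambda>N. avg (\<lambda>x. (f x - u N x)\<^sup>2)) \<longlonglongrightarrow> 0"
    and vh: "(\<lambda>N. avg (\<lambda>x. (h x - v N x)\<^sup>2)) \<longlonglongrightarrow> 0"
  shows "(\<lambda>N. avg (\<lambda>x. g x * (u N x * v N x))) \<longlonglongrightarrow> avg (\<lambda>x. g x * (f x * h x))"
proof -
  note [continuous_intros] = g(1) f h u v
  have small: "(\<lambda>N. avg (\<lambda>x. p x * q N x)) \<longlonglongrightarrow> 0"
    if "\<And>N. continuous_on UNIV (q N)" "continuous_on UNIV p" "(\<lambda>N. avg (\<lambda>x. (q N x)\<^sup>2)) \<longlonglongrightarrow> 0"
    for p :: "real^2 \<Rightarrow> real" and q :: "nat \<Rightarrow> real^2 \<Rightarrow> real"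
  proof -
    have "(\<lambda>N. avg (\<lambda>x. (p x)\<^sup>2) * avg (\<lambda>x. (q N x)\<^sup>2)) \<longlonglongrightarrow> avg (\<lambda>x. (p x)\<^sup>2) * 0"
      by (intro tendsto_intros that)
    hence "(\<lambda>N. avg (\<lambda>x. (p x)\<^sup>2) * avg (\<lambda>x. (q N x)\<^sup>2)) \<longlonglongrightarrow> 0" by simp
    hence "(\<lambda>N. (avg (\<lambda>x. p x * q N x))\<^sup>2) \<longlonglongrightarrow> 0"
      by (rule Lim_null_comparison[OF always_eventually, rotated]) (simp add: avg_Cauchy_Schwarz that)
    thus ?thesis by simp
  qed
  have lin: "avg (\<lambda>x. p x + q x - r x - s x) = avg p + avg q - avg r - avg s"
    if "integrable torus_measure p" "integrable torus_measure q" "integrable torus_measure r" "integrable torus_measure s"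
    for p q r s :: "real^2 \<Rightarrow> real"
    using that by simp
  obtain B where B: "\<And>x. x \<in> cbox 0 1 \<Longrightarrow> \<bar>g x\<bar> \<le> B"
    using compact_imp_bounded[OF compact_continuous_image[OF continuous_on_subset[OF g(1) subset_UNIV] compact_cbox[of 0 1]]]
    unfolding bounded_iff by (metis image_eqI real_norm_def)
  have "(\<lambda>N. avg (\<lambda>x. (g x * (f x - u N x)) * (h x - v N x))) \<longlonglongrightarrow> 0"
  proof -
    have "(\<lambda>N. (B\<^sup>2 * avg (\<lambda>x. (f x - u N x)\<^sup>2)) * avg (\<lambda>x. (h x - v N x)\<^sup>2)) \<longlonglongrightarrow> (B\<^sup>2 * 0) * 0"
      by (intro tendsto_intros uf vh)
    hence lim: "(\<lambda>N. (B\<^sup>2 * avg (\<lambda>x. (f x - u N x)\<^sup>2)) * avg (\<lambda>x. (h x - v N x)\<^sup>2)) \<longlonglongrightarrow> 0"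
      by simp
    have bound: "(avg (\<lambda>x. (g x * (f x - u N x)) * (h x - v N x)))\<^sup>2
        \<le> (B\<^sup>2 * avg (\<lambda>x. (f x - u N x)\<^sup>2)) * avg (\<lambda>x. (h x - v N x)\<^sup>2)" for N
    proof -
      have "(avg (\<lambda>x. (g x * (f x - u N x)) * (h x - v N x)))\<^sup>2
        \<le> avg (\<lambda>x. (g x * (f x - u N x))\<^sup>2) * avg (\<lambda>x. (h x - v N x)\<^sup>2)"
        by (intro avg_Cauchy_Schwarz continuous_intros)
      also have "avg (\<lambda>x. (g x * (f x - u N x))\<^sup>2) \<le> avg (\<lambda>x. B\<^sup>2 * (f x - u N x)\<^sup>2)"
      proof (rule avg_mono)
        fix x :: "real^2" assume x: "x \<in> cbox 0 1"
        have "(g x)\<^sup>2 \<le> B\<^sup>2" using power_mono[OF B[OF x], of 2] by simp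
        thus "(g x * (f x - u N x))\<^sup>2 \<le> B\<^sup>2 * (f x - u N x)\<^sup>2"
          by (simp add: power_mult_distrib mult_right_mono)
      qed (intro continuous_intros)+
      finally show ?thesis by (simp add: mult_right_mono avg_nonneg)
    qed
    have "(\<lambda>N. (avg (\<lambda>x. (g x * (f x - u N x)) * (h x - v N x)))\<^sup>2) \<longlonglongrightarrow> 0"
      by (rule Lim_null_comparison[OF _ lim]) (use bound in simp)
    thus ?thesis by simp
  qed
  moreover have "(\<lambda>N. avg (\<lambda>x. (g x * f x) * (h x - v N x))) \<longlonglongrightarrow> 0"
    "(\<lambda>N. avg (\<lambda>x. (g x * h x) * (f x - u N x))) \<longlonglongrightarrow> 0"
    by (rule small; (intro continuous_intros uf vh)?)+
  ultimately have lim4: "(\<lambda>N. avg (\<lambda>x. g x * (f x * h x)) + avg (\<lambda>x. (g x * (f x - u N x)) * (h x - v N x))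
      - avg (\<lambda>x. (g x * f x) * (h x - v N x)) - avg (\<lambda>x. (g x * h x) * (f x - u N x)))
      \<longlonglongrightarrow> avg (\<lambda>x. g x * (f x * h x)) + 0 - 0 - 0"
    by (intro tendsto_intros)
  have eq: "avg (\<lambda>x. g x * (u N x * v N x)) = avg (\<lambda>x. g x * (f x * h x))
      + avg (\<lambda>x. (g x * (f x - u N x)) * (h x - v N x))
      - avg (\<lambda>x. (g x * f x) * (h x - v N x)) - avg (\<lambda>x. (g x * h x) * (f x - u N x))" for N
  proof -
    have int: "integrable torus_measure (\<lambda>x. g x * (f x * h x))"
      "integrable torus_measure (\<lambda>x. (g x * (f x - u N x)) * (h x - v N x))"
      "integrable torus_measure (\<lambda>x. (g x * f x) * (h x - v N x))"
      "integrable torus_measure (\<lambda>x. (g x * h x) * (f x - u N x))"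
      by (intro integrable_torus' continuous_intros)+
    have "g x * (u N x * v N x) = g x * (f x * h x) + (g x * (f x - u N x)) * (h x - v N x)
        - (g x * f x) * (h x - v N x) - (g x * h x) * (f x - u N x)" for x
      by (simp add: algebra_simps)
    thus ?thesis by (simp only: lin[OF int])
  qed
  show ?thesis unfolding eq using lim4 by (simp only: add_0_right diff_zero)
qed

lemma dirichlet_proj_le: "torus_C (Suc n) f \<Longrightarrow> dirichlet (proj N f) \<le> dirichlet f"
  unfolding dirichlet_trig by (rule Bessel_dirichlet)

text \<open>The test function stays a fixed polynomial while \<open>a\<close> and \<open>b\<close>
  are projected. Projection does not raise the Dirichlet energy, and the integrals converge.\<close>

lemma Wente:
  assumes a: "torus_C (Suc m) a" and b: "torus_C (Suc n) b"
  shows "(avg (\<lambda>x. trig g (boxZ M) x * bracket a b x))\<^sup>2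
    \<le> 21 * (dirichlet (trig g (boxZ M)) * (dirichlet a * dirichlet b))"
proof -
  let ?g = "trig g (boxZ M)"
  have c: "continuous_on UNIV (pderiv_at i a)" "continuous_on UNIV (pderiv_at i b)" for i
    using torus_C_cont[OF torus_C_pderiv[OF a]] torus_C_cont[OF torus_C_pderiv[OF b]] by auto
  have c0: "torus_C 0 (pderiv_at i a)" "torus_C 0 (pderiv_at i b)" for i
    using torus_C_lower[OF torus_C_pderiv[OF a], of 0] torus_C_lower[OF torus_C_pderiv[OF b], of 0] by auto
  have cp: "continuous_on UNIV (pderiv_at i (trig d (boxZ N)))" for i d N
    unfolding pderiv_at_trig by (rule continuous_on_trig)
  note g = continuous_on_trig torus_C_periodic[OF torus_C_trig]
  have lim: "(\<lambda>N. avg (\<lambda>x. ?g x * (pderiv_at i (proj N a) x * pderiv_at j (proj N b) x)))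
      \<longlonglongrightarrow> avg (\<lambda>x. ?g x * (pderiv_at i a x * pderiv_at j b x))" for i j
    unfolding pderiv_at_proj[OF a] pderiv_at_proj[OF b]
    by (intro avg_mult_tendsto g c proj_tendsto c0)
  have split: "avg (\<lambda>x. ?g x * bracket p q x) = avg (\<lambda>x. ?g x * (pderiv_at 1 p x * pderiv_at 2 q x))
      - avg (\<lambda>x. ?g x * (pderiv_at 2 p x * pderiv_at 1 q x))"
    if "\<And>i. continuous_on UNIV (pderiv_at i p)" "\<And>i. continuous_on UNIV (pderiv_at i q)" for p q
    unfolding bracket_eq right_diff_distrib
    by (intro Bochner_Integration.integral_diff integrable_torus' continuous_intros that)
  have "(\<lambda>N. (avg (\<lambda>x. ?g x * bracket (proj N a) (proj N b) x))\<^sup>2)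
      \<longlonglongrightarrow> (avg (\<lambda>x. ?g x * bracket a b x))\<^sup>2"
    unfolding split[OF c] split[OF cp cp] by (intro tendsto_intros lim)
  moreover have "(avg (\<lambda>x. ?g x * bracket (proj N a) (proj N b) x))\<^sup>2
      \<le> 21 * (dirichlet ?g * (dirichlet a * dirichlet b))" if N: "M \<le> N" for N
  proof -
    \<comment> \<open>For \<open>M \<le> N\<close> the test function is padded to the box of the
      projections, as \<open>Wente_trig\<close> wants one common box.\<close>
    obtain g' where g': "?g = trig g' (boxZ N)"
      using trig_superset[OF finite_boxZ boxZ_mono[OF N]] by blast
    have "(avg (\<lambda>x. ?g x * bracket (proj N a) (proj N b) x))\<^sup>2
        \<le> 21 * (dirichlet ?g * (dirichlet (proj N a) * dirichlet (proj N b)))"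
      unfolding g' by (rule Wente_trig)
    also have "\<dots> \<le> 21 * (dirichlet ?g * (dirichlet a * dirichlet b))"
      by (intro mult_left_mono mult_mono dirichlet_proj_le[OF a] dirichlet_proj_le[OF b]) auto
    finally show ?thesis .
  qed
  ultimately show ?thesis
    by (intro LIMSEQ_le_const2) auto
qed

section \<open>Smooth evolutions\<close>

lemma Ck_on_cong:
  "Ck_on k S f \<Longrightarrow> (\<And>x. x \<in> S \<Longrightarrow> f x = g x) \<Longrightarrow> Ck_on k S g"
proof (induction k arbitrary: f g)
  case 0
  thus ?case using continuous_on_cong[of S S f g] by simp
next
  case (Suc k)
  from Suc.prems(1) obtain f' where f': "\<forall>x\<in>S. (f has_derivative f' x) (at x within S)"
      "\<forall>v. Ck_on k S (\<lambda>x. f' x v)"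
    by auto
  have "(g has_derivative f' x) (at x within S)" if "x \<in> S" for x
    by (rule has_derivative_transform[OF that _ f'(1)[rule_format, OF that]]) (simp add: Suc.prems)
  thus ?case using f'(2) by auto
qed

text \<open>From every point of the slab one can move along each axis by arbitrarily small steps and
  stay inside, which determines a derivative within it.\<close>

lemma slab_derivative_unique:
  fixes F :: "real \<times> (real^2) \<Rightarrow> real"
  assumes T: "0 < T" and p: "p \<in> {0..T} \<times> UNIV"
    and "(F has_derivative D) (at p within {0..T} \<times> UNIV)"
    and "(F has_derivative D') (at p within {0..T} \<times> UNIV)"
  shows "D = D'"
  using assms(3,4)
proof (rule frechet_derivative_unique_within)
  fix i :: "real \<times> (real^2)" and e :: real
  assume i: "i \<in> Basis" and e: "0 < e"
  define t x where "t = fst p" and "x = snd p"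
  have tx: "p = (t, x)" "0 \<le> t" "t \<le> T" using p by (simp_all add: t_def x_def mem_Times_iff)
  have small: "0 < min (e / 2) r" "min (e / 2) r < e" "min (e / 2) r \<le> r" if "0 < r" for r
    using e that by (simp_all add: min_def)
  \<comment> \<open>The time step goes forward before \<open>T\<close> and backward at
    \<open>T\<close>; the latter is where \<open>0 < T\<close> is used.\<close>
  obtain d where d: "0 < \<bar>d\<bar>" "\<bar>d\<bar> < e" "0 \<le> t + d" "t + d \<le> T"
  proof (cases "t < T")
    case True
    show ?thesis
      by (rule that[of "min (e / 2) (T - t)"]) (use small[of "T - t"] True tx in auto)
  next
    case False
    show ?thesis
      by (rule that[of "- min (e / 2) T"]) (use small[of T] T False tx in auto)
  qed
  have "i = (1, 0) \<or> (\<exists>j. i = (0, j))"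
    using i by (auto simp: Basis_prod_def)
  hence "p + d *\<^sub>R i \<in> {0..T} \<times> UNIV"
  proof (elim disjE exE)
    assume "i = (1, 0)"
    thus ?thesis using d by (simp add: tx)
  next
    fix j assume "i = (0, j)"
    thus ?thesis using tx by simp
  qed
  thus "\<exists>d. 0 < \<bar>d\<bar> \<and> \<bar>d\<bar> < e \<and> p + d *\<^sub>R i \<in> {0..T} \<times> UNIV"
    by (intro exI[of _ d] conjI d(1,2))
qed

text \<open>\<open>smooth_on\<close> supplies a separate derivative for every order. Uniqueness on
  the slab makes them agree, so that a single derivative is itself smooth.\<close>

lemma smooth_on_slab_derivative:
  fixes F :: "real \<times> (real^2) \<Rightarrow> real"
  assumes T: "0 < T" and F: "smooth_on ({0..T} \<times> UNIV) F"
  shows "\<exists>F'. (\<forall>p\<in>{0..T} \<times> UNIV. (F has_derivative F' p) (at p within {0..T} \<times> UNIV)) \<and>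
    (\<forall>v. smooth_on ({0..T} \<times> UNIV) (\<lambda>p. F' p v))"
proof -
  let ?S = "{0..T} \<times> (UNIV :: (real^2) set)"
  have ex: "\<exists>F'. (\<forall>p\<in>?S. (F has_derivative F' p) (at p within ?S)) \<and> (\<forall>v. Ck_on k ?S (\<lambda>p. F' p v))" for k
    using F[unfolded smooth_on_def, rule_format, of "Suc k"] by simp
  from ex[of 0] obtain F' where F'_ball: "\<forall>p\<in>?S. (F has_derivative F' p) (at p within ?S)"
    by (elim exE conjE)
  note F' = F'_ball[rule_format]
  have "Ck_on k ?S (\<lambda>p. F' p v)" for k v
  proof -
    from ex[of k] obtain G where G_ball: "\<forall>p\<in>?S. (F has_derivative G p) (at p within ?S)"
        and G_Ck: "\<forall>v. Ck_on k ?S (\<lambda>p. G p v)"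
      by (elim exE conjE)
    note G = G_ball[rule_format] G_Ck[rule_format]
    show ?thesis
    proof (rule Ck_on_cong[OF G(2)])
      fix p :: "real \<times> (real^2)" assume p: "p \<in> ?S"
      show "G p v = F' p v"
        using slab_derivative_unique[OF T p G(1)[OF p] F'[OF p]] by simp
    qed
  qed
  thus ?thesis using F'_ball by (intro exI[of _ F']) (simp add: smooth_on_def)
qed

lemma periodic_pderiv_at:
  assumes "periodic f" "\<And>x. f differentiable (at x)"
  shows "periodic (pderiv_at i f)"
proof -
  have "pderiv_at i f (x + axis j 1) = pderiv_at i f x" for x j
  proof -
    have D: "(f has_derivative frechet_derivative f (at (x + axis j 1))) (at (x + axis j 1))"
      using assms(2) by (simp add: frechet_derivative_works)
    have g: "((\<lambda>y. y + axis j 1) has_derivative (\<lambda>v. v)) (at x)"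
      using has_derivative_add[OF has_derivative_ident has_derivative_const, of "axis j 1" "at x"] by simp
    have eq: "(\<lambda>y. f (y + axis j 1)) = f"
      using assms(1) by (simp add: periodic_def)
    have "(f has_derivative frechet_derivative f (at (x + axis j 1))) (at x)"
      using has_derivative_compose[OF g D] unfolding eq .
    from pderiv_at_eqI[OF this, of i]
    show ?thesis by (simp add: pderiv_at_def)
  qed
  thus ?thesis by (simp add: periodic_def)
qed

text \<open>The spatial slice is a whole plane inside the slab, so its derivative is unrestricted
  even at the end times; only the time derivative is one-sided there.\<close>

lemma evolution_slice_derivative:
  assumes F: "((\<lambda>(t, x). f t x) has_derivative D) (at (t, x) within {0..T} \<times> UNIV)" and t: "t \<in> {0..T}"
  shows "(f t has_derivative (\<lambda>v. D (0, v))) (at x)"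
    and "((\<lambda>s. f s x) has_vector_derivative D (1, 0)) (at t within {0..T})"
proof -
  have g: "((\<lambda>y. (t, y)) has_derivative (\<lambda>v. (0, v))) (at x)"
    by (rule has_derivative_Pair[OF has_derivative_const has_derivative_ident])
  have F1: "((\<lambda>(t, x). f t x) has_derivative D) (at (t, x) within range (\<lambda>y. (t, y)))"
    by (rule has_derivative_subset[OF F]) (use t in auto)
  from has_derivative_in_compose[OF g F1]
  show "(f t has_derivative (\<lambda>v. D (0, v))) (at x)" by simp
  have g': "((\<lambda>s. (s, x)) has_derivative (\<lambda>h. (h, 0))) (at t within {0..T})"
    by (rule has_derivative_Pair[OF has_derivative_ident has_derivative_const])
  have F2: "((\<lambda>(t, x). f t x) has_derivative D) (at (t, x) within (\<lambda>s. (s, x)) ` {0..T})"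
    by (rule has_derivative_subset[OF F]) auto
  from has_derivative_in_compose[OF g' F2]
  have "((\<lambda>s. f s x) has_derivative (\<lambda>h. D (h, 0))) (at t within {0..T})" by simp
  moreover have "(\<lambda>h. D (h, 0)) = (\<lambda>h. h *\<^sub>R D (1, 0))"
  proof
    fix h :: real
    have "D (h *\<^sub>R (1, 0)) = h *\<^sub>R D (1, 0)"
      by (rule linear_cmul[OF has_derivative_linear[OF F]])
    thus "D (h, 0) = h *\<^sub>R D (1, 0)" by simp
  qed
  ultimately show "((\<lambda>s. f s x) has_vector_derivative D (1, 0)) (at t within {0..T})"
    unfolding has_vector_derivative_def by (simp only:)
qed

lemma
  fixes f :: "real \<Rightarrow> real^2 \<Rightarrow> real"
  assumes T: "0 < T" and f: "smooth_torus_evolution T f"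
  shows smooth_torus_evolution_diff: "t \<in> {0..T} \<Longrightarrow> f t differentiable (at x)"
    and smooth_torus_evolution_pderiv: "smooth_torus_evolution T (\<lambda>t. pderiv_at i (f t))"
    and smooth_torus_evolution_time: "t \<in> {0..T} \<Longrightarrow>
      ((\<lambda>s. f s x) has_vector_derivative time_deriv T f t x) (at t within {0..T})"
    and smooth_torus_evolution_time_cont: "continuous_on ({0..T} \<times> UNIV) (\<lambda>(t, x). time_deriv T f t x)"
proof -
  let ?S = "{0..T} \<times> (UNIV :: (real^2) set)"
  have "smooth_on ?S (\<lambda>(t, x). f t x)"
    using f unfolding smooth_torus_evolution_def by (rule conjunct1)
  from smooth_on_slab_derivative[OF T this]
  obtain F' where F'_ball: "\<forall>p\<in>?S. ((\<lambda>(t, x). f t x) has_derivative F' p) (at p within ?S)"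
    and F's_all: "\<forall>v. smooth_on ?S (\<lambda>p. F' p v)"
    by (elim exE conjE)
  note F' = F'_ball[rule_format] and F's = F's_all[rule_format]
  have d: "(f t has_derivative (\<lambda>v. F' (t, x) (0, v))) (at x)"
    "((\<lambda>s. f s x) has_vector_derivative F' (t, x) (1, 0)) (at t within {0..T})" if "t \<in> {0..T}" for t x
    using evolution_slice_derivative[OF F'[of "(t, x)"]] that by auto
  show diff: "f t differentiable (at x)" if "t \<in> {0..T}" for t x
    using d(1)[OF that] by (rule differentiableI)
  have p: "pderiv_at i (f t) x = F' (t, x) (0, axis i 1)" if "t \<in> {0..T}" for t x i
    by (rule pderiv_at_eqI[OF d(1)[OF that]])
  have "smooth_on ?S (\<lambda>(t, x). pderiv_at i (f t) x)"
    unfolding smooth_on_def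
  proof
    fix k
    have "Ck_on k ?S (\<lambda>p. F' p (0, axis i 1))"
      using F's unfolding smooth_on_def by blast
    thus "Ck_on k ?S (\<lambda>(t, x). pderiv_at i (f t) x)"
      by (rule Ck_on_cong) (auto simp: p)
  qed
  moreover have "periodic (pderiv_at i (f t))" if "t \<in> {0..T}" for t
    using f that diff[OF that] unfolding smooth_torus_evolution_def by (intro periodic_pderiv_at) auto
  ultimately show "smooth_torus_evolution T (\<lambda>t. pderiv_at i (f t))"
    unfolding smooth_torus_evolution_def by blast
  have td: "time_deriv T f t x = F' (t, x) (1, 0)" if "t \<in> {0..T}" for t x
    unfolding time_deriv_def using that T d(2)[OF that]
    by (intro vector_derivative_within_closed_interval) auto
  show "((\<lambda>s. f s x) has_vector_derivative time_deriv T f t x) (at t within {0..T})" if "t \<in> {0..T}" for t x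
    using d(2)[OF that] td[OF that] by simp
  have "Ck_on 0 ?S (\<lambda>p. F' p (1, 0))"
    using F's unfolding smooth_on_def by blast
  hence "Ck_on 0 ?S (\<lambda>(t, x). time_deriv T f t x)"
    by (rule Ck_on_cong) (auto simp: td)
  thus "continuous_on ?S (\<lambda>(t, x). time_deriv T f t x)" by simp
qed

lemma smooth_torus_evolution_torus_C:
  "0 < T \<Longrightarrow> smooth_torus_evolution T f \<Longrightarrow> t \<in> {0..T} \<Longrightarrow> torus_C n (f t)"
proof (induction n arbitrary: f)
  case 0
  hence "f t differentiable (at x)" for x
    by (intro smooth_torus_evolution_diff)
  thus ?case using 0 unfolding smooth_torus_evolution_def
    by (auto simp: continuous_at_imp_continuous_on differentiable_imp_continuous_within)
next
  case (Suc n)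
  have "torus_C n (pderiv_at i (f t))" for i
    using Suc.IH[OF Suc.prems(1) smooth_torus_evolution_pderiv[OF Suc.prems(1,2)] Suc.prems(3)] .
  thus ?case using Suc.prems smooth_torus_evolution_diff[OF Suc.prems]
    unfolding smooth_torus_evolution_def by auto
qed

lemma smooth_torus_evolution_cont:
  assumes "smooth_torus_evolution T f"
  shows "continuous_on ({0..T} \<times> UNIV) (\<lambda>(t, x). f t x)"
proof -
  have "Ck_on 0 ({0..T} \<times> UNIV) (\<lambda>(t, x). f t x)"
    using assms unfolding smooth_torus_evolution_def smooth_on_def by blast
  thus ?thesis by simp
qed

lemma slab_bounded:
  fixes G :: "real \<Rightarrow> real^2 \<Rightarrow> real"
  assumes "continuous_on ({0..T} \<times> UNIV) (\<lambda>(t, x). G t x)"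
  obtains B where "0 \<le> B" "\<And>t x. t \<in> {0..T} \<Longrightarrow> x \<in> cbox 0 1 \<Longrightarrow> \<bar>G t x\<bar> \<le> B"
proof -
  have "compact ({0..T} \<times> cbox (0::real^2) 1)"
    by (intro compact_Times compact_Icc compact_cbox)
  hence "bounded ((\<lambda>(t, x). G t x) ` ({0..T} \<times> cbox 0 1))"
    by (intro compact_imp_bounded compact_continuous_image continuous_on_subset[OF assms]) auto
  then obtain B where B: "\<And>y. y \<in> (\<lambda>(t, x). G t x) ` ({0..T} \<times> cbox 0 1) \<Longrightarrow> norm y \<le> B"
    unfolding bounded_iff by blast
  show ?thesis
  proof (rule that[of "max B 0"])
    fix t x assume "t \<in> {0..T}" "x \<in> cbox (0::real^2) 1"
    thus "\<bar>G t x\<bar> \<le> max B 0" using B[of "G t x"] by fastforce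
  qed simp
qed

lemma avg_has_real_derivative:
  assumes G: "\<And>t x. t \<in> {0..T} \<Longrightarrow> ((\<lambda>s. G s x) has_vector_derivative G' t x) (at t within {0..T})"
    and cG: "\<And>t. t \<in> {0..T} \<Longrightarrow> continuous_on UNIV (G t)"
    and cG': "continuous_on ({0..T} \<times> UNIV) (\<lambda>(t, x). G' t x)"
    and t: "t \<in> {0..T}"
  shows "((\<lambda>t. avg (G t)) has_real_derivative avg (G' t)) (at t within {0..T})"
proof -
  have c: "continuous_on (cbox 0 1) (G t)" if "t \<in> {0..T}" for t
    using cG[OF that] by (rule continuous_on_subset) auto
  have "continuous_on (cbox 0 1) (\<lambda>x. (\<lambda>(t, x). G' t x) (t, x))"
    by (rule continuous_on_compose2[OF cG']) (use t in \<open>auto intro!: continuous_intros\<close>)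
  hence c': "continuous_on (cbox 0 1) (G' t)" by simp
  have "((\<lambda>t. integral (cbox 0 1) (G t)) has_vector_derivative integral (cbox 0 1) (G' t)) (at t within {0..T})"
    using t by (intro leibniz_rule_vector_derivative G integrable_continuous c continuous_on_subset[OF cG']) auto
  hence "((\<lambda>t. avg (G t)) has_vector_derivative integral (cbox 0 1) (G' t)) (at t within {0..T})"
    by (rule has_vector_derivative_transform[OF t, rotated]) (simp add: avg_eq_integral c)
  thus ?thesis
    by (simp add: avg_eq_integral c' has_real_derivative_iff_has_vector_derivative)
qed

text \<open>For continuous functions the essential supremum is a true supremum over the closed
  square: a strict excess would hold on an open set, and open nonempty sets are not null.\<close>

lemma
  fixes f :: "real^2 \<Rightarrow> 'a::euclidean_space"
  assumes f: "continuous_on UNIV f"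
  shows norm_le_Linf: "x \<in> cbox 0 1 \<Longrightarrow> norm (f x) \<le> Linf_norm f"
    and Linf_le: "(\<And>x. x \<in> cbox 0 1 \<Longrightarrow> norm (f x) \<le> B) \<Longrightarrow> Linf_norm f \<le> B"
proof -
  define m where "m = esssup torus_measure (\<lambda>x. ereal (norm (f x)))"
  have meas: "(\<lambda>x. ereal (norm (f x))) \<in> borel_measurable torus_measure"
    unfolding torus_measure_def
    by (rule measurable_restrict_space1)
      (use borel_measurable_continuous_onI[OF f] in simp)
  have le: "m \<le> ereal B" if "\<And>x. x \<in> cbox 0 1 \<Longrightarrow> norm (f x) \<le> B" for B
    unfolding m_def by (rule esssup_I[OF meas]) (use that in \<open>auto intro!: AE_I2\<close>)
  have ge: "ereal (norm (f x)) \<le> m" if x: "x \<in> cbox 0 1" for x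
  proof (rule ccontr)
    assume "\<not> ereal (norm (f x)) \<le> m"
    hence lt: "m < ereal (norm (f x))" by simp
    define U where "U = (\<lambda>y. ereal (norm (f y))) -` {m<..}"
    have cU: "continuous_on UNIV (\<lambda>y. ereal (norm (f y)))"
      by (intro continuous_intros f)
    have U: "open U" "x \<in> U"
      using open_vimage[OF open_greaterThan cU] lt by (auto simp: U_def)
    have "box (0::real^2) 1 \<noteq> {}"
      by (auto simp: box_ne_empty Basis_vec_def inner_axis)
    \<comment> \<open>\<open>x\<close> may lie on the boundary of the square, but being in the
      closure of the open box it has points of that box nearby where the excess persists.\<close>
    hence "x \<in> closure (box 0 1)" using x closure_box[of "0::real^2" 1] by simp
    hence ne: "box 0 1 \<inter> U \<noteq> {}"
      using U open_Int_closure_eq_empty[of U "box 0 1"] by auto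
    have "AE y in torus_measure. ereal (norm (f y)) \<le> m"
      unfolding m_def by (rule esssup_AE)
    hence "AE y in lborel. y \<in> cbox 0 1 \<longrightarrow> ereal (norm (f y)) \<le> m"
      unfolding torus_measure_def by (subst (asm) AE_restrict_space_iff) auto
    hence "AE y in lborel. y \<notin> box 0 1 \<inter> U"
      by (rule eventually_mono) (use box_subset_cbox[of "0::real^2" 1] in \<open>auto simp: U_def\<close>)
    moreover have o: "open (box 0 1 \<inter> U)" using U by auto
    ultimately have "box 0 1 \<inter> U \<in> null_sets lborel"
      by (subst AE_iff_null_sets) (auto simp: borel_open)
    hence "negligible (box 0 1 \<inter> U)"
      by (simp add: negligible_iff_null_sets null_sets_completionI)
    thus False using open_not_negligible[OF o ne] by simp
  qed
  obtain b where b: "\<And>x. x \<in> cbox 0 1 \<Longrightarrow> norm (f x) \<le> b"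
    using compact_imp_bounded[OF compact_continuous_image[OF continuous_on_subset[OF f subset_UNIV] compact_cbox[of 0 1]]]
    unfolding bounded_iff by (metis image_eqI)
  \<comment> \<open>One point of the square bounds \<open>m\<close> from below and compactness from
    above, so \<open>m\<close> is finite and \<open>real_of_ereal\<close> does not fall back to its
    default 0.\<close>
  have "0 \<in> cbox (0::real^2) 1" by (simp add: mem_box_cart)
  from ge[OF this] le[of b] b have "ereal (norm (f 0)) \<le> m" "m \<le> ereal b" by auto
  then obtain r where r: "m = ereal r" by (cases m) auto
  hence L: "Linf_norm f = r" by (simp add: Linf_norm_def m_def)
  show "x \<in> cbox 0 1 \<Longrightarrow> norm (f x) \<le> Linf_norm f" using ge[of x] by (simp add: r L)
  show "(\<And>x. x \<in> cbox 0 1 \<Longrightarrow> norm (f x) \<le> B) \<Longrightarrow> Linf_norm f \<le> B"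
    using le[of B] by (simp add: r L)
qed

text \<open>Uniform continuity on the compact slab moves the supremum by at most
  \<open>e / 2\<close>. Continuity in time makes the velocity gradient a legitimate Gronwall
  coefficient.\<close>

lemma Linf_norm_continuous:
  fixes J :: "real \<Rightarrow> real^2 \<Rightarrow> 'a::euclidean_space"
  assumes J: "continuous_on ({0..T} \<times> UNIV) (\<lambda>(t, x). J t x)"
  shows "continuous_on {0..T} (\<lambda>t. Linf_norm (J t))"
proof -
  let ?S = "{0..T} \<times> cbox (0::real^2) 1"
  have c: "continuous_on UNIV (J t)" if "t \<in> {0..T}" for t
  proof -
    have "continuous_on UNIV (\<lambda>x. (\<lambda>(t, x). J t x) (t, x))"
      by (rule continuous_on_compose2[OF J]) (use that in \<open>auto intro!: continuous_intros\<close>)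
    thus ?thesis by simp
  qed
  have "uniformly_continuous_on ?S (\<lambda>(t, x). J t x)"
    by (intro compact_uniformly_continuous continuous_on_subset[OF J] compact_Times compact_Icc compact_cbox) auto
  note unif = this[unfolded uniformly_continuous_on_def]
  show ?thesis
    unfolding continuous_on_iff
  proof (intro ballI allI impI)
    fix t e :: real assume t: "t \<in> {0..T}" and e: "0 < e"
    obtain d where d: "0 < d" "\<And>p q. p \<in> ?S \<Longrightarrow> q \<in> ?S \<Longrightarrow> dist q p < d \<Longrightarrow>
        dist ((\<lambda>(t, x). J t x) q) ((\<lambda>(t, x). J t x) p) < e / 2"
      using unif e by (metis half_gt_zero)
    have le: "Linf_norm (J s) \<le> Linf_norm (J r) + e / 2"
      if "s \<in> {0..T}" "r \<in> {0..T}" "dist s r < d" for s r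
    proof (rule Linf_le[OF c[OF that(1)]])
      fix x assume x: "x \<in> cbox (0::real^2) 1"
      have "dist (J s x) (J r x) < e / 2"
        using d(2)[of "(r, x)" "(s, x)"] that x by (simp add: dist_Pair_Pair)
      hence "norm (J s x) \<le> norm (J r x) + e / 2"
        using norm_triangle_ineq2[of "J s x" "J r x"] by (simp add: dist_norm)
      thus "norm (J s x) \<le> Linf_norm (J r) + e / 2"
        using norm_le_Linf[OF c[OF that(2)] x] by simp
    qed
    have "dist (Linf_norm (J s)) (Linf_norm (J t)) < e" if s: "s \<in> {0..T}" "dist s t < d" for s
    proof -
      have "dist t s < d" using s(2) by (simp only: dist_commute)
      from le[OF s(1) t s(2)] le[OF t s(1) this] show ?thesis
        unfolding dist_real_def using e by linarith
    qed
    thus "\<exists>d>0. \<forall>s\<in>{0..T}. dist s t < d \<longrightarrow> dist (Linf_norm (J s)) (Linf_norm (J t)) < e"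
      using d(1) by blast
  qed
qed

lemma L1_Linf_norm_eq_integral:
  assumes "continuous_on ({0..T} \<times> UNIV) (\<lambda>(t, x). J t x)"
  shows "L1_Linf_norm T J = integral {0..T} (\<lambda>t. Linf_norm (J t))"
  unfolding L1_Linf_norm_def
  by (rule set_borel_integral_eq_integral(2)) (rule borel_integrable_atLeastAtMost'[OF Linf_norm_continuous[OF assms]])

section \<open>Elliptic estimates at a fixed time\<close>

text \<open>
  \<open>hneg\<close> is the square of the homogeneous \<open>H\<^sup>-\<^sup>1\<close> norm and \<open>pot\<close> the solution of the Poisson
  equation, both restricted to the modes in \<open>boxZ N\<close>. The mode \<open>k = 0\<close> drops out because
  \<open>x / 0 = 0\<close>.
\<close>

definition hneg :: "nat \<Rightarrow> (real^2 \<Rightarrow> real) \<Rightarrow> real"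
  where "hneg N f = (\<Sum>k\<in>boxZ N. (coef f k)\<^sup>2 / (4 * pi\<^sup>2 * nsq k))"

definition pot :: "nat \<Rightarrow> (real^2 \<Rightarrow> real) \<Rightarrow> real^2 \<Rightarrow> real"
  where "pot N f = trig (\<lambda>k. - (coef f k / (4 * pi\<^sup>2 * nsq k))) (boxZ N)"

lemma hneg_nonneg [simp]: "0 \<le> hneg N f"
  by (simp add: hneg_def sum_nonneg)

lemma torus_C_pot: "torus_C n (pot N f)"
  unfolding pot_def by (rule torus_C_trig)

lemma dirichlet_pot: "dirichlet (pot N f) = hneg N f"
proof -
  have "4 * pi\<^sup>2 * (nsq k * (- (coef f k / (4 * pi\<^sup>2 * nsq k)))\<^sup>2) = (coef f k)\<^sup>2 / (4 * pi\<^sup>2 * nsq k)" for k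
    by (cases "nsq k = 0") (simp_all add: power2_eq_square field_simps)
  thus ?thesis unfolding pot_def dirichlet_trig hneg_def sum_distrib_left by (rule sum.cong[OF refl])
qed

lemma avg_mult_pot:
  "continuous_on UNIV h \<Longrightarrow> avg (\<lambda>x. h x * pot N f x) = - (\<Sum>k\<in>boxZ N. coef f k * coef h k / (4 * pi\<^sup>2 * nsq k))"
  unfolding pot_def by (subst avg_mult_trig) (simp_all add: sum_negf)

lemma laplacian_trig:
  "laplacian (trig c (boxZ N)) x = trig (\<lambda>k. - (4 * pi\<^sup>2 * nsq k) * c k) (boxZ N) x"
proof -
  have "(\<Sum>i\<in>UNIV. pderiv_at i (pderiv_at i (trig c (boxZ N))) x)
      = (\<Sum>k\<in>boxZ N. - (4 * pi\<^sup>2 * (\<Sum>i\<in>UNIV. (freq i k)\<^sup>2)) * c k * cas k x)"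
    unfolding pderiv_at_trig trig_def
    by (subst sum.swap) (simp add: sum_2 power2_eq_square algebra_simps)
  thus ?thesis by (simp add: laplacian_def trig_def sum_freq_sq)
qed

text \<open>\<open>pot\<close> discards the mode 0, so it inverts the Laplacian on the box only for
  functions of mean zero.\<close>

lemma laplacian_pot:
  assumes "coef f 0 = 0"
  shows "laplacian (pot N f) x = proj N f x"
proof -
  have "- (4 * pi\<^sup>2 * nsq k) * - (coef f k / (4 * pi\<^sup>2 * nsq k)) = coef f k" for k
    using assms by (cases "k = 0") simp_all
  thus ?thesis unfolding pot_def laplacian_trig by (simp only:)
qed

text \<open>Duality: the bracket is tested against its own potential, whose Dirichlet energy is
  again the H^-1 energy. The Wente inequality then reads h * h \<le> h * c, and h cancels unless it
  is zero.\<close>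

lemma hneg_bracket_le:
  assumes a: "torus_C (Suc m) a" and b: "torus_C (Suc n) b"
  shows "hneg N (bracket a b) \<le> 21 * (dirichlet a * dirichlet b)"
proof -
  let ?h = "hneg N (bracket a b)" and ?g = "pot N (bracket a b)"
  have "torus_C 0 (bracket a b)"
    using torus_C_lower[OF a, of 1] torus_C_lower[OF b, of 1] by (intro torus_C_bracket) auto
  hence c: "continuous_on UNIV (bracket a b)" by simp
  have "avg (\<lambda>x. bracket a b x * ?g x) = - ?h"
    unfolding avg_mult_pot[OF c] hneg_def by (simp add: power2_eq_square)
  hence "?h\<^sup>2 = (avg (\<lambda>x. ?g x * bracket a b x))\<^sup>2"
    by (simp add: mult.commute)
  also have "\<dots> \<le> 21 * (dirichlet ?g * (dirichlet a * dirichlet b))"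
    unfolding pot_def by (rule Wente[OF a b])
  finally have "?h * ?h \<le> ?h * (21 * (dirichlet a * dirichlet b))"
    by (simp add: dirichlet_pot power2_eq_square mult_ac)
  moreover have "0 \<le> 21 * (dirichlet a * dirichlet b)" by simp
  ultimately show ?thesis
    using hneg_nonneg[of N "bracket a b"] by (cases "?h = 0") (auto simp del: hneg_nonneg)
qed

lemma avg_sq_eq_proj:
  assumes "continuous_on UNIV f"
  shows "avg (\<lambda>x. (f x)\<^sup>2) = avg (\<lambda>x. (f x - proj N f x)\<^sup>2) + (\<Sum>k\<in>boxZ N. (coef f k)\<^sup>2)"
  using avg_sq_diff_trig[OF assms finite_boxZ, of "coef f"] by simp

lemma coef_laplacian:
  assumes w: "torus_C (Suc (Suc n)) w"
  shows "coef (laplacian w) k = - (4 * pi\<^sup>2 * nsq k) * coef w k"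
proof -
  have w1: "torus_C (Suc n) (pderiv_at i w)" and w2: "torus_C n (pderiv_at i (pderiv_at i w))" for i
    using torus_C_pderiv[OF w] torus_C_pderiv by blast+
  have "coef (laplacian w) k = avg (\<lambda>x. \<Sum>i\<in>UNIV. pderiv_at i (pderiv_at i w) x * cas k x)"
    by (simp add: coef_def laplacian_def sum_distrib_right)
  also have "\<dots> = (\<Sum>i\<in>UNIV. coef (pderiv_at i (pderiv_at i w)) k)"
    unfolding coef_def
    by (intro Bochner_Integration.integral_sum integrable_torus' continuous_intros torus_C_cont[OF w2])
  also have "\<dots> = - (4 * pi\<^sup>2 * (\<Sum>i\<in>UNIV. (freq i k)\<^sup>2)) * coef w k"
    by (simp add: coef_pderiv_at[OF w1] coef_pderiv_at[OF w] sum_2 power2_eq_square algebra_simps)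
  finally show ?thesis by (simp add: sum_freq_sq)
qed

text \<open>On the box the gradient of \<open>w\<close> is read off from the Poisson equation;
  outside it the second derivatives pay, as in \<open>avg_sq_diff_proj_le\<close>. The factors 2
  come from splitting the square of a difference. Multiplying by \<open>N\<close> squared avoids
  division when \<open>N = 0\<close>.\<close>

lemma dirichlet_le_hneg:
  assumes w: "torus_C (Suc (Suc n)) w"
    and \<theta>: "continuous_on UNIV \<theta>" and d: "continuous_on UNIV d"
    and eq: "\<And>x. laplacian w x = \<theta> x - \<epsilon> * d x"
  shows "(real N)\<^sup>2 * dirichlet w
    \<le> (real N)\<^sup>2 * (2 * hneg N \<theta> + 2 * \<epsilon>\<^sup>2 * hneg N d) + (\<Sum>i\<in>UNIV. dirichlet (pderiv_at i w))"
proof -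
  have w1: "torus_C (Suc n) (pderiv_at i w)" for i
    using w by (rule torus_C_pderiv)
  have "coef (laplacian w) k = coef \<theta> k - \<epsilon> * coef d k" for k
  proof -
    have "coef (laplacian w) k = avg (\<lambda>x. \<theta> x * cas k x - \<epsilon> * (d x * cas k x))"
      by (simp add: coef_def eq left_diff_distrib mult.assoc)
    also have "\<dots> = avg (\<lambda>x. \<theta> x * cas k x) - avg (\<lambda>x. \<epsilon> * (d x * cas k x))"
      by (intro Bochner_Integration.integral_diff integrable_torus' continuous_intros \<theta> d)
    finally show ?thesis by (simp add: coef_def)
  qed
  hence cw: "4 * pi\<^sup>2 * nsq k * coef w k = - (coef \<theta> k - \<epsilon> * coef d k)" for k
    using coef_laplacian[OF w, of k] by (metis add.inverse_inverse mult_minus_left)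
  have termwise: "4 * pi\<^sup>2 * (nsq k * (coef w k)\<^sup>2)
      \<le> 2 * ((coef \<theta> k)\<^sup>2 / (4 * pi\<^sup>2 * nsq k)) + 2 * \<epsilon>\<^sup>2 * ((coef d k)\<^sup>2 / (4 * pi\<^sup>2 * nsq k))" for k
  proof (cases "k = 0")
    case False
    define m where "m = 4 * pi\<^sup>2 * nsq k"
    have m: "0 < m" using False nsq_nonneg[of k] nsq_eq_0[of k] by (simp add: m_def less_le)
    have "m * (m * (coef w k)\<^sup>2) = (m * coef w k)\<^sup>2" by (simp add: power2_eq_square mult_ac)
    also have "\<dots> = (coef \<theta> k - \<epsilon> * coef d k)\<^sup>2" using cw[of k] by (simp add: m_def power2_commute)
    also have "\<dots> \<le> 2 * (coef \<theta> k)\<^sup>2 + 2 * (\<epsilon> * coef d k)\<^sup>2"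
      using zero_le_power2[of "coef \<theta> k + \<epsilon> * coef d k"] by (simp add: power2_eq_square algebra_simps)
    finally have "m * (coef w k)\<^sup>2 \<le> (2 * (coef \<theta> k)\<^sup>2 + 2 * (\<epsilon> * coef d k)\<^sup>2) / m"
      using m by (simp add: pos_le_divide_eq mult.commute)
    thus ?thesis by (simp add: m_def add_divide_distrib power_mult_distrib mult_ac)
  qed (simp add: nsq_def)
  have "(\<Sum>i\<in>UNIV. \<Sum>k\<in>boxZ N. (coef (pderiv_at i w) k)\<^sup>2) = 4 * pi\<^sup>2 * (\<Sum>k\<in>boxZ N. nsq k * (coef w k)\<^sup>2)"
    unfolding coef_pderiv_at[OF w] by (rule sum_freq_coef_sq)
  also have "\<dots> \<le> (\<Sum>k\<in>boxZ N. 2 * ((coef \<theta> k)\<^sup>2 / (4 * pi\<^sup>2 * nsq k)) + 2 * \<epsilon>\<^sup>2 * ((coef d k)\<^sup>2 / (4 * pi\<^sup>2 * nsq k)))"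
    unfolding sum_distrib_left by (intro sum_mono termwise)
  also have "\<dots> = 2 * hneg N \<theta> + 2 * \<epsilon>\<^sup>2 * hneg N d"
    by (simp add: hneg_def sum.distrib sum_distrib_left)
  finally have main: "(\<Sum>i\<in>UNIV. \<Sum>k\<in>boxZ N. (coef (pderiv_at i w) k)\<^sup>2) \<le> 2 * hneg N \<theta> + 2 * \<epsilon>\<^sup>2 * hneg N d" .
  have "(real N)\<^sup>2 * dirichlet w = (\<Sum>i\<in>UNIV. (real N)\<^sup>2 * avg (\<lambda>x. (pderiv_at i w x - proj N (pderiv_at i w) x)\<^sup>2))
      + (real N)\<^sup>2 * (\<Sum>i\<in>UNIV. \<Sum>k\<in>boxZ N. (coef (pderiv_at i w) k)\<^sup>2)"
    unfolding dirichlet_def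
    by (subst avg_sq_eq_proj[of _ N]) (auto intro: torus_C_cont[OF w1] simp: sum.distrib sum_distrib_left distrib_left)
  also have "\<dots> \<le> (\<Sum>i\<in>UNIV. dirichlet (pderiv_at i w)) + (real N)\<^sup>2 * (2 * hneg N \<theta> + 2 * \<epsilon>\<^sup>2 * hneg N d)"
    by (intro add_mono sum_mono avg_sq_diff_proj_le[OF w1] mult_left_mono main) auto
  finally show ?thesis by simp
qed

section \<open>Second derivatives and the Monge-Ampere determinant\<close>

lemma norm_vec_sq: "(norm v)\<^sup>2 = (\<Sum>i\<in>UNIV. (v $ i)\<^sup>2)" for v :: "real^'n"
  unfolding power2_norm_eq_inner inner_vec_def by (simp add: power2_eq_square)

lemma norm_mat_sq: "(norm A)\<^sup>2 = (\<Sum>i\<in>UNIV. \<Sum>j\<in>UNIV. (A $ i $ j)\<^sup>2)" for A :: "real^'n^'m"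
  unfolding power2_norm_eq_inner inner_vec_def by (simp add: power2_eq_square)

lemma hessian_sq: "(norm (hessian f x))\<^sup>2 = (pderiv_at 1 (pderiv_at 1 f) x)\<^sup>2 + (pderiv_at 1 (pderiv_at 2 f) x)\<^sup>2
    + (pderiv_at 2 (pderiv_at 1 f) x)\<^sup>2 + (pderiv_at 2 (pderiv_at 2 f) x)\<^sup>2"
  unfolding norm_mat_sq by (simp add: sum_2 hessian_def)

text \<open>The planar expansion det (I + \<epsilon> A) = 1 + \<epsilon> tr A + \<epsilon>^2 det A,
  with the determinant of the Hessian written as a bracket so that the Wente inequality
  applies.\<close>

lemma det_hessian:
  "det (mat 1 + \<epsilon> *\<^sub>R hessian f x) = 1 + \<epsilon> * (laplacian f x + \<epsilon> * bracket (pderiv_at 1 f) (pderiv_at 2 f) x)"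
  by (simp add: det_2 mat_def hessian_def laplacian_def bracket_eq sum_2 algebra_simps)

text \<open>
  The integral of \<open>det D\<^sup>2 f\<close> vanishes, so \<open>D\<^sup>2 f\<close> and \<open>\<Delta> f\<close> have the same \<open>L\<^sup>2\<close> norm, and the smallness
  of \<open>\<epsilon> D\<^sup>2 f\<close> lets the determinant be absorbed.
\<close>

lemma avg_hessian_le:
  assumes f: "torus_C (Suc (Suc (Suc n))) f"
    and r: "\<And>x. r x = laplacian f x + \<epsilon> * bracket (pderiv_at 1 f) (pderiv_at 2 f) x"
    and small: "\<And>x. x \<in> cbox 0 1 \<Longrightarrow> \<epsilon> * norm (hessian f x) \<le> 1" and \<epsilon>: "0 < \<epsilon>"
  shows "dirichlet (pderiv_at 1 f) + dirichlet (pderiv_at 2 f) \<le> 4 * avg (\<lambda>x. (r x)\<^sup>2)"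
proof -
  let ?d = "bracket (pderiv_at 1 f) (pderiv_at 2 f)" and ?p = "\<lambda>i j. pderiv_at i (pderiv_at j f)"
  have f1: "torus_C (Suc (Suc n)) (pderiv_at i f)" and f2: "torus_C (Suc n) (?p i j)" for i j
    using torus_C_pderiv[OF f] torus_C_pderiv by blast+
  have c: "continuous_on UNIV (?p i j)" for i j by (rule torus_C_cont[OF f2])
  have cd: "continuous_on UNIV ?d" by (rule torus_C_cont[OF torus_C_bracket[OF f1 f1]])
  have rc: "continuous_on UNIV r"
    unfolding r[abs_def] laplacian_def by (intro continuous_intros c cd)
  have int: "integrable torus_measure (\<lambda>x. (?p i j x)\<^sup>2)" "integrable torus_measure ?d" for i j
    by (intro integrable_torus' continuous_intros c cd)+
  let ?h = "\<lambda>x. (norm (hessian f x))\<^sup>2"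
  have ch: "continuous_on UNIV (hessian f)"
    unfolding hessian_def[abs_def] by (intro continuous_on_vec_lambda c)
  have H: "dirichlet (pderiv_at 1 f) + dirichlet (pderiv_at 2 f) = avg ?h"
    unfolding hessian_sq dirichlet_def sum_2 using int by simp
  \<comment> \<open>The term \<open>2 * ?d x\<close> is left unestimated, since it integrates to
    zero exactly.\<close>
  have "avg ?h \<le> avg (\<lambda>x. (2 * (r x)\<^sup>2 + ?h x / 2) - 2 * ?d x)"
  proof (rule avg_mono)
    fix x :: "real^2" assume x: "x \<in> cbox 0 1"
    have comm: "?p 2 1 x = ?p 1 2 x" using pderiv_at_commute[OF f, of 2 1] by simp
    have d: "?d x = ?p 1 1 x * ?p 2 2 x - (?p 1 2 x)\<^sup>2"
      by (simp add: bracket_eq comm power2_eq_square)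
    have lap: "?h x = (laplacian f x)\<^sup>2 - 2 * ?d x"
      unfolding d hessian_sq comm laplacian_def sum_2 by (simp add: power2_eq_square algebra_simps)
    have "\<bar>?d x\<bar> \<le> ?h x / 2"
    proof -
      have "\<bar>a * b - c\<^sup>2\<bar> \<le> (a\<^sup>2 + c\<^sup>2 + c\<^sup>2 + b\<^sup>2) / 2" for a b c :: real
      proof -
        have "0 \<le> a\<^sup>2 + b\<^sup>2 - 2 * (a * b)" "0 \<le> a\<^sup>2 + b\<^sup>2 + 2 * (a * b)"
          using zero_le_power2[of "a - b"] zero_le_power2[of "a + b"]
          unfolding power2_diff power2_sum by (simp_all add: mult.assoc)
        moreover have "\<bar>p - q\<bar> \<le> (r + q + q + s) / 2"
          if "0 \<le> q" "0 \<le> r + s - 2 * p" "0 \<le> r + s + 2 * p" for p q r s :: real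
          unfolding abs_le_iff by (intro conjI) (use that in argo)+
        ultimately show ?thesis by (simp only: zero_le_power2)
      qed
      thus ?thesis unfolding d hessian_sq comm .
    qed
    hence "\<epsilon> * \<bar>?d x\<bar> \<le> (\<epsilon> * norm (hessian f x)) * (norm (hessian f x) / 2)"
      using \<epsilon> by (simp add: power2_eq_square mult_left_mono)
    also have "\<dots> \<le> 1 * (norm (hessian f x) / 2)"
      by (rule mult_right_mono[OF small[OF x]]) simp
    finally have "(\<epsilon> * \<bar>?d x\<bar>)\<^sup>2 \<le> (norm (hessian f x) / 2)\<^sup>2"
      using \<epsilon> by (intro power_mono) auto
    \<comment> \<open>Twice this quantity enters the bound for the squared Laplacian, so half of
      \<open>?h\<close> is absorbed on the left; the remaining half turns the factor 2 into
      4.\<close>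
    hence ed: "(\<epsilon> * ?d x)\<^sup>2 \<le> ?h x / 4"
      by (simp add: power_mult_distrib power_divide)
    have "(laplacian f x)\<^sup>2 = (r x - \<epsilon> * ?d x)\<^sup>2" by (simp add: r)
    also have "\<dots> \<le> 2 * (r x)\<^sup>2 + 2 * (\<epsilon> * ?d x)\<^sup>2"
      using zero_le_power2[of "r x + \<epsilon> * ?d x"] by (simp add: power2_eq_square algebra_simps)
    finally show "?h x \<le> (2 * (r x)\<^sup>2 + ?h x / 2) - 2 * ?d x"
      using lap ed by linarith
  qed (auto intro!: continuous_intros ch rc cd)
  also have "\<dots> = 2 * avg (\<lambda>x. (r x)\<^sup>2) + avg ?h / 2"
  proof -
    have "integrable torus_measure (\<lambda>x. (r x)\<^sup>2)" "integrable torus_measure ?h"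
      by (intro integrable_torus' continuous_intros rc ch)+
    moreover have "avg ?d = 0" by (rule avg_bracket[OF f1 f1])
    ultimately show ?thesis using int(2) by simp
  qed
  finally show ?thesis unfolding H by simp
qed

section \<open>Stretching by the Euler flow\<close>

lemma jacobian_perp_grad:
  assumes f: "torus_C (Suc (Suc n)) f"
  shows "jacobian (perp_grad f) (at x) = (\<chi> i j. if i = 1 then - pderiv_at j (pderiv_at 2 f) x else pderiv_at j (pderiv_at 1 f) x)"
proof -
  have d: "(pderiv_at i f has_derivative (\<lambda>v. \<Sum>j\<in>UNIV. v $ j * pderiv_at j (pderiv_at i f) x)) (at x)" for i
    by (rule pderiv_at_has_derivative[OF torus_C_diff[OF torus_C_pderiv[OF f]]])
  have "((\<lambda>x. (- pderiv_at 2 f x) *\<^sub>R (axis 1 1 :: real^2) + pderiv_at 1 f x *\<^sub>R axis 2 1) has_derivative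
      (\<lambda>v. (- (\<Sum>j\<in>UNIV. v $ j * pderiv_at j (pderiv_at 2 f) x)) *\<^sub>R (axis 1 1 :: real^2)
        + (\<Sum>j\<in>UNIV. v $ j * pderiv_at j (pderiv_at 1 f) x) *\<^sub>R axis 2 1)) (at x)"
    by (intro has_derivative_add has_derivative_scaleR_left has_derivative_minus d)
  moreover have "(\<lambda>x. (- pderiv_at 2 f x) *\<^sub>R (axis 1 1 :: real^2) + pderiv_at 1 f x *\<^sub>R axis 2 1) = perp_grad f"
    by (simp add: fun_eq_iff perp_grad_def vec_eq_iff forall_2 axis_def)
  ultimately have "(perp_grad f has_derivative
      (\<lambda>v. (- (\<Sum>j\<in>UNIV. v $ j * pderiv_at j (pderiv_at 2 f) x)) *\<^sub>R (axis 1 1 :: real^2)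
        + (\<Sum>j\<in>UNIV. v $ j * pderiv_at j (pderiv_at 1 f) x) *\<^sub>R axis 2 1)) (at x)"
    by (simp only:)
  hence "frechet_derivative (perp_grad f) (at x) =
      (\<lambda>v. (- (\<Sum>j\<in>UNIV. v $ j * pderiv_at j (pderiv_at 2 f) x)) *\<^sub>R (axis 1 1 :: real^2)
        + (\<Sum>j\<in>UNIV. v $ j * pderiv_at j (pderiv_at 1 f) x) *\<^sub>R axis 2 1)"
    by (rule frechet_derivative_at[symmetric])
  thus ?thesis
    by (simp add: jacobian_def matrix_def vec_eq_iff forall_2 sum_2 axis_def)
qed

text \<open>Cauchy-Schwarz over the entries. The norm of \<open>J\<close> is the Frobenius norm, the
  one that \<open>Linf_norm\<close> takes pointwise.\<close>

lemma quadratic_form_le: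
  fixes J :: "real^2^2" and w :: "2 \<Rightarrow> real"
  shows "(\<Sum>i\<in>UNIV. \<Sum>j\<in>UNIV. J $ j $ i * (w i * w j)) \<le> norm J * (\<Sum>i\<in>UNIV. (w i)\<^sup>2)"
proof -
  have n: "(norm J)\<^sup>2 = (\<Sum>(i, j)\<in>UNIV. (J $ j $ i)\<^sup>2)"
    by (simp add: UNIV_Times_UNIV[symmetric] sum.cartesian_product[symmetric] del: UNIV_Times_UNIV)
      (simp add: norm_mat_sq sum_2)
  have "(\<Sum>p\<in>UNIV. (\<lambda>(i, j). J $ j $ i) p * (\<lambda>(i, j). w i * w j) p)\<^sup>2
      \<le> (\<Sum>p\<in>UNIV. ((\<lambda>(i, j). J $ j $ i) p)\<^sup>2) * (\<Sum>p\<in>UNIV. ((\<lambda>(i, j). w i * w j) p)\<^sup>2)"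
    by (rule Cauchy_Schwarz_ineq_sum)
  also have "\<dots> = (norm J * (\<Sum>i\<in>UNIV. (w i)\<^sup>2))\<^sup>2"
    unfolding power_mult_distrib n
    by (simp add: split_def UNIV_Times_UNIV[symmetric] sum.cartesian_product[symmetric, of "\<lambda>i j. (w i * w j)\<^sup>2", simplified split_def] del: UNIV_Times_UNIV)
      (simp add: sum_2 power2_eq_square algebra_simps)
  finally have "(\<Sum>p\<in>UNIV. (\<lambda>(i, j). J $ j $ i) p * (\<lambda>(i, j). w i * w j) p) \<le> norm J * (\<Sum>i\<in>UNIV. (w i)\<^sup>2)"
    by (rule power2_le_imp_le) (simp add: sum_nonneg)
  thus ?thesis
    by (simp add: UNIV_Times_UNIV[symmetric] sum.cartesian_product split_def del: UNIV_Times_UNIV)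
qed

lemma pderiv_at_bracket:
  assumes f: "torus_C (Suc (Suc m)) f" and g: "torus_C (Suc (Suc n)) g"
  shows "pderiv_at i (bracket f g) x = bracket (pderiv_at i f) g x + bracket f (pderiv_at i g) x"
proof -
  have d: "pderiv_at j f differentiable (at x)" "pderiv_at j g differentiable (at x)" for j
    using torus_C_diff[OF torus_C_pderiv[OF f]] torus_C_diff[OF torus_C_pderiv[OF g]] by auto
  have "pderiv_at i (bracket f g) x = pderiv_at i (\<lambda>x. pderiv_at 1 f x * pderiv_at 2 g x) x
      - pderiv_at i (\<lambda>x. pderiv_at 2 f x * pderiv_at 1 g x) x"
    unfolding bracket_eq[abs_def] by (intro pderiv_at_diff differentiable_mult d)
  thus ?thesis
    by (simp add: pderiv_at_mult d bracket_eq pderiv_at_commute[OF f, of i] pderiv_at_commute[OF g, of i] algebra_simps)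
qed

text \<open>After one integration by parts the derivative of the bracket falls on either factor. The
  term with second derivatives of \<open>W\<close> vanishes by skew-adjointness; what remains is a
  quadratic form in the gradient of \<open>W\<close> whose matrix is the velocity gradient.\<close>

lemma stretching_le:
  assumes f: "torus_C (Suc (Suc (Suc n))) f" and W: "torus_C (Suc (Suc (Suc m))) W"
    and a: "\<And>x. x \<in> cbox 0 1 \<Longrightarrow> norm (jacobian (perp_grad f) (at x)) \<le> a"
  shows "- avg (\<lambda>x. laplacian W x * bracket f W x) \<le> a * dirichlet W"
proof -
  have f1: "torus_C (Suc (Suc n)) (pderiv_at i f)" and W1: "torus_C (Suc (Suc m)) (pderiv_at i W)" for i
    using torus_C_pderiv f W by blast+
  have f': "torus_C (Suc (Suc n)) f" and W': "torus_C (Suc (Suc m)) W"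
    using torus_C_lower[OF f, of "Suc (Suc n)"] torus_C_lower[OF W, of "Suc (Suc m)"] by (auto simp del: torus_C.simps)
  have f'': "torus_C (Suc (Suc 0)) f" and W'': "torus_C (Suc (Suc 0)) W"
    using torus_C_lower[OF f, of "Suc (Suc 0)"] torus_C_lower[OF W, of "Suc (Suc 0)"] by (auto simp del: torus_C.simps)
  have b: "torus_C (Suc 0) (bracket f W)" by (rule torus_C_bracket[OF f'' W''])
  note cW = torus_C_cont[OF W1] and cb = torus_C_cont[OF b]
  have cWW: "continuous_on UNIV (pderiv_at i (pderiv_at j W))" for i j
    by (rule torus_C_cont[OF torus_C_pderiv[OF W1]])
  have cff: "continuous_on UNIV (pderiv_at i (pderiv_at j f))" for i j
    by (rule torus_C_cont[OF torus_C_pderiv[OF f1]])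
  have cf: "continuous_on UNIV (pderiv_at j f)" for j
    by (rule torus_C_cont[OF f1])
  have cb1: "continuous_on UNIV (bracket (pderiv_at i f) W)" for i
    unfolding bracket_eq[abs_def] by (intro continuous_intros cff cW)
  have cb2: "continuous_on UNIV (bracket f (pderiv_at i W))" for i
    unfolding bracket_eq[abs_def] by (intro continuous_intros cf cWW)
  have one: "- avg (\<lambda>x. pderiv_at i (pderiv_at i W) x * bracket f W x) = avg (\<lambda>x. pderiv_at i W x * bracket (pderiv_at i f) W x)" for i
  proof -
    have "- avg (\<lambda>x. pderiv_at i (pderiv_at i W) x * bracket f W x)
        = avg (\<lambda>x. pderiv_at i W x * pderiv_at i (bracket f W) x)"
      using avg_by_parts[OF W1 b, of i i] by simp
    also have "\<dots> = avg (\<lambda>x. pderiv_at i W x * bracket (pderiv_at i f) W x + pderiv_at i W x * bracket f (pderiv_at i W) x)"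
      by (simp add: pderiv_at_bracket[OF f' W'] distrib_left)
    also have "\<dots> = avg (\<lambda>x. pderiv_at i W x * bracket (pderiv_at i f) W x) + avg (\<lambda>x. pderiv_at i W x * bracket f (pderiv_at i W) x)"
      by (intro Bochner_Integration.integral_add integrable_torus' continuous_intros cW cb1 cb2)
    also have "avg (\<lambda>x. pderiv_at i W x * bracket f (pderiv_at i W) x) = 0"
      using avg_mult_bracket[OF f' W1 W1, of i i] by simp
    finally show ?thesis by simp
  qed
  have "- avg (\<lambda>x. laplacian W x * bracket f W x) = (\<Sum>i\<in>UNIV. - avg (\<lambda>x. pderiv_at i (pderiv_at i W) x * bracket f W x))"
    unfolding laplacian_def sum_distrib_right sum_negf
    by (subst Bochner_Integration.integral_sum) (auto intro!: integrable_torus' continuous_intros cWW cb)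
  also have "\<dots> = (\<Sum>i\<in>UNIV. avg (\<lambda>x. pderiv_at i W x * bracket (pderiv_at i f) W x))"
    by (simp only: one)
  also have "\<dots> = avg (\<lambda>x. \<Sum>i\<in>UNIV. pderiv_at i W x * bracket (pderiv_at i f) W x)"
    by (intro Bochner_Integration.integral_sum[symmetric] integrable_torus' continuous_intros cW cb1)
  also have "\<dots> \<le> avg (\<lambda>x. a * (\<Sum>i\<in>UNIV. (pderiv_at i W x)\<^sup>2))"
  proof (rule avg_mono)
    fix x :: "real^2" assume x: "x \<in> cbox 0 1"
    let ?J = "jacobian (perp_grad f) (at x)"
    have "(\<Sum>i\<in>UNIV. pderiv_at i W x * bracket (pderiv_at i f) W x)
        = (\<Sum>i\<in>UNIV. \<Sum>j\<in>UNIV. ?J $ j $ i * (pderiv_at i W x * pderiv_at j W x))"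
      by (simp add: jacobian_perp_grad[OF f'] sum_2 bracket_eq pderiv_at_commute[OF f', of 2 1] algebra_simps)
    also have "\<dots> \<le> norm ?J * (\<Sum>i\<in>UNIV. (pderiv_at i W x)\<^sup>2)"
      by (rule quadratic_form_le)
    also have "\<dots> \<le> a * (\<Sum>i\<in>UNIV. (pderiv_at i W x)\<^sup>2)"
      by (intro mult_right_mono a[OF x] sum_nonneg) simp
    finally show "(\<Sum>i\<in>UNIV. pderiv_at i W x * bracket (pderiv_at i f) W x) \<le> a * (\<Sum>i\<in>UNIV. (pderiv_at i W x)\<^sup>2)" .
  qed (intro continuous_intros cW cb1)+
  also have "\<dots> = a * dirichlet W"
    unfolding dirichlet_def
    by (simp, subst Bochner_Integration.integral_sum) (auto intro!: integrable_torus' continuous_intros cW)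
  finally show ?thesis .
qed

lemma L2_norm_grad_diff:
  assumes f: "torus_C (Suc n) f" and g: "torus_C (Suc m) g"
  shows "L2_norm (\<lambda>x. grad f x - grad g x) = sqrt (dirichlet (\<lambda>x. f x - g x))"
proof -
  have p: "pderiv_at i (\<lambda>x. f x - g x) = (\<lambda>x. pderiv_at i f x - pderiv_at i g x)" for i
    using torus_C_diff[OF f] torus_C_diff[OF g] by (simp add: fun_eq_iff pderiv_at_diff)
  have "(norm (grad f x - grad g x))\<^sup>2 = (\<Sum>i\<in>UNIV. (pderiv_at i f x - pderiv_at i g x)\<^sup>2)" for x
    unfolding norm_vec_sq by (simp add: grad_def)
  thus ?thesis
    unfolding L2_norm_def dirichlet_def p
    by (simp, subst Bochner_Integration.integral_sum)
      (auto intro!: integrable_torus' continuous_intros torus_C_cont[OF torus_C_pderiv[OF f]] torus_C_cont[OF torus_C_pderiv[OF g]])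
qed

section \<open>Transport and the Gronwall inequality\<close>

lemma
  assumes F: "\<And>s. (F has_real_derivative F' s) (at s)" and F': "continuous_on UNIV F'"
    and f: "torus_C (Suc n) f"
  shows pderiv_at_compose: "pderiv_at i (\<lambda>x. F (f x)) x = F' (f x) * pderiv_at i f x"
    and torus_C_compose: "torus_C (Suc 0) (\<lambda>x. F (f x))"
proof -
  have d: "((\<lambda>x. F (f x)) has_derivative (\<lambda>v. F' (f x) * frechet_derivative f (at x) v)) (at x)" for x
    using has_derivative_compose[OF torus_C_diff[OF f, unfolded frechet_derivative_works] F[unfolded has_field_derivative_def]] .
  show p: "pderiv_at i (\<lambda>x. F (f x)) x = F' (f x) * pderiv_at i f x" for i x
    using pderiv_at_eqI[OF d] by (simp add: pderiv_at_def)
  have "periodic (\<lambda>x. F (f x))" using torus_C_periodic[OF f] by (simp add: periodic_def)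
  moreover have "torus_C 0 (pderiv_at i (\<lambda>x. F (f x)))" for i
  proof -
    have "continuous_on UNIV (\<lambda>x. F' (f x))"
      by (rule continuous_on_compose2[OF F' torus_C_cont[OF f]]) simp
    hence "torus_C 0 (\<lambda>x. F' (f x))" using torus_C_periodic[OF f] by (simp add: periodic_def)
    moreover have "torus_C 0 (pderiv_at i f)"
      using torus_C_lower[OF torus_C_pderiv[OF f], of 0] by simp
    moreover have "pderiv_at i (\<lambda>x. F (f x)) = (\<lambda>x. F' (f x) * pderiv_at i f x)"
      using p by (simp add: fun_eq_iff)
    ultimately show ?thesis using torus_C_mult by (simp only:)
  qed
  moreover have "(\<lambda>x. F (f x)) differentiable (at x)" for x
    using d by (rule differentiableI)
  ultimately show "torus_C (Suc 0) (\<lambda>x. F (f x))" by simp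
qed

text \<open>The time derivative of \<open>F (\<rho> t x)\<close> is minus the bracket of
  \<open>\<psi> t\<close> with this composition, and brackets have average zero. Asking only C^1 of
  \<open>F\<close> admits the squared positive part.\<close>

lemma avg_transport_const:
  assumes T: "0 < T" and \<rho>: "smooth_torus_evolution T \<rho>" and \<psi>: "smooth_torus_evolution T \<psi>"
    and eq: "\<And>t x. t \<in> {0..T} \<Longrightarrow> time_deriv T \<rho> t x + bracket (\<psi> t) (\<rho> t) x = 0"
    and F: "\<And>s. (F has_real_derivative F' s) (at s)" and F': "continuous_on UNIV F'"
    and t: "t \<in> {0..T}"
  shows "avg (\<lambda>x. F (\<rho> t x)) = avg (\<lambda>x. F (\<rho> 0 x))"
proof -
  have C: "torus_C n (\<rho> t)" "torus_C n (\<psi> t)" if "t \<in> {0..T}" for n t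
    using smooth_torus_evolution_torus_C[OF T] \<rho> \<psi> that by auto
  have Fc: "continuous_on UNIV F"
    using F by (meson DERIV_isCont continuous_at_imp_continuous_on)
  have "((\<lambda>t. avg (\<lambda>x. F (\<rho> t x))) has_real_derivative 0) (at t within {0..T})" if t: "t \<in> {0..T}" for t
  proof -
    have "((\<lambda>t. avg (\<lambda>x. F (\<rho> t x))) has_real_derivative avg (\<lambda>x. F' (\<rho> t x) * time_deriv T \<rho> t x)) (at t within {0..T})"
    proof (rule avg_has_real_derivative[OF _ _ _ t])
      show "((\<lambda>s. F (\<rho> s x)) has_vector_derivative F' (\<rho> t x) * time_deriv T \<rho> t x) (at t within {0..T})"
        if "t \<in> {0..T}" for t x
        using DERIV_chain2[OF F smooth_torus_evolution_time[OF T \<rho> that, of x, folded has_real_derivative_iff_has_vector_derivative]]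
        by (simp add: has_real_derivative_iff_has_vector_derivative)
      show "continuous_on UNIV (\<lambda>x. F (\<rho> t x))" if "t \<in> {0..T}" for t
        by (rule continuous_on_compose2[OF Fc torus_C_cont[OF C(1)[OF that]]]) simp
      have "continuous_on ({0..T} \<times> UNIV) (\<lambda>p. F' ((\<lambda>(t, x). \<rho> t x) p))"
        by (rule continuous_on_compose2[OF F' smooth_torus_evolution_cont[OF \<rho>]]) simp
      from continuous_on_mult[OF this smooth_torus_evolution_time_cont[OF T \<rho>]]
      show "continuous_on ({0..T} \<times> UNIV) (\<lambda>(t, x). F' (\<rho> t x) * time_deriv T \<rho> t x)"
        by (simp add: split_def)
    qed
    moreover have "avg (\<lambda>x. F' (\<rho> t x) * time_deriv T \<rho> t x) = 0"
    proof -
      have "F' (\<rho> t x) * time_deriv T \<rho> t x = - bracket (\<psi> t) (\<lambda>x. F (\<rho> t x)) x" for x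
      proof -
        have td: "time_deriv T \<rho> t x = - bracket (\<psi> t) (\<rho> t) x"
          using eq[OF t, of x] by (simp add: eq_neg_iff_add_eq_0)
        show ?thesis
          unfolding td bracket_eq pderiv_at_compose[OF F F' C(1)[OF t]] by (simp add: algebra_simps)
      qed
      thus ?thesis
        using avg_bracket[OF C(2)[OF t] torus_C_compose[OF F F' C(1)[OF t]]] by simp
    qed
    ultimately show ?thesis by simp
  qed
  from has_field_derivative_zero_constant[OF convex_real_interval(5) this]
  obtain c where c: "\<forall>t\<in>{0..T}. avg (\<lambda>x. F (\<rho> t x)) = c" by blast
  thus ?thesis using t T by simp
qed

text \<open>Squaring removes the kink of the positive part: at 0 the difference quotient is bounded
  by \<open>\<bar>y\<bar>\<close>.\<close>

lemma has_real_derivative_pos_part_sq: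
  "((\<lambda>s::real. (max 0 s)\<^sup>2) has_real_derivative 2 * max 0 s) (at s)"
proof -
  consider "s < 0" | "s = 0" | "0 < s" by linarith
  thus ?thesis
  proof cases
    case 1
    have "((\<lambda>s::real. 0) has_real_derivative 0) (at s)" by simp
    hence "((\<lambda>s::real. (max 0 s)\<^sup>2) has_real_derivative 0) (at s)"
      by (rule has_field_derivative_transform_within_open[of _ _ _ "{..<0}"]) (use 1 in \<open>auto simp: max_def\<close>)
    thus ?thesis using 1 by (simp add: max_def)
  next
    case 2
    have "((\<lambda>y::real. ((max 0 y)\<^sup>2 - (max 0 0)\<^sup>2) / (y - 0)) \<longlongrightarrow> 0) (at 0)"
    proof (rule Lim_null_comparison)
      show "\<forall>\<^sub>F y in at (0::real). norm (((max 0 y)\<^sup>2 - (max 0 0)\<^sup>2) / (y - 0)) \<le> \<bar>y\<bar>"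
        by (rule always_eventually) (auto simp: max_def power2_eq_square)
      show "((\<lambda>y::real. \<bar>y\<bar>) \<longlongrightarrow> 0) (at 0)"
        by (rule tendsto_rabs_zero) (rule tendsto_ident_at)
    qed
    thus ?thesis using 2 by (simp add: has_field_derivative_iff)
  next
    case 3
    have "((\<lambda>s::real. s\<^sup>2) has_real_derivative 2 * s) (at s)"
      by (auto intro!: derivative_eq_intros)
    hence "((\<lambda>s::real. (max 0 s)\<^sup>2) has_real_derivative 2 * s) (at s)"
      by (rule has_field_derivative_transform_within_open[of _ _ _ "{0<..}"]) (use 3 in \<open>auto simp: max_def\<close>)
    thus ?thesis using 3 by (simp add: max_def)
  qed
qed

text \<open>
  Transport conserves the integral of \<open>(max 0 (\<plusminus> \<rho> - M))\<^sup>2\<close>, which is zero initially.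
\<close>

lemma transport_max_principle:
  assumes T: "0 < T" and \<rho>: "smooth_torus_evolution T \<rho>" and \<psi>: "smooth_torus_evolution T \<psi>"
    and eq: "\<And>t x. t \<in> {0..T} \<Longrightarrow> time_deriv T \<rho> t x + bracket (\<psi> t) (\<rho> t) x = 0"
    and t: "t \<in> {0..T}"
  shows "\<bar>\<rho> t x\<bar> \<le> Linf_norm (\<rho> 0)"
proof -
  let ?M = "Linf_norm (\<rho> 0)"
  have C: "torus_C 0 (\<rho> t)" if "t \<in> {0..T}" for t
    using smooth_torus_evolution_torus_C[OF T \<rho> that] .
  have "\<sigma> * \<rho> t x \<le> ?M" if \<sigma>: "\<bar>\<sigma>\<bar> = 1" for \<sigma> :: real
  proof -
    let ?F = "\<lambda>s. (max 0 (\<sigma> * s - ?M))\<^sup>2" and ?F' = "\<lambda>s. 2 * max 0 (\<sigma> * s - ?M) * \<sigma>"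
    have F: "(?F has_real_derivative ?F' s) (at s)" for s
      by (rule DERIV_chain2[OF has_real_derivative_pos_part_sq]) (auto intro!: derivative_eq_intros)
    have F': "continuous_on UNIV ?F'" by (intro continuous_intros)
    have "avg (\<lambda>x. ?F (\<rho> t x)) = avg (\<lambda>x. ?F (\<rho> 0 x))"
      by (rule avg_transport_const[OF T \<rho> \<psi> eq F F' t])
    also have "\<dots> = avg (\<lambda>x. 0)"
    proof (rule Bochner_Integration.integral_cong[OF refl])
      fix x assume "x \<in> space torus_measure"
      hence "\<bar>\<rho> 0 x\<bar> \<le> ?M" using norm_le_Linf[of "\<rho> 0" x] C[of 0] T by auto
      moreover have "\<sigma> * \<rho> 0 x \<le> \<bar>\<rho> 0 x\<bar>"
        using \<sigma> abs_ge_self[of "\<sigma> * \<rho> 0 x"] by (simp add: abs_mult)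
      ultimately show "?F (\<rho> 0 x) = 0" by simp
    qed
    finally have z: "avg (\<lambda>x. (max 0 (\<sigma> * \<rho> t x - ?M))\<^sup>2) = 0" by simp
    have "torus_C 0 (\<lambda>x. max 0 (\<sigma> * \<rho> t x - ?M))"
      using C[OF t] by (auto simp: periodic_def intro!: continuous_intros)
    from avg_sq_eq_0[OF this z, of x] show ?thesis by simp
  qed
  from this[of 1] this[of "- 1"] show ?thesis by (simp add: abs_le_iff)
qed

section \<open>Bounds uniform in time and the Gronwall inequality\<close>

lemma avg_sum_pderiv_sq:
  assumes "torus_C (Suc n) f"
  shows "avg (\<lambda>x. \<Sum>i\<in>UNIV. (pderiv_at i f x)\<^sup>2) = dirichlet f"
  unfolding dirichlet_def
  by (rule Bochner_Integration.integral_sum)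
    (intro integrable_torus' continuous_intros torus_C_cont[OF torus_C_pderiv[OF assms]])

text \<open>A qualitative bound that may depend on the whole solution. It is harmless because its
  uses below end up divided by \<open>N\<close> squared.\<close>

lemma dirichlet_bounded:
  assumes T: "0 < T" and f: "smooth_torus_evolution T f"
  obtains B where "0 \<le> B" "\<And>t. t \<in> {0..T} \<Longrightarrow> dirichlet (f t) \<le> B"
    "\<And>t x. t \<in> {0..T} \<Longrightarrow> x \<in> cbox 0 1 \<Longrightarrow> (\<Sum>i\<in>UNIV. (pderiv_at i (f t) x)\<^sup>2) \<le> B"
proof -
  have "continuous_on ({0..T} \<times> UNIV) (\<lambda>p. \<Sum>i\<in>UNIV. ((\<lambda>(t, x). pderiv_at i (f t) x) p)\<^sup>2)"
    by (intro continuous_intros smooth_torus_evolution_cont smooth_torus_evolution_pderiv[OF T f])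
  hence "continuous_on ({0..T} \<times> UNIV) (\<lambda>(t, x). \<Sum>i\<in>UNIV. (pderiv_at i (f t) x)\<^sup>2)"
    by (simp add: split_def)
  then obtain B where B: "0 \<le> B"
    "\<And>t x. t \<in> {0..T} \<Longrightarrow> x \<in> cbox 0 1 \<Longrightarrow> \<bar>\<Sum>i\<in>UNIV. (pderiv_at i (f t) x)\<^sup>2\<bar> \<le> B"
    using slab_bounded by blast
  have pt: "(\<Sum>i\<in>UNIV. (pderiv_at i (f t) x)\<^sup>2) \<le> B" if "t \<in> {0..T}" "x \<in> cbox 0 1" for t x
    using B(2)[OF that] by (simp add: abs_le_iff)
  have "dirichlet (f t) \<le> B" if t: "t \<in> {0..T}" for t
  proof -
    have C: "torus_C (Suc 0) (f t)" by (rule smooth_torus_evolution_torus_C[OF T f t])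
    have "dirichlet (f t) = avg (\<lambda>x. \<Sum>i\<in>UNIV. (pderiv_at i (f t) x)\<^sup>2)"
      by (rule avg_sum_pderiv_sq[OF C, symmetric])
    also have "\<dots> \<le> avg (\<lambda>x. B)"
      by (rule avg_mono) (auto intro!: continuous_intros torus_C_cont[OF torus_C_pderiv[OF C]] pt t)
    also have "\<dots> = B" using torus.prob_space by simp
    finally show ?thesis .
  qed
  thus ?thesis using that[of B] B(1) pt by blast
qed

text \<open>An integrating factor built from the primitive of \<open>b\<close>, so that
  \<open>b\<close> enters the bound only through its integral and not its maximum.\<close>

lemma Gronwall_integral:
  fixes E b :: "real \<Rightarrow> real"
  assumes T: "0 < T" and E: "\<And>t. t \<in> {0..T} \<Longrightarrow> (E has_real_derivative E' t) (at t within {0..T})"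
    and le: "\<And>t. t \<in> {0..T} \<Longrightarrow> E' t \<le> b t * E t + c"
    and b: "continuous_on {0..T} b" "\<And>t. t \<in> {0..T} \<Longrightarrow> 0 \<le> b t"
    and c: "0 \<le> c" and E0: "E 0 = 0" and t: "t \<in> {0..T}"
  shows "E t \<le> T * c * exp (integral {0..T} b)"
proof -
  define B where "B t = integral {0..t} b" for t
  have B': "(B has_real_derivative b t) (at t within {0..T})" if "t \<in> {0..T}" for t
    unfolding B_def by (rule integral_has_real_derivative[OF b(1) that])
  have int: "b integrable_on {0..t}" if "t \<in> {0..T}" for t
    by (rule integrable_continuous_real, rule continuous_on_subset[OF b(1)]) (use that in auto)
  have B0: "0 \<le> B t" if "t \<in> {0..T}" for t
    unfolding B_def by (rule integral_nonneg[OF int[OF that]]) (use that in \<open>auto intro: b(2)\<close>)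
  have BT: "B t \<le> B T"
    unfolding B_def using t T by (intro integral_subset_le int) (auto intro: b(2))
  \<comment> \<open>Subtracting \<open>c * t\<close> makes the weighted energy nonincreasing: the
    integrating factor is at most 1, so the source contributes at most \<open>c\<close> per unit
    time.\<close>
  define G where "G t = E t * exp (- B t) - c * t" for t
  have G': "(G has_real_derivative E' t * exp (- B t) - E t * (exp (- B t) * b t) - c) (at t within {0..T})"
    if "t \<in> {0..T}" for t
    unfolding G_def by (auto intro!: derivative_eq_intros E B' that)
  have neg: "E' t * exp (- B t) - E t * (exp (- B t) * b t) - c \<le> 0" if "t \<in> {0..T}" for t
  proof -
    have "(E' t - b t * E t) * exp (- B t) \<le> c * exp (- B t)"
      using le[OF that] by (intro mult_right_mono) auto
    also have "\<dots> \<le> c * 1" using c B0[OF that] by (intro mult_left_mono) auto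
    finally show ?thesis by (simp add: algebra_simps)
  qed
  have "G t \<le> G 0"
  proof (cases "t = 0")
    case False
    hence t0: "0 < t" using t by simp
    have "\<exists>s\<in>{0<..<t}. G t - G 0 = (\<lambda>h. h * (E' s * exp (- B s) - E s * (exp (- B s) * b s) - c)) (t - 0)"
    proof (rule mvt_simple[OF t0])
      fix s assume "0 \<le> s" "s \<le> t"
      hence s: "s \<in> {0..T}" using t by simp
      show "(G has_derivative (\<lambda>h. h * (E' s * exp (- B s) - E s * (exp (- B s) * b s) - c))) (at s within {0..t})"
        by (rule has_derivative_subset[of _ _ _ "{0..T}"])
          (use G'[OF s] t in \<open>auto simp: has_field_derivative_def mult_commute_abs\<close>)
    qed
    then obtain s where s: "s \<in> {0<..<t}"
      "G t - G 0 = t * (E' s * exp (- B s) - E s * (exp (- B s) * b s) - c)" by auto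
    have "t * (E' s * exp (- B s) - E s * (exp (- B s) * b s) - c) \<le> 0"
      using t0 t s(1) by (intro mult_nonneg_nonpos neg) auto
    thus ?thesis using s(2) by linarith
  qed simp
  hence "E t * exp (- B t) \<le> c * t" by (simp add: G_def E0)
  hence "E t * exp (- B t) * exp (B t) \<le> c * t * exp (B t)"
    by (rule mult_right_mono) simp
  hence "E t \<le> c * t * exp (B t)" by (simp add: mult.assoc flip: exp_add)
  also have "\<dots> \<le> c * T * exp (B T)"
    using c t BT by (intro mult_mono) auto
  finally show ?thesis by (simp add: B_def mult.commute)
qed

section \<open>The energy estimate\<close>

text \<open>The setting of the theorem with the smallness threshold fixed to 1.\<close>

locale monge_ampere_vs_euler =
  fixes T \<epsilon> :: real and \<rho>bar \<phi>bar \<rho> \<psi> :: "real \<Rightarrow> real^2 \<Rightarrow> real"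
  assumes T: "0 < T" and \<epsilon>: "0 < \<epsilon>"
    and euler: "smooth_euler_solution T \<rho>bar \<phi>bar"
    and MA: "smooth_monge_ampere_solution \<epsilon> T \<rho> \<psi>"
    and init: "\<rho>bar 0 = \<rho> 0"
    and small: "\<And>t. t \<in> {0..T} \<Longrightarrow> \<epsilon> * Linf_norm (hessian (\<psi> t)) \<le> 1"
begin

definition "w t x = \<psi> t x - \<phi>bar t x"
definition "\<theta> t x = \<rho> t x - \<rho>bar t x"
definition "a t = Linf_norm (\<lambda>x. jacobian (perp_grad (\<phi>bar t)) (at x))"
definition "M = Linf_norm (\<rho> 0)"
definition "S = avg (\<lambda>x. (\<rho> 0 x)\<^sup>2)"

lemma evolutions:
  "smooth_torus_evolution T \<rho>" "smooth_torus_evolution T \<psi>"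
  "smooth_torus_evolution T \<rho>bar" "smooth_torus_evolution T \<phi>bar"
  using euler MA by (auto simp: smooth_euler_solution_def smooth_monge_ampere_solution_def)

lemma torus_C:
  assumes "t \<in> {0..T}"
  shows "torus_C n (\<rho> t)" "torus_C n (\<psi> t)" "torus_C n (\<rho>bar t)" "torus_C n (\<phi>bar t)"
    "torus_C n (w t)" "torus_C n (\<theta> t)"
  unfolding w_def[abs_def] \<theta>_def[abs_def]
  using evolutions[THEN smooth_torus_evolution_torus_C[OF T _ assms]]
  by (auto intro!: torus_C_diff_fun simp del: torus_C.simps)

lemma transport:
  assumes "t \<in> {0..T}"
  shows "time_deriv T \<rho> t x = - bracket (\<psi> t) (\<rho> t) x"
    and "time_deriv T \<rho>bar t x = - bracket (\<phi>bar t) (\<rho>bar t) x"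
  using euler MA assms
  by (simp_all add: smooth_euler_solution_def smooth_monge_ampere_solution_def eq_neg_iff_add_eq_0)

lemma pderiv_at_w: "t \<in> {0..T} \<Longrightarrow> pderiv_at i (w t) x = pderiv_at i (\<psi> t) x - pderiv_at i (\<phi>bar t) x"
  unfolding w_def[abs_def]
  by (intro pderiv_at_diff torus_C_diff[OF torus_C(2)] torus_C_diff[OF torus_C(4)])

abbreviation "d t \<equiv> bracket (pderiv_at 1 (\<psi> t)) (pderiv_at 2 (\<psi> t))"

lemma rho_eq: "t \<in> {0..T} \<Longrightarrow> \<rho> t x = laplacian (\<psi> t) x + \<epsilon> * d t x"
proof -
  assume "t \<in> {0..T}"
  hence "det (mat 1 + \<epsilon> *\<^sub>R hessian (\<psi> t) x) = 1 + \<epsilon> * \<rho> t x"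
    using MA unfolding smooth_monge_ampere_solution_def by blast
  thus ?thesis using \<epsilon> by (simp add: det_hessian)
qed

lemma laplacian_w: "t \<in> {0..T} \<Longrightarrow> laplacian (w t) x = \<theta> t x - \<epsilon> * d t x"
proof -
  assume t: "t \<in> {0..T}"
  have "pderiv_at i (w t) = (\<lambda>x. pderiv_at i (\<psi> t) x - pderiv_at i (\<phi>bar t) x)" for i
    using pderiv_at_w[OF t] by blast
  hence "pderiv_at i (pderiv_at i (w t)) x = pderiv_at i (pderiv_at i (\<psi> t)) x - pderiv_at i (pderiv_at i (\<phi>bar t)) x" for i
    by (simp only:) (intro pderiv_at_diff torus_C_diff[OF torus_C_pderiv[OF torus_C(2)[OF t]]]
        torus_C_diff[OF torus_C_pderiv[OF torus_C(4)[OF t]]])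
  hence "laplacian (w t) x = laplacian (\<psi> t) x - laplacian (\<phi>bar t) x"
    by (simp add: laplacian_def sum_subtractf)
  moreover have "laplacian (\<phi>bar t) x = \<rho>bar t x"
    using euler t unfolding smooth_euler_solution_def by blast
  ultimately show ?thesis by (simp add: rho_eq[OF t] \<theta>_def)
qed

lemma coef_theta_0: "t \<in> {0..T} \<Longrightarrow> coef (\<theta> t) 0 = 0"
proof -
  assume t: "t \<in> {0..T}"
  have "avg (\<theta> t) = avg (\<rho> t) - avg (\<rho>bar t)"
    unfolding \<theta>_def[abs_def]
    by (intro Bochner_Integration.integral_diff integrable_torus_C[OF torus_C(1)[OF t]] integrable_torus_C[OF torus_C(3)[OF t]])
  also have "\<dots> = 0"
    using euler MA t unfolding smooth_euler_solution_def smooth_monge_ampere_solution_def by simp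
  finally show ?thesis by (simp add: coef_def)
qed

lemma rho_le_M: "t \<in> {0..T} \<Longrightarrow> \<bar>\<rho> t x\<bar> \<le> M"
  unfolding M_def
  by (rule transport_max_principle[OF T evolutions(1,2)]) (simp_all add: transport)

lemma M_nonneg: "0 \<le> M"
  using order_trans[OF abs_ge_zero rho_le_M[of 0]] T by simp

lemma avg_rho_sq: "t \<in> {0..T} \<Longrightarrow> avg (\<lambda>x. (\<rho> t x)\<^sup>2) = S"
  unfolding S_def
  by (rule avg_transport_const[OF T evolutions(1,2), where F = "\<lambda>s. s\<^sup>2" and F' = "\<lambda>s. 2 * s"])
    (auto simp: transport intro!: derivative_eq_intros continuous_intros)

text \<open>21 is the Wente constant, and each of the two Dirichlet energies is at most
  \<open>4 * S\<close>: 336 = 21 * 4 * 4. Conservation of the L^2 norm of the vorticity makes the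
  bound free of \<open>t\<close> and \<epsilon>.\<close>

lemma hneg_d_le: "t \<in> {0..T} \<Longrightarrow> hneg N (d t) \<le> 336 * S\<^sup>2"
proof -
  assume t: "t \<in> {0..T}"
  let ?A = "dirichlet (pderiv_at 1 (\<psi> t))" and ?B = "dirichlet (pderiv_at 2 (\<psi> t))"
  have C1: "torus_C (Suc 0) (pderiv_at i (\<psi> t))" for i
    by (rule torus_C_pderiv[OF torus_C(2)[OF t]])
  have ch: "continuous_on UNIV (hessian (\<psi> t))"
    unfolding hessian_def[abs_def]
    by (intro continuous_on_vec_lambda torus_C_cont[OF torus_C_pderiv[OF torus_C_pderiv[OF torus_C(2)[OF t]]]])
  have "?A + ?B \<le> 4 * avg (\<lambda>x. (\<rho> t x)\<^sup>2)"
  proof (rule avg_hessian_le[OF torus_C(2)[OF t] rho_eq[OF t] _ \<epsilon>])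
    fix x :: "real^2" assume x: "x \<in> cbox 0 1"
    have "\<epsilon> * norm (hessian (\<psi> t) x) \<le> \<epsilon> * Linf_norm (hessian (\<psi> t))"
      using norm_le_Linf[OF ch x] \<epsilon> by (intro mult_left_mono) auto
    thus "\<epsilon> * norm (hessian (\<psi> t) x) \<le> 1" using small[OF t] by linarith
  qed
  hence AB: "?A + ?B \<le> 4 * S" by (simp add: avg_rho_sq[OF t])
  have "hneg N (d t) \<le> 21 * (?A * ?B)" by (rule hneg_bracket_le[OF C1 C1])
  also have "?A * ?B \<le> (4 * S) * (4 * S)"
    using AB dirichlet_nonneg[of "pderiv_at 1 (\<psi> t)"] dirichlet_nonneg[of "pderiv_at 2 (\<psi> t)"]
    by (intro mult_mono) linarith+
  finally show ?thesis by (simp add: power2_eq_square)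
qed

lemma dirichlet_w_le:
  assumes t: "t \<in> {0..T}"
  shows "(real N)\<^sup>2 * dirichlet (w t)
    \<le> (real N)\<^sup>2 * (2 * hneg N (\<theta> t) + 2 * \<epsilon>\<^sup>2 * (336 * S\<^sup>2)) + (\<Sum>i\<in>UNIV. dirichlet (pderiv_at i (w t)))"
proof -
  have "continuous_on UNIV (d t)"
    by (intro torus_C_cont[OF torus_C_bracket] torus_C_pderiv torus_C[OF t])
  from dirichlet_le_hneg[OF torus_C(5)[OF t] torus_C_cont[OF torus_C(6)[OF t]] this laplacian_w[OF t], of N]
  show ?thesis
    by (rule order_trans) (intro add_mono mult_left_mono hneg_d_le[OF t] order_refl; simp)
qed

lemma jacobian_le_a:
  assumes t: "t \<in> {0..T}" and x: "x \<in> cbox 0 1"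
  shows "norm (jacobian (perp_grad (\<phi>bar t)) (at x)) \<le> a t"
  unfolding a_def
proof (rule norm_le_Linf[OF _ x])
  have c: "continuous_on UNIV (\<lambda>x. if i = 1 then - pderiv_at j (pderiv_at 2 (\<phi>bar t)) x else pderiv_at j (pderiv_at 1 (\<phi>bar t)) x)" for i j :: 2
    using torus_C_cont[OF torus_C_pderiv[OF torus_C_pderiv[OF torus_C(4)[OF t]]]]
    by (cases "i = 1") (auto intro: continuous_intros)
  show "continuous_on UNIV (\<lambda>x. jacobian (perp_grad (\<phi>bar t)) (at x))"
    unfolding jacobian_perp_grad[OF torus_C(4)[OF t]]
    by (intro continuous_on_vec_lambda c)
qed

lemma jacobian_continuous:
  "continuous_on ({0..T} \<times> UNIV) (\<lambda>(t, x). jacobian (perp_grad (\<phi>bar t)) (at x))"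
proof -
  have p: "continuous_on ({0..T} \<times> UNIV) (\<lambda>(t, x). pderiv_at j (pderiv_at i (\<phi>bar t)) x)" for i j
    by (intro smooth_torus_evolution_cont smooth_torus_evolution_pderiv T evolutions)
  have c: "continuous_on ({0..T} \<times> UNIV) (\<lambda>(t, x). if i = 1 then - pderiv_at j (pderiv_at 2 (\<phi>bar t)) x else pderiv_at j (pderiv_at 1 (\<phi>bar t)) x)" for i j :: 2
    using p[of j 1] continuous_on_minus[OF p[of j 2]] by (cases "i = 1") (auto simp: split_def)
  have "continuous_on ({0..T} \<times> UNIV) (\<lambda>p. \<chi> (i::2) (j::2). (\<lambda>(t, x). if i = 1 then - pderiv_at j (pderiv_at 2 (\<phi>bar t)) x else pderiv_at j (pderiv_at 1 (\<phi>bar t)) x) p)"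
    by (intro continuous_on_vec_lambda c)
  thus ?thesis
    by (rule continuous_on_eq) (auto simp: jacobian_perp_grad[OF torus_C(4)])
qed

lemma a_continuous: "continuous_on {0..T} a"
  unfolding a_def[abs_def] by (rule Linf_norm_continuous[OF jacobian_continuous])

lemma a_nonneg: "t \<in> {0..T} \<Longrightarrow> 0 \<le> a t"
  using order_trans[OF norm_ge_zero jacobian_le_a[of t 0]] by (simp add: mem_box_cart)

lemma integral_a: "integral {0..T} a = L1_Linf_norm T (\<lambda>t x. jacobian (perp_grad (\<phi>bar t)) (at x))"
  unfolding L1_Linf_norm_eq_integral[OF jacobian_continuous] a_def[abs_def] ..

section \<open>Evolution of the truncated H^-1 energy\<close>

definition "energy_deriv N t
  = 2 * (avg (\<lambda>x. pot N (\<theta> t) x * bracket (\<psi> t) (\<rho> t) x) - avg (\<lambda>x. pot N (\<theta> t) x * bracket (\<phi>bar t) (\<rho>bar t) x))"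

text \<open>The energy is a finite sum of squares of coefficients, so differentiation under each
  integral suffices. The result is -2 times the pairing of the time derivative of
  \<open>\<theta>\<close> with \<open>pot\<close>, into which the transport equations are
  inserted.\<close>

lemma hneg_theta_derivative:
  assumes t: "t \<in> {0..T}"
  shows "((\<lambda>t. hneg N (\<theta> t)) has_real_derivative energy_deriv N t) (at t within {0..T})"
proof -
  define \<theta>' where "\<theta>' t x = time_deriv T \<rho> t x - time_deriv T \<rho>bar t x" for t x
  have c\<theta>': "continuous_on ({0..T} \<times> UNIV) (\<lambda>(t, x). \<theta>' t x)"
    using continuous_on_diff[OF smooth_torus_evolution_time_cont[OF T evolutions(1)]
        smooth_torus_evolution_time_cont[OF T evolutions(3)]]
    by (simp add: \<theta>'_def split_def)
  have \<theta>'_eq: "\<theta>' t x = bracket (\<phi>bar t) (\<rho>bar t) x - bracket (\<psi> t) (\<rho> t) x" for x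
    by (simp add: \<theta>'_def transport[OF t])
  have cb: "continuous_on UNIV (bracket (\<phi>bar t) (\<rho>bar t))" "continuous_on UNIV (bracket (\<psi> t) (\<rho> t))"
    by (intro torus_C_cont[OF torus_C_bracket] torus_C[OF t])+
  have coef': "((\<lambda>t. coef (\<theta> t) k) has_real_derivative coef (\<theta>' t) k) (at t within {0..T})" for k
    unfolding coef_def
  proof (rule avg_has_real_derivative[OF _ _ _ t])
    fix s x assume s: "s \<in> {0..T}"
    have "((\<lambda>s. \<theta> s x * cas k x) has_real_derivative \<theta>' s x * cas k x) (at s within {0..T})"
      unfolding \<theta>_def \<theta>'_def
      by (intro DERIV_cmult_right DERIV_diff)
        (simp_all add: has_real_derivative_iff_has_vector_derivative smooth_torus_evolution_time[OF T _ s] evolutions)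
    thus "((\<lambda>s. \<theta> s x * cas k x) has_vector_derivative \<theta>' s x * cas k x) (at s within {0..T})"
      by (simp add: has_real_derivative_iff_has_vector_derivative)
  next
    fix s assume "s \<in> {0..T}"
    thus "continuous_on UNIV (\<lambda>x. \<theta> s x * cas k x)"
      by (intro continuous_intros torus_C_cont[OF torus_C(6)])
  next
    have "continuous_on ({0..T} \<times> UNIV) (\<lambda>p. (\<lambda>(t, x). \<theta>' t x) p * cas k (snd p))"
      by (intro continuous_on_mult c\<theta>' continuous_on_compose2[OF continuous_on_cas[of UNIV k]] continuous_intros) auto
    thus "continuous_on ({0..T} \<times> UNIV) (\<lambda>(t, x). \<theta>' t x * cas k x)"
      by (simp add: split_def)
  qed
  have "((\<lambda>t. hneg N (\<theta> t)) has_real_derivative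
      (\<Sum>k\<in>boxZ N. (2 * coef (\<theta> t) k * coef (\<theta>' t) k) / (4 * pi\<^sup>2 * nsq k))) (at t within {0..T})"
    unfolding hneg_def
    by (intro DERIV_sum DERIV_cdivide) (auto intro!: derivative_eq_intros coef')
  moreover have "(\<Sum>k\<in>boxZ N. (2 * coef (\<theta> t) k * coef (\<theta>' t) k) / (4 * pi\<^sup>2 * nsq k)) = energy_deriv N t"
  proof -
    have c': "continuous_on UNIV (\<theta>' t)"
      unfolding \<theta>'_eq by (intro continuous_intros cb)
    have "(\<Sum>k\<in>boxZ N. (2 * coef (\<theta> t) k * coef (\<theta>' t) k) / (4 * pi\<^sup>2 * nsq k)) = - 2 * avg (\<lambda>x. \<theta>' t x * pot N (\<theta> t) x)"
      unfolding avg_mult_pot[OF c'] by (simp add: sum_distrib_left sum_negf mult_ac)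
    also have "avg (\<lambda>x. \<theta>' t x * pot N (\<theta> t) x) = avg (\<lambda>x. pot N (\<theta> t) x * bracket (\<phi>bar t) (\<rho>bar t) x - pot N (\<theta> t) x * bracket (\<psi> t) (\<rho> t) x)"
      by (simp add: \<theta>'_eq algebra_simps)
    also have "\<dots> = avg (\<lambda>x. pot N (\<theta> t) x * bracket (\<phi>bar t) (\<rho>bar t) x) - avg (\<lambda>x. pot N (\<theta> t) x * bracket (\<psi> t) (\<rho> t) x)"
      by (intro Bochner_Integration.integral_diff integrable_torus' continuous_intros cb torus_C_cont[OF torus_C_pot[of 0]])
    finally show ?thesis by (simp add: energy_deriv_def)
  qed
  ultimately show ?thesis by simp
qed

text \<open>
  The derivative of the energy is \<open>-2 \<integral> \<rho> {\<psi> - \<phi>, W} - 2 \<integral> \<theta> {\<phi>, W}\<close> with \<open>\<phi>\<close> the Euler stream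
  function and \<open>W = pot N \<theta>\<close>. In the second integral \<open>\<theta>\<close> is \<open>\<Delta> W\<close> up to high modes, which leaves
  the stretching term and an error of order \<open>1 / N\<^sup>2\<close>.
\<close>

lemma energy_deriv_le:
  assumes t: "t \<in> {0..T}" and N: "0 < N"
    and B: "\<And>x. x \<in> cbox 0 1 \<Longrightarrow> (\<Sum>i\<in>UNIV. (pderiv_at i (\<phi>bar t) x)\<^sup>2) \<le> B" "0 \<le> B"
    and D1: "dirichlet (\<theta> t) \<le> D1" and D2: "(\<Sum>i\<in>UNIV. dirichlet (pderiv_at i (w t))) \<le> D2"
  shows "energy_deriv N t \<le> (2 * a t + 3 * M + 1) * hneg N (\<theta> t)
    + (2 * M * \<epsilon>\<^sup>2 * (336 * S\<^sup>2) + (M * D2 + B * D1) / (real N)\<^sup>2)"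
proof -
  define W where "W = pot N (\<theta> t)"
  let ?E = "hneg N (\<theta> t)" and ?r = "\<lambda>x. \<theta> t x - proj N (\<theta> t) x"
  have W: "torus_C n W" for n unfolding W_def by (rule torus_C_pot)
  have DW: "dirichlet W = ?E" unfolding W_def by (rule dirichlet_pot)
  have lapW: "laplacian W x = proj N (\<theta> t) x" for x
    unfolding W_def by (rule laplacian_pot[OF coef_theta_0[OF t]])
  note C = torus_C[OF t]
  note cont = torus_C_cont[OF C(1)] torus_C_cont[OF C(3)] torus_C_cont[OF C(6)]
  have cp: "continuous_on UNIV (pderiv_at i W)" "continuous_on UNIV (pderiv_at i (w t))" for i
    using torus_C_cont[OF torus_C_pderiv[OF W]] torus_C_cont[OF torus_C_pderiv[OF C(5)]] by auto
  have cb: "continuous_on UNIV (bracket (\<phi>bar t) W)" "continuous_on UNIV (bracket (w t) W)"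
    by (intro torus_C_cont[OF torus_C_bracket] C W)+
  have bw: "bracket (w t) W x = bracket (\<psi> t) W x - bracket (\<phi>bar t) W x" for x
    by (simp add: bracket_eq pderiv_at_w[OF t] algebra_simps)
  have int: "integrable torus_measure (\<lambda>x. \<rho> t x * bracket (w t) W x)"
    "integrable torus_measure (\<lambda>x. ?r x * bracket (\<phi>bar t) W x)"
    "integrable torus_measure (\<lambda>x. laplacian W x * bracket (\<phi>bar t) W x)"
    "integrable torus_measure (\<lambda>x. \<rho> t x * bracket (\<psi> t) W x)"
    "integrable torus_measure (\<lambda>x. \<rho>bar t x * bracket (\<phi>bar t) W x)"
    unfolding lapW
    by (intro integrable_torus' continuous_intros cont cb torus_C_cont[OF torus_C_bracket[OF C(2) W]])+
  have "energy_deriv N t = 2 * (avg (\<lambda>x. \<rho>bar t x * bracket (\<phi>bar t) W x) - avg (\<lambda>x. \<rho> t x * bracket (\<psi> t) W x))"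
    unfolding energy_deriv_def W_def[symmetric]
    using avg_mult_bracket[OF C(2) W C(1)] avg_mult_bracket[OF C(4) W C(3)] by simp
  also have "avg (\<lambda>x. \<rho>bar t x * bracket (\<phi>bar t) W x) - avg (\<lambda>x. \<rho> t x * bracket (\<psi> t) W x)
      = avg (\<lambda>x. \<rho>bar t x * bracket (\<phi>bar t) W x - \<rho> t x * bracket (\<psi> t) W x)"
    by (rule Bochner_Integration.integral_diff[OF int(5,4), symmetric])
  \<comment> \<open>The nonlinear difference is split so that the velocity error meets
    \<open>\<rho>\<close>, which is bounded by \<open>M\<close>, and the Euler flow meets
    \<open>\<theta>\<close>; then \<open>\<theta>\<close> is written as the Laplacian of
    \<open>W\<close> plus the remainder \<open>?r\<close>.\<close>
  also have "\<dots> = avg (\<lambda>x. - (\<rho> t x * bracket (w t) W x) - laplacian W x * bracket (\<phi>bar t) W x - ?r x * bracket (\<phi>bar t) W x)"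
    by (rule arg_cong[where f = avg]) (simp add: fun_eq_iff bw lapW \<theta>_def algebra_simps)
  also have "\<dots> = - avg (\<lambda>x. \<rho> t x * bracket (w t) W x) - avg (\<lambda>x. laplacian W x * bracket (\<phi>bar t) W x)
      - avg (\<lambda>x. ?r x * bracket (\<phi>bar t) W x)"
    using int by simp
  finally have split: "energy_deriv N t = avg (\<lambda>x. \<rho> t x * bracket (w t) W x) * (- 2)
      + (- avg (\<lambda>x. laplacian W x * bracket (\<phi>bar t) W x)) * 2 + avg (\<lambda>x. ?r x * bracket (\<phi>bar t) W x) * (- 2)"
    by simp

  have "avg (\<lambda>x. \<rho> t x * bracket (w t) W x) * (- 2) = avg (\<lambda>x. - 2 * (\<rho> t x * bracket (w t) W x))"
    unfolding integral_mult_right_zero by (rule mult.commute)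
  also have "\<dots> \<le> avg (\<lambda>x. M * ((\<Sum>i\<in>UNIV. (pderiv_at i (w t) x)\<^sup>2) + (\<Sum>i\<in>UNIV. (pderiv_at i W x)\<^sup>2)))"
  proof (rule avg_mono)
    fix x :: "real^2" assume "x \<in> cbox 0 1"
    define p where "p i = pderiv_at i (w t) x" for i
    define q where "q i = pderiv_at i W x" for i
    have "\<bar>2 * (b * c)\<bar> \<le> b\<^sup>2 + c\<^sup>2" for b c :: real
      using sum_squares_bound[of b c] sum_squares_bound[of "- b" c] by (simp add: abs_le_iff mult.assoc)
    from add_mono[OF this[of "p 1" "q 2"] this[of "p 2" "q 1"]]
    have "\<bar>2 * (p 1 * q 2) - 2 * (p 2 * q 1)\<bar> \<le> (p 1)\<^sup>2 + (q 2)\<^sup>2 + ((p 2)\<^sup>2 + (q 1)\<^sup>2)"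
      by (rule order_trans[OF abs_triangle_ineq4])
    moreover have "2 * bracket (w t) W x = 2 * (p 1 * q 2) - 2 * (p 2 * q 1)"
      unfolding bracket_eq p_def q_def by (rule right_diff_distrib)
    ultimately have "\<bar>2 * bracket (w t) W x\<bar> \<le> (\<Sum>i\<in>UNIV. (p i)\<^sup>2) + (\<Sum>i\<in>UNIV. (q i)\<^sup>2)"
      by (simp only: sum_2 add_ac)
    hence "\<bar>\<rho> t x\<bar> * \<bar>2 * bracket (w t) W x\<bar> \<le> M * ((\<Sum>i\<in>UNIV. (p i)\<^sup>2) + (\<Sum>i\<in>UNIV. (q i)\<^sup>2))"
      by (intro mult_mono rho_le_M[OF t] M_nonneg) auto
    moreover have "- 2 * (\<rho> t x * bracket (w t) W x) \<le> \<bar>\<rho> t x\<bar> * \<bar>2 * bracket (w t) W x\<bar>"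
      using abs_ge_minus_self[of "\<rho> t x * (2 * bracket (w t) W x)"] unfolding abs_mult[of "\<rho> t x"] by simp
    ultimately show "- 2 * (\<rho> t x * bracket (w t) W x)
        \<le> M * ((\<Sum>i\<in>UNIV. (pderiv_at i (w t) x)\<^sup>2) + (\<Sum>i\<in>UNIV. (pderiv_at i W x)\<^sup>2))"
      unfolding p_def q_def by (rule order_trans[rotated])
  qed (intro continuous_intros cont cb cp)+
  also have "\<dots> = M * (avg (\<lambda>x. \<Sum>i\<in>UNIV. (pderiv_at i (w t) x)\<^sup>2) + avg (\<lambda>x. \<Sum>i\<in>UNIV. (pderiv_at i W x)\<^sup>2))"
  proof -
    have "integrable torus_measure (\<lambda>x. \<Sum>i\<in>UNIV. (pderiv_at i (w t) x)\<^sup>2)"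
      "integrable torus_measure (\<lambda>x. \<Sum>i\<in>UNIV. (pderiv_at i W x)\<^sup>2)"
      by (intro integrable_torus' continuous_intros cp)+
    thus ?thesis by simp
  qed
  also have "\<dots> = M * (dirichlet (w t) + ?E)"
    by (simp only: avg_sum_pderiv_sq[OF C(5)] avg_sum_pderiv_sq[OF W] DW)
  finally have 1: "avg (\<lambda>x. \<rho> t x * bracket (w t) W x) * (- 2) \<le> M * (dirichlet (w t) + ?E)" .

  have 2: "- avg (\<lambda>x. laplacian W x * bracket (\<phi>bar t) W x) \<le> a t * ?E"
    using stretching_le[OF C(4) W jacobian_le_a[OF t]] unfolding DW .

  have "avg (\<lambda>x. ?r x * bracket (\<phi>bar t) W x) * (- 2) = avg (\<lambda>x. - 2 * (?r x * bracket (\<phi>bar t) W x))"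
    unfolding integral_mult_right_zero by (rule mult.commute)
  also have "\<dots> \<le> avg (\<lambda>x. B * (?r x)\<^sup>2 + (\<Sum>i\<in>UNIV. (pderiv_at i W x)\<^sup>2))"
  proof (rule avg_mono)
    fix x :: "real^2" assume x: "x \<in> cbox 0 1"
    define p where "p i = pderiv_at i (\<phi>bar t) x" for i
    define q where "q i = pderiv_at i W x" for i
    have "- 2 * (?r x * (p 1 * q 2 - p 2 * q 1)) \<le> (?r x * p 1)\<^sup>2 + (q 2)\<^sup>2 + (?r x * p 2)\<^sup>2 + (q 1)\<^sup>2"
    proof -
      \<comment> \<open>Two completed squares give the Young inequality with the signs matching
        those of the bracket; \<open>B\<close> is then spent on the small factor \<open>?r\<close>,
        leaving the gradient of \<open>W\<close> with coefficient 1.\<close>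
      have "0 \<le> (?r x * p 1 + q 2)\<^sup>2 + (?r x * p 2 - q 1)\<^sup>2" by simp
      thus ?thesis unfolding power2_sum power2_diff by (simp add: algebra_simps)
    qed
    also have "\<dots> = (?r x)\<^sup>2 * (\<Sum>i\<in>UNIV. (p i)\<^sup>2) + (\<Sum>i\<in>UNIV. (q i)\<^sup>2)"
      by (simp add: sum_2 power_mult_distrib distrib_left)
    also have "\<dots> \<le> (?r x)\<^sup>2 * B + (\<Sum>i\<in>UNIV. (q i)\<^sup>2)"
      using B(1)[OF x] by (intro add_right_mono mult_left_mono) (simp_all add: p_def)
    finally show "- 2 * (?r x * bracket (\<phi>bar t) W x) \<le> B * (?r x)\<^sup>2 + (\<Sum>i\<in>UNIV. (pderiv_at i W x)\<^sup>2)"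
      by (simp add: bracket_eq p_def q_def mult.commute)
  qed (intro continuous_intros cont cb cp)+
  also have "\<dots> = B * avg (\<lambda>x. (?r x)\<^sup>2) + avg (\<lambda>x. \<Sum>i\<in>UNIV. (pderiv_at i W x)\<^sup>2)"
  proof -
    have "integrable torus_measure (\<lambda>x. (?r x)\<^sup>2)"
      "integrable torus_measure (\<lambda>x. \<Sum>i\<in>UNIV. (pderiv_at i W x)\<^sup>2)"
      by (intro integrable_torus' continuous_intros cp cont)+
    thus ?thesis by simp
  qed
  also have "\<dots> = B * avg (\<lambda>x. (?r x)\<^sup>2) + ?E"
    by (simp only: avg_sum_pderiv_sq[OF W] DW)
  finally have r: "avg (\<lambda>x. ?r x * bracket (\<phi>bar t) W x) * (- 2) \<le> B * avg (\<lambda>x. (?r x)\<^sup>2) + ?E" .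
  have "B * avg (\<lambda>x. (?r x)\<^sup>2) \<le> B * (D1 / (real N)\<^sup>2)"
  proof (rule mult_left_mono[OF _ B(2)])
    have "(real N)\<^sup>2 * avg (\<lambda>x. (?r x)\<^sup>2) \<le> D1"
      using avg_sq_diff_proj_le[OF C(6), of N] D1 by linarith
    thus "avg (\<lambda>x. (?r x)\<^sup>2) \<le> D1 / (real N)\<^sup>2"
      using N by (simp add: pos_le_divide_eq mult.commute)
  qed
  with r have 3: "avg (\<lambda>x. ?r x * bracket (\<phi>bar t) W x) * (- 2) \<le> B * (D1 / (real N)\<^sup>2) + ?E"
    by (rule order_trans[OF _ add_right_mono])

  have "(real N)\<^sup>2 * dirichlet (w t) \<le> (real N)\<^sup>2 * (2 * ?E + 2 * \<epsilon>\<^sup>2 * (336 * S\<^sup>2)) + D2"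
    using dirichlet_w_le[OF t, of N] D2 by linarith
  hence "(real N)\<^sup>2 * dirichlet (w t) \<le> (real N)\<^sup>2 * (2 * ?E + 2 * \<epsilon>\<^sup>2 * (336 * S\<^sup>2) + D2 / (real N)\<^sup>2)"
    using N by (simp add: distrib_left)
  hence "dirichlet (w t) \<le> 2 * ?E + 2 * \<epsilon>\<^sup>2 * (336 * S\<^sup>2) + D2 / (real N)\<^sup>2"
    using N by simp
  hence "M * (dirichlet (w t) + ?E) \<le> M * ((2 * ?E + 2 * \<epsilon>\<^sup>2 * (336 * S\<^sup>2) + D2 / (real N)\<^sup>2) + ?E)"
    by (intro mult_left_mono M_nonneg add_right_mono)
  with 1 2 3 have "energy_deriv N t \<le> M * ((2 * ?E + 2 * \<epsilon>\<^sup>2 * (336 * S\<^sup>2) + D2 / (real N)\<^sup>2) + ?E)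
      + a t * ?E * 2 + (B * (D1 / (real N)\<^sup>2) + ?E)"
    unfolding split by linarith
  \<comment> \<open>Collecting multiples of the energy: \<open>2 * a t\<close> from stretching,
    \<open>3 * M\<close> as twice \<open>M\<close> from the gradient of \<open>w\<close> plus once
    from that of \<open>W\<close>, and 1 from the remainder.\<close>
  also have "\<dots> = (2 * a t + 3 * M + 1) * ?E
      + (2 * M * \<epsilon>\<^sup>2 * (336 * S\<^sup>2) + (M * D2 + B * D1) / (real N)\<^sup>2)"
    by (simp add: algebra_simps add_divide_distrib)
  finally show ?thesis .
qed

lemma evolution_diff:
  assumes "smooth_torus_evolution T f" "smooth_torus_evolution T g"
  obtains B where "0 \<le> B" "\<And>t. t \<in> {0..T} \<Longrightarrow> dirichlet (\<lambda>x. f t x - g t x) \<le> B"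
proof -
  obtain B1 where B1: "0 \<le> B1" "\<And>t. t \<in> {0..T} \<Longrightarrow> dirichlet (f t) \<le> B1"
    by (rule dirichlet_bounded[OF T assms(1)]) blast
  obtain B2 where B2: "0 \<le> B2" "\<And>t. t \<in> {0..T} \<Longrightarrow> dirichlet (g t) \<le> B2"
    by (rule dirichlet_bounded[OF T assms(2)]) blast
  show ?thesis
  proof (rule that[of "2 * B1 + 2 * B2"])
    fix t assume t: "t \<in> {0..T}"
    have C: "torus_C (Suc 0) (f t)" "torus_C (Suc 0) (g t)"
      using smooth_torus_evolution_torus_C[OF T _ t] assms by blast+
    have c: "continuous_on UNIV (pderiv_at i (f t))" "continuous_on UNIV (pderiv_at i (g t))" for i
      using torus_C_cont[OF torus_C_pderiv[OF C(1)]] torus_C_cont[OF torus_C_pderiv[OF C(2)]] by auto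
    have "avg (\<lambda>x. (pderiv_at i (\<lambda>x. f t x - g t x) x)\<^sup>2)
        \<le> 2 * avg (\<lambda>x. (pderiv_at i (f t) x)\<^sup>2) + 2 * avg (\<lambda>x. (pderiv_at i (g t) x)\<^sup>2)" for i
    proof -
      have "pderiv_at i (\<lambda>x. f t x - g t x) = (\<lambda>x. pderiv_at i (f t) x - pderiv_at i (g t) x)"
        using torus_C_diff[OF C(1)] torus_C_diff[OF C(2)] by (simp add: fun_eq_iff pderiv_at_diff)
      hence "avg (\<lambda>x. (pderiv_at i (\<lambda>x. f t x - g t x) x)\<^sup>2)
          \<le> avg (\<lambda>x. 2 * (pderiv_at i (f t) x)\<^sup>2 + 2 * (pderiv_at i (g t) x)\<^sup>2)"
      proof (simp only:, intro avg_mono continuous_intros c)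
        fix x
        show "(pderiv_at i (f t) x - pderiv_at i (g t) x)\<^sup>2 \<le> 2 * (pderiv_at i (f t) x)\<^sup>2 + 2 * (pderiv_at i (g t) x)\<^sup>2"
          using zero_le_power2[of "pderiv_at i (f t) x + pderiv_at i (g t) x"]
          by (simp add: power2_eq_square algebra_simps)
      qed
      also have "\<dots> = 2 * avg (\<lambda>x. (pderiv_at i (f t) x)\<^sup>2) + 2 * avg (\<lambda>x. (pderiv_at i (g t) x)\<^sup>2)"
      proof -
        have "integrable torus_measure (\<lambda>x. (pderiv_at i (f t) x)\<^sup>2)" "integrable torus_measure (\<lambda>x. (pderiv_at i (g t) x)\<^sup>2)"
          by (intro integrable_torus' continuous_intros c)+
        thus ?thesis by simp
      qed
      finally show ?thesis .
    qed
    hence "dirichlet (\<lambda>x. f t x - g t x) \<le> 2 * dirichlet (f t) + 2 * dirichlet (g t)"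
      unfolding dirichlet_def sum_distrib_left sum.distrib[symmetric] by (intro sum_mono)
    thus "dirichlet (\<lambda>x. f t x - g t x) \<le> 2 * B1 + 2 * B2"
      using B1(2)[OF t] B2(2)[OF t] by linarith
  qed (use B1 B2 in simp)
qed

text \<open>Gronwall is applied for each \<open>N\<close>, and then \<open>N\<close> tends to
  infinity at fixed \<open>t\<close>. The solution-dependent constants \<open>B\<close>,
  \<open>D1\<close> and \<open>D2\<close> disappear in that limit, while \<open>X\<close> is
  independent of \<open>N\<close>.\<close>

lemma dirichlet_w_final:
  assumes t: "t \<in> {0..T}"
  defines "X \<equiv> exp (2 * integral {0..T} a + (3 * M + 1) * T)"
  shows "dirichlet (w t) \<le> \<epsilon>\<^sup>2 * (4 * T * M * (336 * S\<^sup>2) * X + 2 * (336 * S\<^sup>2))"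
proof -
  obtain B where B: "0 \<le> B" "\<And>t x. t \<in> {0..T} \<Longrightarrow> x \<in> cbox 0 1 \<Longrightarrow> (\<Sum>i\<in>UNIV. (pderiv_at i (\<phi>bar t) x)\<^sup>2) \<le> B"
    by (rule dirichlet_bounded[OF T evolutions(4)]) blast
  obtain D1 where D1: "0 \<le> D1" "\<And>t. t \<in> {0..T} \<Longrightarrow> dirichlet (\<theta> t) \<le> D1"
    by (rule evolution_diff[OF evolutions(1,3)]) (simp add: \<theta>_def[abs_def])
  have "\<exists>D. 0 \<le> D \<and> (\<forall>t\<in>{0..T}. dirichlet (pderiv_at i (w t)) \<le> D)" for i
  proof -
    obtain D where D: "0 \<le> D" "\<And>t. t \<in> {0..T} \<Longrightarrow> dirichlet (\<lambda>x. pderiv_at i (\<psi> t) x - pderiv_at i (\<phi>bar t) x) \<le> D"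
      by (rule evolution_diff[OF smooth_torus_evolution_pderiv[OF T evolutions(2)] smooth_torus_evolution_pderiv[OF T evolutions(4)]])
        blast
    have "pderiv_at i (w t) = (\<lambda>x. pderiv_at i (\<psi> t) x - pderiv_at i (\<phi>bar t) x)" if "t \<in> {0..T}" for t
      using pderiv_at_w[OF that] by blast
    thus ?thesis using D by auto
  qed
  then have "\<forall>i. \<exists>D. 0 \<le> D \<and> (\<forall>t\<in>{0..T}. dirichlet (pderiv_at i (w t)) \<le> D)" ..
  from choice[OF this]
  obtain D where D: "\<And>i. 0 \<le> D i" "\<And>i t. t \<in> {0..T} \<Longrightarrow> dirichlet (pderiv_at i (w t)) \<le> D i"
    by blast
  define D2 where "D2 = (\<Sum>i\<in>UNIV. D i)"
  have D2: "0 \<le> D2" "\<And>t. t \<in> {0..T} \<Longrightarrow> (\<Sum>i\<in>UNIV. dirichlet (pderiv_at i (w t))) \<le> D2"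
    unfolding D2_def by (auto intro!: sum_nonneg sum_mono D)
  let ?b = "\<lambda>t. 2 * a t + (3 * M + 1)" and ?Q = "336 * S\<^sup>2" and ?K = "M * D2 + B * D1"
  have K: "0 \<le> ?K" using M_nonneg D2 B D1 by simp
  have int_b: "integral {0..T} ?b = 2 * integral {0..T} a + (3 * M + 1) * T"
  proof -
    have "(\<lambda>t. 2 * a t) integrable_on {0..T}"
      by (intro integrable_continuous_real continuous_intros a_continuous)
    from integral_add[OF this integrable_const_ivl[of "3 * M + 1" 0 T]]
    show ?thesis using T by (simp add: mult.commute)
  qed
  have energy: "hneg N (\<theta> t) \<le> T * (2 * M * \<epsilon>\<^sup>2 * ?Q + ?K / (real N)\<^sup>2) * X" if N: "0 < N" for N
    unfolding X_def int_b[symmetric]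
  proof (rule Gronwall_integral[OF T hneg_theta_derivative _ _ _ _ _ t])
    show "energy_deriv N t \<le> ?b t * hneg N (\<theta> t) + (2 * M * \<epsilon>\<^sup>2 * ?Q + ?K / (real N)\<^sup>2)" if t: "t \<in> {0..T}" for t
      using energy_deriv_le[OF t N B(2)[OF t] B(1) D1(2)[OF t] D2(2)[OF t]] by (simp add: add.assoc)
    show "continuous_on {0..T} ?b" by (intro continuous_intros a_continuous)
    show "0 \<le> ?b t" if "t \<in> {0..T}" for t using a_nonneg[OF that] M_nonneg by simp
    show "0 \<le> 2 * M * \<epsilon>\<^sup>2 * ?Q + ?K / (real N)\<^sup>2" using M_nonneg K by simp
    have "\<theta> 0 x = 0" for x by (simp add: \<theta>_def init)
    thus "hneg N (\<theta> 0) = 0" by (simp add: hneg_def coef_def)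
  qed
  have bound: "dirichlet (w t) \<le> 2 * (T * (2 * M * \<epsilon>\<^sup>2 * ?Q + ?K / (real N)\<^sup>2) * X) + 2 * \<epsilon>\<^sup>2 * ?Q + D2 / (real N)\<^sup>2"
    if N: "0 < N" for N
  proof -
    have "(real N)\<^sup>2 * dirichlet (w t) \<le> (real N)\<^sup>2 * (2 * hneg N (\<theta> t) + 2 * \<epsilon>\<^sup>2 * ?Q) + D2"
      using dirichlet_w_le[OF t, of N] D2(2)[OF t] by linarith
    hence "(real N)\<^sup>2 * dirichlet (w t) \<le> (real N)\<^sup>2 * (2 * hneg N (\<theta> t) + 2 * \<epsilon>\<^sup>2 * ?Q + D2 / (real N)\<^sup>2)"
      using N by (simp add: distrib_left)
    hence "dirichlet (w t) \<le> 2 * hneg N (\<theta> t) + 2 * \<epsilon>\<^sup>2 * ?Q + D2 / (real N)\<^sup>2"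
      using N by simp
    thus ?thesis using energy[OF N] by linarith
  qed
  have lim0: "(\<lambda>N. c / (real N)\<^sup>2) \<longlonglongrightarrow> 0" for c :: real
  proof -
    have "(\<lambda>N. c / real N * (1 / real N)) \<longlonglongrightarrow> 0 * 0"
      by (intro tendsto_mult lim_const_over_n)
    thus ?thesis by (simp add: power2_eq_square)
  qed
  have "(\<lambda>N. 2 * (T * (2 * M * \<epsilon>\<^sup>2 * ?Q + ?K / (real N)\<^sup>2) * X) + 2 * \<epsilon>\<^sup>2 * ?Q + D2 / (real N)\<^sup>2)
      \<longlonglongrightarrow> 2 * (T * (2 * M * \<epsilon>\<^sup>2 * ?Q + 0) * X) + 2 * \<epsilon>\<^sup>2 * ?Q + 0"
    by (intro tendsto_intros lim0)
  hence "dirichlet (w t) \<le> 2 * (T * (2 * M * \<epsilon>\<^sup>2 * ?Q + 0) * X) + 2 * \<epsilon>\<^sup>2 * ?Q + 0"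
    by (rule LIMSEQ_le_const) (use bound in \<open>auto intro!: exI[of _ 1]\<close>)
  thus ?thesis by (simp add: algebra_simps)
qed

end

theorem theorem6p4:
  shows "\<exists>\<eta>0::real. \<eta>0 > 0 \<and>
    (\<exists>C :: real \<Rightarrow> real \<Rightarrow> real \<Rightarrow> real.
      \<forall>(T::real) (\<rho>0 :: real^2 \<Rightarrow> real)
        (\<rho>bar :: real \<Rightarrow> real^2 \<Rightarrow> real) (\<phi>bar :: real \<Rightarrow> real^2 \<Rightarrow> real)
        (\<epsilon>::real) (\<rho> :: real \<Rightarrow> real^2 \<Rightarrow> real) (\<psi> :: real \<Rightarrow> real^2 \<Rightarrow> real).
        T > 0 \<longrightarrow>
        smooth_euler_solution T \<rho>bar \<phi>bar \<longrightarrow>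
        \<epsilon> > 0 \<longrightarrow>
        smooth_monge_ampere_solution \<epsilon> T \<rho> \<psi> \<longrightarrow>
        \<rho> 0 = \<rho>0 \<longrightarrow> \<rho>bar 0 = \<rho>0 \<longrightarrow>
        (\<forall>t\<in>{0..T}. \<epsilon> * Linf_norm (hessian (\<psi> t)) \<le> \<eta>0) \<longrightarrow>
        (SUP t\<in>{0..T}. ereal (L2_norm (\<lambda>x. grad (\<psi> t) x - grad (\<phi>bar t) x)))
          \<le> ereal (C T (Linf_L2_norm \<rho>0)
                (L1_Linf_norm T (\<lambda>t x. jacobian (perp_grad (\<phi>bar t)) (at x))) * \<epsilon>))"
proof (intro exI conjI allI impI)
  \<comment> \<open>This fixes the threshold \<open>\<eta>0\<close> to 1.\<close>
  show "(0::real) < 1" by simp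
  fix T :: real and \<rho>0 :: "real^2 \<Rightarrow> real" and \<rho>bar \<phi>bar :: "real \<Rightarrow> real^2 \<Rightarrow> real"
    and \<epsilon> :: real and \<rho> \<psi> :: "real \<Rightarrow> real^2 \<Rightarrow> real"
  assume T: "T > 0" and euler: "smooth_euler_solution T \<rho>bar \<phi>bar" and \<epsilon>: "\<epsilon> > 0"
    and MA: "smooth_monge_ampere_solution \<epsilon> T \<rho> \<psi>" and init0: "\<rho> 0 = \<rho>0" "\<rho>bar 0 = \<rho>0"
    and small: "\<forall>t\<in>{0..T}. \<epsilon> * Linf_norm (hessian (\<psi> t)) \<le> 1"
  interpret monge_ampere_vs_euler T \<epsilon> \<rho>bar \<phi>bar \<rho> \<psi>
    by unfold_locales (use T euler \<epsilon> MA init0 small in auto)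
  let ?J = "L1_Linf_norm T (\<lambda>t x. jacobian (perp_grad (\<phi>bar t)) (at x))"
  \<comment> \<open>The bound for the Dirichlet energy of \<open>w\<close>, with \<open>P\<close> in
    place of \<open>M\<close> and \<open>P\<close> squared in place of \<open>S\<close>; the root
    undoes the squaring of the norm. Both replacements are monotone because one maximum norm
    \<open>P\<close> dominates \<open>M\<close> and the root of \<open>S\<close>.\<close>
  let ?C = "\<lambda>T P J. sqrt (4 * T * P * (336 * (P\<^sup>2)\<^sup>2) * exp (2 * J + (3 * P + 1) * T) + 2 * (336 * (P\<^sup>2)\<^sup>2))"
  define P where "P = Linf_L2_norm \<rho>0"
  have MP: "M \<le> P" by (simp add: M_def P_def Linf_L2_norm_def init0)
  have S0: "0 \<le> S" by (simp add: S_def avg_nonneg)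
  have "sqrt S \<le> P" by (simp add: S_def P_def Linf_L2_norm_def L2_norm_def init0)
  hence SP: "S \<le> P\<^sup>2" using S0 by (intro sqrt_le_D)
  have S2: "S\<^sup>2 \<le> (P\<^sup>2)\<^sup>2" using SP S0 by (rule power_mono)
  show "(SUP t\<in>{0..T}. ereal (L2_norm (\<lambda>x. grad (\<psi> t) x - grad (\<phi>bar t) x)))
      \<le> ereal (?C T (Linf_L2_norm \<rho>0) ?J * \<epsilon>)"
  proof (rule SUP_least)
    fix t assume t: "t \<in> {0..T}"
    have "dirichlet (w t) \<le> \<epsilon>\<^sup>2 * (4 * T * M * (336 * S\<^sup>2) * exp (2 * ?J + (3 * M + 1) * T) + 2 * (336 * S\<^sup>2))"
      using dirichlet_w_final[OF t] unfolding integral_a .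
    also have "\<dots> \<le> \<epsilon>\<^sup>2 * (4 * T * P * (336 * (P\<^sup>2)\<^sup>2) * exp (2 * ?J + (3 * P + 1) * T) + 2 * (336 * (P\<^sup>2)\<^sup>2))"
      using M_nonneg MP S2 T
      by (intro mult_left_mono add_mono mult_mono order_refl mult_right_mono) auto
    finally have "sqrt (dirichlet (w t)) \<le> sqrt (\<epsilon>\<^sup>2 * (?C T P ?J)\<^sup>2)"
      using M_nonneg MP T by simp
    hence "sqrt (dirichlet (w t)) \<le> ?C T P ?J * \<epsilon>"
      using \<epsilon> M_nonneg MP T by (simp add: real_sqrt_mult mult.commute)
    moreover have "L2_norm (\<lambda>x. grad (\<psi> t) x - grad (\<phi>bar t) x) = sqrt (dirichlet (w t))"
      unfolding w_def[abs_def] by (rule L2_norm_grad_diff[OF torus_C(2)[OF t] torus_C(4)[OF t]])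
    ultimately show "ereal (L2_norm (\<lambda>x. grad (\<psi> t) x - grad (\<phi>bar t) x))
        \<le> ereal (?C T (Linf_L2_norm \<rho>0) ?J * \<epsilon>)"
      by (simp add: P_def)
  qed
qed

end
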